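(* Let $r\ge1$ be an integer. A function $v\in L_r^1(T^{\rm ps})$ is uniquely determined by the following degrees of freedom: (a) $v(z_i)$, $1\le i\le3$ ($6$ DOFs); (b) $\int_{e_i}v\cdot n_i$, $1\le i\le3$, if $r=1$; (c) $[\![\operatorname{div}v]\!](z_{3+i})$, $1\le i\le3$ ($3$ DOFs); (d) $v(z_{3+i})\cdot n_i$, $1\le i\le3$, if $r\ge2$ ($3$ DOFs); (e) $\int_ev\cdot w$ for all $w\in[\mathcal P_{r-2}(e)]^2$, $e\in\mathcal E^b(T^{\rm ps})$ ($12(r-1)$ DOFs); (f) $\int_Tv\cdot\operatorname{rot}w$ for all $w\in\mathring S_{r+1}^0(T^{\rm ps})$ ($3(r-1)(r-2)$ DOFs); (g) $\int_T(\operatorname{div}v)\,w$ for all $w\in\mathring{\mathcal V}_{r-1}^2(T^{\rm ps})$ ($3r(r+1)-4$ DOFs).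
   Context: Let $T\subset\mathbb R^2$ be a (closed, nondegenerate) triangle with vertices $z_1,z_2,z_3$, labelled counter-clockwise, and let $z_0$ be a point in the interior of $T$. Let $e_i=[z_{i+1},z_{i+2}]$ (indices $1,2,3$ modulo $3$) be the edge opposite $z_i$, with outward unit normal $n_i$, and let $z_{3+i}$ be a point in the relative interior of $e_i$, $i=1,2,3$. The Powell--Sabin split $T^{\rm ps}=\{T_1,\dots,T_6\}$ is the triangulation of $T$ obtained by connecting $z_0$ to each of $z_1,\dots,z_6$. $\mathcal E^b(T^{\rm ps})$ is the set of the six boundary edges of $T^{\rm ps}$ (each $e_i$ is divided in two by $z_{3+i}$). For scalar $q$, $\operatorname{rot}q=(\partial q/\partial x_2,-\partial q/\partial x_1)^\top$. $\mathcal P_k(S)$ is the space of polynomials of degree $\le k$ on $S$, with $\mathcal P_k(S)=\{0\}$ for $k<0$; $\mathcal P_k(T^{\rm ps})=\{q\in L^2(T): q|_S\in\mathcal P_k(S)\ \forall S\in T^{\rm ps}\}$; $L_k^1(T^{\rm ps})=[\mathcal P_k(T^{\rm ps})\cap C(T)]^2$; $\mathring S_k^0(T^{\rm ps})=\{v\in\mathcal P_k(T^{\rm ps})\cap C(T):\operatorname{rot}v\in[C(T)]^2,\ v=0\text{ and }\operatorname{rot}v=0\text{ on }\partial T\}$; $\mathring{\mathcal V}_k^2(T^{\rm ps})=\{q\in\mathcal P_k(T^{\rm ps}): q\text{ is continuous at }z_4,z_5,z_6,\ \int_Tq=0\}$. Jump: if $K_1,K_2\in T^{\rm ps}$ are the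 two triangles having $z_{3+i}$ as a vertex, with common edge $e$, and $m_j$ is the unit normal to $e$ pointing out of $K_j$, then $[\![p]\!](z_{3+i})=p|_{K_1}(z_{3+i})m_1+p|_{K_2}(z_{3+i})m_2=(p|_{K_1}(z_{3+i})-p|_{K_2}(z_{3+i}))m_1$; it counts as one scalar degree of freedom. "Uniquely determined by the degrees of freedom" means that the degrees of freedom are unisolvent: their number equals the dimension of the space (here $\dim L_r^1(T^{\rm ps})=6r^2+6r+2$), and the only function in the space at which all of them vanish is $0$. *)

theory Defs
  imports "HOL-Analysis.Analysis" "HOL-Library.Function_Algebras"
begin

text \<open>Pointwise vector space structure on functions, so that the library notions
  \<^const>\<open>dim\<close>, \<^const>\<open>span\<close> etc. apply to the function spaces below.\<close>

instantiation "fun" :: (type, real_vector) real_vector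
begin

definition scaleR_fun :: "real \<Rightarrow> ('a \<Rightarrow> 'b) \<Rightarrow> 'a \<Rightarrow> 'b"
  where "scaleR_fun c f = (\<lambda>x. c *\<^sub>R f x)"

instance
  by standard (auto simp: scaleR_fun_def fun_eq_iff scaleR_add_right scaleR_add_left)

end

type_synonym pt = "real^2"

subsection \<open>The Powell--Sabin split\<close>

text \<open>The points \<open>z\<^sub>0, \<dots>, z\<^sub>6\<close> are given by a function \<open>z :: nat \<Rightarrow> pt\<close>, of which only the
  values at \<open>0, \<dots>, 6\<close> matter. \<open>nx\<close> is the successor on \<open>{1, 2, 3}\<close> modulo \<open>3\<close>.\<close>

definition nx :: "nat \<Rightarrow> nat"
  where "nx i = i mod 3 + 1"

definition ccw :: "pt \<Rightarrow> pt \<Rightarrow> pt \<Rightarrow> bool"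
  where "ccw a b c \<longleftrightarrow> 0 < (b - a) $ 1 * (c - a) $ 2 - (b - a) $ 2 * (c - a) $ 1"

definition tri :: "(nat \<Rightarrow> pt) \<Rightarrow> pt set"
  where "tri z = convex hull {z 1, z 2, z 3}"

definition edge :: "(nat \<Rightarrow> pt) \<Rightarrow> nat \<Rightarrow> pt set"
  where "edge z i = closed_segment (z (nx i)) (z (nx (nx i)))"

definition powell_sabin_points :: "(nat \<Rightarrow> pt) \<Rightarrow> bool"
  where "powell_sabin_points z \<longleftrightarrow>
    ccw (z 1) (z 2) (z 3) \<and> z 0 \<in> interior (tri z) \<and>
    (\<forall>i\<in>{1..3}. z (3 + i) \<in> rel_interior (edge z i))"

text \<open>The two triangles having \<open>z\<^bsub>3+i\<^esub>\<close> as a vertex.\<close>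

definition K1 :: "(nat \<Rightarrow> pt) \<Rightarrow> nat \<Rightarrow> pt set"
  where "K1 z i = convex hull {z 0, z (nx i), z (3 + i)}"

definition K2 :: "(nat \<Rightarrow> pt) \<Rightarrow> nat \<Rightarrow> pt set"
  where "K2 z i = convex hull {z 0, z (3 + i), z (nx (nx i))}"

definition ps_split :: "(nat \<Rightarrow> pt) \<Rightarrow> pt set set"
  where "ps_split z = K1 z ` {1..3} \<union> K2 z ` {1..3}"

text \<open>Boundary edges of the split, given by their end points.\<close>

definition bdry_edges :: "(nat \<Rightarrow> pt) \<Rightarrow> (pt \<times> pt) set"
  where "bdry_edges z = (\<lambda>i. (z (nx i), z (3 + i))) ` {1..3}
                      \<union> (\<lambda>i. (z (3 + i), z (nx (nx i)))) ` {1..3}"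

definition outer_normal :: "pt set \<Rightarrow> pt set \<Rightarrow> pt"
  where "outer_normal K e = (THE n. norm n = 1 \<and> (\<forall>x\<in>e. \<forall>y\<in>e. n \<bullet> (x - y) = 0) \<and>
                                    (\<forall>x\<in>K. \<forall>y\<in>e. n \<bullet> (x - y) \<le> 0))"

text \<open>Integral over the segment \<open>[a, b]\<close> with respect to arc length.\<close>

definition segment_integral :: "pt \<Rightarrow> pt \<Rightarrow> (pt \<Rightarrow> real) \<Rightarrow> real"
  where "segment_integral a b f = dist a b * integral {0..1} (\<lambda>t. f (linepath a b t))"

subsection \<open>Differential operators\<close>

text \<open>Derivatives are taken within a set, so that they make sense up to its boundary: on a
  convex set with nonempty interior, such as a triangle, the derivative within the set is
  unique at every point of the set. In particular, \<open>divergence v K\<close> is the divergence of the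
  restriction of \<open>v\<close> to \<open>K\<close>.\<close>

definition divergence :: "(pt \<Rightarrow> pt) \<Rightarrow> pt set \<Rightarrow> pt \<Rightarrow> real"
  where "divergence v K x = (\<Sum>i\<in>UNIV. frechet_derivative v (at x within K) (axis i 1) $ i)"

definition rot :: "(pt \<Rightarrow> real) \<Rightarrow> pt set \<Rightarrow> pt \<Rightarrow> pt"
  where "rot q K x = vector [frechet_derivative q (at x within K) (axis 2 1),
                             - frechet_derivative q (at x within K) (axis 1 1)]"

subsection \<open>Function spaces\<close>

text \<open>A function on a set \<open>S\<close> is represented by its extension by zero outside \<open>S\<close>, so that
  equality of functions and dimensions refer to functions on \<open>S\<close>. The degree bound is an
  integer; for a negative one the sum is empty and the space is \<open>{0}\<close>.\<close>

definition poly_on :: "int \<Rightarrow> pt set \<Rightarrow> (pt \<Rightarrow> real) set"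
  where "poly_on k S = {q. (\<exists>c. \<forall>x\<in>S. q x =
            (\<Sum>(i, j) | int i + int j \<le> k. c i j * (x $ 1) ^ i * (x $ 2) ^ j)) \<and>
          (\<forall>x. x \<notin> S \<longrightarrow> q x = 0)}"

definition vpoly_on :: "int \<Rightarrow> pt set \<Rightarrow> (pt \<Rightarrow> pt) set"
  where "vpoly_on k S = {w. \<forall>i. (\<lambda>x. w x $ i) \<in> poly_on k S}"

text \<open>A piecewise polynomial function is in general two-valued on the common edges of the
  triangles. The corresponding element of \<open>L\<^sup>2(T)\<close> is represented by the family
  of its restrictions \<open>q K = q|\<^sub>K\<close>, for \<open>K\<close> in the split.\<close>

definition pw_poly :: "int \<Rightarrow> (nat \<Rightarrow> pt) \<Rightarrow> (pt set \<Rightarrow> pt \<Rightarrow> real) set"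
  where "pw_poly k z = {q. (\<forall>K\<in>ps_split z. q K \<in> poly_on k K) \<and> (\<forall>K. K \<notin> ps_split z \<longrightarrow> q K = 0)}"

definition pieces :: "(nat \<Rightarrow> pt) \<Rightarrow> (pt \<Rightarrow> real) \<Rightarrow> pt set \<Rightarrow> pt \<Rightarrow> real"
  where "pieces z q = (\<lambda>K x. if K \<in> ps_split z \<and> x \<in> K then q x else 0)"

definition cont_pw_poly :: "int \<Rightarrow> (nat \<Rightarrow> pt) \<Rightarrow> (pt \<Rightarrow> real) set"
  where "cont_pw_poly k z = {q. pieces z q \<in> pw_poly k z \<and> continuous_on (tri z) q \<and>
                                (\<forall>x. x \<notin> tri z \<longrightarrow> q x = 0)}"

text \<open>The spaces \<open>L\<^sub>k\<^sup>1\<close>, \<open>S\<^sub>k\<^sup>0\<close> (with zero boundary values) and \<open>V\<^sub>k\<^sup>2\<close> (continuous at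
  \<open>z\<^sub>4, z\<^sub>5, z\<^sub>6\<close> and with zero mean) on the split.\<close>

definition L1_space :: "int \<Rightarrow> (nat \<Rightarrow> pt) \<Rightarrow> (pt \<Rightarrow> pt) set"
  where "L1_space k z = {v. \<forall>i. (\<lambda>x. v x $ i) \<in> cont_pw_poly k z}"

definition S0_space :: "int \<Rightarrow> (nat \<Rightarrow> pt) \<Rightarrow> (pt \<Rightarrow> real) set"
  where "S0_space k z = {v \<in> cont_pw_poly k z.
           v differentiable_on tri z \<and> continuous_on (tri z) (rot v (tri z)) \<and>
           (\<forall>x\<in>frontier (tri z). v x = 0 \<and> rot v (tri z) x = 0)}"

definition V2_space :: "int \<Rightarrow> (nat \<Rightarrow> pt) \<Rightarrow> (pt set \<Rightarrow> pt \<Rightarrow> real) set"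
  where "V2_space k z = {q \<in> pw_poly k z.
           (\<forall>i\<in>{1..3}. q (K1 z i) (z (3 + i)) = q (K2 z i) (z (3 + i))) \<and>
           (\<Sum>K\<in>ps_split z. integral K (q K)) = 0}"

definition jump :: "(nat \<Rightarrow> pt) \<Rightarrow> (pt set \<Rightarrow> pt \<Rightarrow> real) \<Rightarrow> nat \<Rightarrow> pt"
  where "jump z p i =
    p (K1 z i) (z (3 + i)) *\<^sub>R outer_normal (K1 z i) (closed_segment (z 0) (z (3 + i))) +
    p (K2 z i) (z (3 + i)) *\<^sub>R outer_normal (K2 z i) (closed_segment (z 0) (z (3 + i)))"

text \<open>Number of degrees of freedom: a family of functionals indexed linearly by a test space
  counts with the dimension of that space, and the (vector-valued) jump at a point counts
  once, being a multiple of a fixed normal. The summands correspond to the vertex values,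
  the edge fluxes, the jumps, the normal components at the edge points, and the moments on
  the boundary edges, against rotations, and of the divergence.\<close>

definition num_edge_dofs :: "nat \<Rightarrow> (nat \<Rightarrow> pt) \<Rightarrow> nat"
  where "num_edge_dofs r z =
    (\<Sum>(a, b)\<in>bdry_edges z. dim (vpoly_on (int r - 2) (closed_segment a b)))"

definition num_dofs :: "nat \<Rightarrow> (nat \<Rightarrow> pt) \<Rightarrow> nat"
  where "num_dofs r z = 3 * DIM(pt) + (if r = 1 then 3 else 0) + 3 + (if r \<ge> 2 then 3 else 0)
    + num_edge_dofs r z + dim (S0_space (int r + 1) z) + dim (V2_space (int r - 1) z)"

end

theory Submission
  imports Defs "HOL-Computational_Algebra.Polynomial"
begin

text \<open>Let \<open>v\<close> have vanishing degrees of freedom. On an edge of \<open>T\<close> the normal component of \<open>v\<close> vanishes at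
  \<open>z\<^bsub>3+i\<^esub>\<close>, and then the vanishing jump of \<open>div v\<close> says that the tangential component is \<open>C\<^sup>1\<close> there. In both
  cases integration by parts of \<open>p p''\<close> against the edge moments gives \<open>\<integral>p'\<^sup>2 = 0\<close>, hence \<open>v = 0\<close> on the boundary.
  Now \<open>div v\<close> is itself an admissible test function in (g), so \<open>div v = 0\<close> and \<open>v = rot q\<close> with \<open>q\<close> a \<open>C\<^sup>1\<close> spline
  with zero boundary values; testing (f) with \<open>q\<close> yields \<open>v = 0\<close>.

  Let \<open>\<mu>\<close> be the piecewise linear function with \<open>\<mu>(z\<^sub>0) = 1\<close> and \<open>\<mu> = 0\<close> on the boundary. Every space of
  continuous piecewise polynomials is filtered by repeated division by \<open>\<mu>\<close>. For the \<open>C\<^sup>1\<close> splines with zero boundary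
  values, which are multiples of \<open>\<mu>\<^sup>2\<close>, the quotients of this filtration have dimension at most \<open>6(j - 1)\<close> in degree
  \<open>j\<close>, which gives the upper bound \<open>3(r - 1)(r - 2)\<close>. The lower bound follows by rank-nullity for the divergence on the
  fields that vanish on the boundary.\<close>

subsection \<open>Finite-dimensional subspaces\<close>

text \<open>Injectivity alone would not settle the count: equality with the dimension of
  \<open>L1_space\<close> requires the exact dimension of the C^1 splines. Counting smoothness
  conditions across the spokes is delicate at \<open>z 0\<close>, where such conditions may depend
  on each other according to the slopes of the spokes. Division by \<open>MU\<close> moves every
  condition to the boundary. At \<open>z (3 + i)\<close> the two outer edges are collinear, so
  \<open>MU\<close> has the same affine formula on both sides and the C^1 condition along the edge
  survives each division. At a corner the outer edges are not collinear, \<open>MU\<close> has a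
  kink, and a factor left after dividing a C^1 spline by \<open>MU\<close> must vanish. What remains
  on an edge is a function of one variable, zero at the corners and C^1 at the split point; moments
  of order up to j - 2 on its two halves determine it, which is the origin of 6 (j - 1). The same
  univariate fact treats the boundary values of v. For the lower bound, the fields vanishing on the
  boundary have dimension at least 2 (3 r^2 - 3 r + 1) and the test space of (g) has dimension 3 r
  (r + 1) - 4; the difference is 3 (r - 1) (r - 2).\<close>

definition lin_on :: "'a::real_vector set \<Rightarrow> ('a \<Rightarrow> 'b::real_vector) \<Rightarrow> bool"
  where "lin_on S f \<longleftrightarrow> (\<forall>x\<in>S. \<forall>y\<in>S. f (x + y) = f x + f y) \<and> (\<forall>c. \<forall>x\<in>S. f (c *\<^sub>R x) = c *\<^sub>R f x)"

text \<open>For an infinite-dimensional space \<open>dim\<close> is 0, the cardinality of an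
  infinite basis. A bound on \<open>dim\<close> alone would say nothing there; here it comes with a
  finite spanning set.\<close>

definition dimle :: "'a::real_vector set \<Rightarrow> nat \<Rightarrow> bool"
  where "dimle S n \<longleftrightarrow> (\<exists>B. finite B \<and> card B \<le> n \<and> S \<subseteq> span B)"

lemma lin_onI:
  assumes "\<And>x y. x \<in> S \<Longrightarrow> y \<in> S \<Longrightarrow> f (x + y) = f x + f y"
    and "\<And>c x. x \<in> S \<Longrightarrow> f (c *\<^sub>R x) = c *\<^sub>R f x"
  shows "lin_on S f"
  using assms by (auto simp: lin_on_def)

lemma lin_on_subset: "lin_on S f \<Longrightarrow> T \<subseteq> S \<Longrightarrow> lin_on T f"
  unfolding lin_on_def by blast

lemma linear_imp_lin_on: "linear f \<Longrightarrow> lin_on S f"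
  by (simp add: lin_on_def linear_add linear_scale)

lemma lin_on_diff:
  assumes "subspace S" "lin_on S f" "x \<in> S" "y \<in> S"
  shows "f (x - y) = f x - f y"
proof -
  have "f (x + (-1) *\<^sub>R y) = f x + (-1) *\<^sub>R f y"
    using assms unfolding lin_on_def by (metis subspace_scale)
  then show ?thesis by simp
qed

lemma lin_on_sum:
  assumes "subspace S" "lin_on S f" "finite I" "\<And>i. i \<in> I \<Longrightarrow> b i \<in> S"
  shows "f (\<Sum>i\<in>I. c i *\<^sub>R b i) = (\<Sum>i\<in>I. c i *\<^sub>R f (b i))"
  using assms(3,4)
proof (induction I rule: finite_induct)
  case empty
  have "f (0 *\<^sub>R 0) = 0 *\<^sub>R f 0"
    using assms(1,2) subspace_0 unfolding lin_on_def by blast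
  then show ?case by simp
next
  case (insert x F)
  have "(\<Sum>i\<in>F. c i *\<^sub>R b i) \<in> S"
    using insert assms(1) by (intro subspace_sum) (auto intro: subspace_scale)
  moreover have "c x *\<^sub>R b x \<in> S" using insert assms(1) by (auto intro: subspace_scale)
  ultimately have "f (c x *\<^sub>R b x + (\<Sum>i\<in>F. c i *\<^sub>R b i)) = f (c x *\<^sub>R b x) + f (\<Sum>i\<in>F. c i *\<^sub>R b i)"
    using assms(2) unfolding lin_on_def by blast
  moreover have "f (c x *\<^sub>R b x) = c x *\<^sub>R f (b x)"
    using assms(2) insert unfolding lin_on_def by blast
  ultimately show ?case using insert by auto
qed

lemma subspace_kernels:
  assumes "subspace S" "\<And>i. i \<in> I \<Longrightarrow> lin_on S (l i)"
  shows "subspace {x \<in> S. \<forall>i\<in>I. l i x = 0}"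
proof -
  have "l i 0 = 0" if "i \<in> I" for i
    using lin_on_diff[OF assms(1) assms(2)[OF that], of 0 0] subspace_0[OF assms(1)] by simp
  then show ?thesis
    using assms unfolding subspace_def lin_on_def by auto
qed

lemma subspace_kernel:
  assumes "subspace S" "lin_on S f"
  shows "subspace {x \<in> S. f x = 0}"
  using subspace_kernels[of S "{()}" "\<lambda>_. f"] assms by simp

lemma dimle_imp: "dimle S n \<Longrightarrow> dim S \<le> n"
  unfolding dimle_def using dim_le_card by (meson le_trans)

lemma dimle_mono: "dimle T m \<Longrightarrow> S \<subseteq> T \<Longrightarrow> m \<le> n \<Longrightarrow> dimle S n"
  unfolding dimle_def by (meson le_trans order_trans)

lemma dimle_basis:
  fixes S :: "'a::real_vector set"
  assumes "dimle S n"
  obtains B where "B \<subseteq> S" "independent B" "finite B" "S \<subseteq> span B" "card B = dim S"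
proof -
  obtain B where B: "B \<subseteq> S" "independent B" "S \<subseteq> span B" "card B = dim S"
    by (rule basis_exists)
  obtain C where "finite C" "S \<subseteq> span C" using assms unfolding dimle_def by blast
  then have "finite B" using independent_span_bound[of C B] B by auto
  then show thesis using B that by blast
qed

lemma dimle_dim: "dimle S n \<Longrightarrow> dimle S (dim S)"
  by (erule dimle_basis) (auto simp: dimle_def)

lemma dimle_functional:
  fixes l :: "'a::real_vector \<Rightarrow> real"
  assumes S: "subspace S" and l: "lin_on S l" and k: "dimle {x \<in> S. l x = 0} n"
  shows "dimle S (Suc n)"
proof (cases "\<exists>x0\<in>S. l x0 \<noteq> 0")
  case True
  then obtain x0 where x0: "x0 \<in> S" "l x0 \<noteq> 0" by blast
  obtain B where B: "finite B" "card B \<le> n" "{x \<in> S. l x = 0} \<subseteq> span B"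
    using k unfolding dimle_def by blast
  have "x \<in> span (insert x0 B)" if x: "x \<in> S" for x
  proof -
    define y where "y = x - (l x / l x0) *\<^sub>R x0"
    have "l y = l x - l ((l x / l x0) *\<^sub>R x0)"
      unfolding y_def using S l x x0 by (intro lin_on_diff) (auto intro: subspace_scale)
    also have "l ((l x / l x0) *\<^sub>R x0) = l x"
      using l x0 unfolding lin_on_def by simp
    finally have "y \<in> span B"
      using B(3) S x x0 unfolding y_def by (auto intro: subspace_diff subspace_scale)
    then have "y \<in> span (insert x0 B)" using span_mono[of B "insert x0 B"] by auto
    moreover have "x = y + (l x / l x0) *\<^sub>R x0" by (simp add: y_def)
    ultimately show ?thesis by (metis insertI1 span_add span_base span_scale)
  qed
  then show ?thesis unfolding dimle_def using B
    by (intro exI[of _ "insert x0 B"]) (auto simp: card_insert_if)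
next
  case False
  then have "S = {x \<in> S. l x = 0}" by auto
  then show ?thesis using k by (metis dimle_mono le_SucI order_refl)
qed

text \<open>Serves two purposes: an upper bound for \<open>S\<close> when the common kernel is
  controlled, and a lower bound for the kernel when \<open>dim S\<close> is known.\<close>

lemma dimle_functionals:
  fixes l :: "'i \<Rightarrow> 'a::real_vector \<Rightarrow> real"
  assumes "finite I" "subspace S" "\<And>i. i \<in> I \<Longrightarrow> lin_on S (l i)"
    and "dimle {x \<in> S. \<forall>i\<in>I. l i x = 0} n"
  shows "dimle S (card I + n)"
  using assms
proof (induction I arbitrary: S rule: finite_induct)
  case empty
  then show ?case by simp
next
  case (insert j I)
  let ?S = "{x \<in> S. l j x = 0}"
  have "dimle ?S (card I + n)"
  proof (rule insert.IH)
    show "subspace ?S" using insert.prems by (intro subspace_kernel) auto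
    show "lin_on ?S (l i)" if "i \<in> I" for i
      using insert.prems(2)[of i] that by (auto intro: lin_on_subset)
    have "{x \<in> ?S. \<forall>i\<in>I. l i x = 0} = {x \<in> S. \<forall>i\<in>insert j I. l i x = 0}" by auto
    then show "dimle {x \<in> ?S. \<forall>i\<in>I. l i x = 0} n" using insert.prems(3) by simp
  qed
  then have "dimle S (Suc (card I + n))"
    using insert.prems by (intro dimle_functional) auto
  then show ?case using insert by simp
qed

text \<open>A vector outside the kernel extends a basis of the kernel to an independent set. Finite
  dimension enters through \<open>dimle S n\<close>; with the default value 0 of \<open>dim\<close>
  the equation would fail.\<close>

lemma dim_hyperplane:
  fixes l :: "'a::real_vector \<Rightarrow> real"
  assumes S: "subspace S" and l: "lin_on S l" and d: "dimle S n" and x0: "x0 \<in> S" "l x0 \<noteq> 0"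
  shows "dim S = Suc (dim {x \<in> S. l x = 0})"
proof (rule antisym)
  let ?K = "{x \<in> S. l x = 0}"
  have K: "dimle ?K n" using d by (rule dimle_mono) auto
  show "dim S \<le> Suc (dim ?K)"
    by (rule dimle_imp[OF dimle_functional[OF S l dimle_dim[OF K]]])
  obtain B where B: "B \<subseteq> ?K" "independent B" "finite B" "?K \<subseteq> span B" "card B = dim ?K"
    by (rule dimle_basis[OF K])
  have "span B \<subseteq> ?K" using B subspace_kernel[OF S l] by (simp add: span_minimal)
  then have x0B: "x0 \<notin> span B" using x0 by auto
  then have "independent (insert x0 B)" using B by (simp add: independent_insertI)
  moreover obtain C where C: "C \<subseteq> S" "independent C" "finite C" "S \<subseteq> span C" "card C = dim S"
    by (rule dimle_basis[OF d])
  moreover have "insert x0 B \<subseteq> span C" using B x0 C by auto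
  ultimately have "card (insert x0 B) \<le> dim S" using independent_span_bound[of C "insert x0 B"] by simp
  moreover have "x0 \<notin> B" using x0B span_base by blast
  ultimately show "Suc (dim ?K) \<le> dim S" using B by simp
qed

lemma dimle_image:
  assumes S: "subspace S" and f: "lin_on S f" and d: "dimle S n"
  shows "dimle (f ` S) n"
proof -
  obtain B where B: "B \<subseteq> S" "independent B" "finite B" "S \<subseteq> span B" "card B = dim S"
    by (rule dimle_basis[OF d])
  have "f x \<in> span (f ` B)" if "x \<in> S" for x
  proof -
    have "x \<in> span B" using B that by auto
    then obtain c where "x = (\<Sum>b\<in>B. c b *\<^sub>R b)" using span_finite[OF B(3)] by auto
    then have "f x = (\<Sum>b\<in>B. c b *\<^sub>R f b)"
      using lin_on_sum[OF S f B(3), of "\<lambda>b. b" c] B(1) by auto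
    then show ?thesis by (auto intro: span_sum span_scale span_base)
  qed
  moreover have "card (f ` B) \<le> n" using card_image_le[OF B(3), of f] B(5) dimle_imp[OF d] by simp
  ultimately show ?thesis unfolding dimle_def using B(3) by (intro exI[of _ "f ` B"]) auto
qed

lemma dim_image_le:
  assumes "subspace S" "lin_on S f" "dimle S n" "T \<subseteq> f ` S"
  shows "dim T \<le> dim S"
  using dimle_imp[OF dimle_mono[OF dimle_image[OF assms(1,2) dimle_dim[OF assms(3)]] assms(4) order_refl]] .

text \<open>Independence is stated for the indexed family. Injectivity of \<open>b\<close>, needed
  to pass to independence of a set, is then a consequence.\<close>

lemma dim_family:
  assumes "finite I" and indep: "\<And>c. (\<Sum>i\<in>I. c i *\<^sub>R b i) = 0 \<Longrightarrow> \<forall>i\<in>I. c i = 0"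
    and S: "S = {\<Sum>i\<in>I. c i *\<^sub>R b i | c. True}"
  shows "dim S = card I" "dimle S (card I)" "subspace S"
proof -
  have inj: "inj_on b I"
  proof (rule inj_onI)
    fix i j assume ij: "i \<in> I" "j \<in> I" "b i = b j"
    show "i = j"
    proof (rule ccontr)
      assume "i \<noteq> j"
      \<comment> \<open>Two equal vectors would satisfy the nontrivial relation with coefficients 1
        and -1.\<close>
      let ?c = "\<lambda>k. (if k = i then 1 else 0) + (if k = j then -1 else (0::real))"
      have "(\<Sum>k\<in>I. ?c k *\<^sub>R b k) = (\<Sum>k\<in>I. (if k = i then b k else 0)) + (\<Sum>k\<in>I. (if k = j then - b k else 0))"
        unfolding sum.distrib[symmetric] by (intro sum.cong) (auto simp: scaleR_add_left)
      also have "\<dots> = 0" using ij assms(1) by (simp add: sum.delta)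
      finally have "?c i = 0" using indep[of ?c] ij(1) by blast
      then show False using \<open>i \<noteq> j\<close> by simp
    qed
  qed
  have sp: "S = span (b ` I)"
  proof -
    have "span (b ` I) = range (\<lambda>u. \<Sum>v\<in>b ` I. u v *\<^sub>R v)" using assms(1) by (intro span_finite) auto
    also have "\<dots> = range (\<lambda>u. \<Sum>i\<in>I. u (b i) *\<^sub>R b i)" using inj by (simp add: sum.reindex)
    also have "\<dots> = S"
    proof -
      have "\<exists>u. (\<Sum>i\<in>I. c i *\<^sub>R b i) = (\<Sum>i\<in>I. u (b i) *\<^sub>R b i)" for c
        using inj by (intro exI[of _ "\<lambda>v. c (the_inv_into I b v)"] sum.cong) (auto simp: the_inv_into_f_f)
      then show ?thesis unfolding S by auto
    qed
    finally show ?thesis by simp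
  qed
  have "independent (b ` I)"
  proof (rule independent_if_scalars_zero)
    show "finite (b ` I)" using assms(1) by simp
    fix f x assume "(\<Sum>x\<in>b ` I. f x *\<^sub>R x) = 0" "x \<in> b ` I"
    then show "f x = 0" using indep[of "\<lambda>i. f (b i)"] inj by (auto simp: sum.reindex)
  qed
  then show "dim S = card I" unfolding sp using inj
    by (simp add: dim_span_eq_card_independent card_image del: dim_span)
  show "dimle S (card I)" unfolding sp dimle_def using assms(1) inj
    by (intro exI[of _ "b ` I"]) (auto simp: card_image)
  show "subspace S" unfolding sp by simp
qed

lemma scaleR_fun_apply [simp]: "(c *\<^sub>R f) x = c *\<^sub>R f x"
  by (simp add: scaleR_fun_def)

lemma sum_fun_apply: "(\<Sum>i\<in>I. f i) x = (\<Sum>i\<in>I. f i x)"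
  by (induction I rule: infinite_finite_induct) auto

text \<open>The fields \<open>axis i b\<close> with \<open>b\<close> in a basis of \<open>S\<close>
  form a basis: the space is a direct sum of copies of \<open>S\<close>, one for each
  component.\<close>

lemma dim_componentwise:
  fixes S :: "('a \<Rightarrow> real) set"
  assumes S: "subspace S" and d: "dimle S n"
  defines "V \<equiv> {v :: 'a \<Rightarrow> real^'n. \<forall>i. (\<lambda>x. v x $ i) \<in> S}"
  shows "dim V = CARD('n) * dim S" "dimle V (CARD('n) * dim S)" "subspace V"
proof -
  obtain B where B: "B \<subseteq> S" "independent B" "finite B" "S \<subseteq> span B" "card B = dim S"
    by (rule dimle_basis[OF d])
  let ?I = "(UNIV :: 'n set) \<times> B"
  let ?b = "\<lambda>(i, b). (\<lambda>x. axis i (b x)) :: 'a \<Rightarrow> real^'n"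
  have comp: "(\<lambda>x. (\<Sum>p\<in>?I. c p *\<^sub>R ?b p) x $ k) = (\<Sum>b\<in>B. c (k, b) *\<^sub>R b)" for c k
  proof
    fix x
    have "(\<Sum>p\<in>?I. c p *\<^sub>R ?b p) x $ k = (\<Sum>p\<in>?I. (c p *\<^sub>R ?b p) x $ k)"
      by (simp add: sum_fun_apply)
    also have "\<dots> = (\<Sum>i\<in>UNIV. \<Sum>b\<in>B. c (i, b) * (axis i (b x) :: real^'n) $ k)"
      unfolding sum.cartesian_product by (intro sum.cong) auto
    also have "\<dots> = (\<Sum>i\<in>UNIV. if i = k then \<Sum>b\<in>B. c (i, b) * b x else 0)"
      by (intro sum.cong) (auto simp: axis_def)
    also have "\<dots> = (\<Sum>b\<in>B. c (k, b) *\<^sub>R b) x" by (simp add: sum_fun_apply)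
    finally show "(\<Sum>p\<in>?I. c p *\<^sub>R ?b p) x $ k = (\<Sum>b\<in>B. c (k, b) *\<^sub>R b) x" .
  qed
  have fin: "finite ?I" using B by simp
  have ind: "\<forall>p\<in>?I. c p = 0" if z: "(\<Sum>p\<in>?I. c p *\<^sub>R ?b p) = 0" for c
  proof -
    have "c (i, b) = 0" if "b \<in> B" for i b
    proof -
      have "(\<Sum>b\<in>B. c (i, b) *\<^sub>R b) = 0"
        using comp[of c i, symmetric] z by (simp add: fun_eq_iff)
      then show ?thesis using B(2,3) that independentD by fastforce
    qed
    then show ?thesis by auto
  qed
  have eq: "V = {\<Sum>p\<in>?I. c p *\<^sub>R ?b p | c. True}"
  proof (intro subset_antisym subsetI)
    fix v assume v: "v \<in> V"
    have "\<forall>i. \<exists>u. (\<lambda>x. v x $ i) = (\<Sum>b\<in>B. u b *\<^sub>R b)"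
    proof
      fix i
      have "(\<lambda>x. v x $ i) \<in> span B" using v B(4) unfolding V_def by auto
      then show "\<exists>u. (\<lambda>x. v x $ i) = (\<Sum>b\<in>B. u b *\<^sub>R b)" using span_finite[OF B(3)] by auto
    qed
    then obtain u where u: "\<And>i. (\<lambda>x. v x $ i) = (\<Sum>b\<in>B. u i b *\<^sub>R b)" by metis
    have "v = (\<Sum>p\<in>?I. (\<lambda>(i, b). u i b) p *\<^sub>R ?b p)"
    proof (rule ext, rule vec_eq_iff[THEN iffD2], rule allI)
      fix x k
      show "v x $ k = (\<Sum>p\<in>?I. (\<lambda>(i, b). u i b) p *\<^sub>R ?b p) x $ k"
        using fun_cong[OF comp[of "\<lambda>(i, b). u i b" k], of x] fun_cong[OF u[of k], of x] by simp
    qed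
    then show "v \<in> {\<Sum>p\<in>?I. c p *\<^sub>R ?b p | c. True}" by blast
  next
    fix v assume "v \<in> {\<Sum>p\<in>?I. c p *\<^sub>R ?b p | c. True}"
    then obtain c where c: "v = (\<Sum>p\<in>?I. c p *\<^sub>R ?b p)" by blast
    show "v \<in> V" unfolding V_def
    proof (clarify)
      fix k
      have "(\<Sum>b\<in>B. c (k, b) *\<^sub>R b) \<in> S"
        using B(1) S by (intro subspace_sum subspace_scale) auto
      then show "(\<lambda>x. v x $ k) \<in> S" unfolding c comp .
    qed
  qed
  have "card ?I = CARD('n) * dim S" using B by (simp add: card_cartesian_product)
  then show "dim V = CARD('n) * dim S" "dimle V (CARD('n) * dim S)" "subspace V"
    using dim_family[OF fin ind eq] by auto
qed

subsection \<open>Polynomials in two variables\<close>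

text \<open>The coordinate functions are parameters, so that the same space can be described in
  Cartesian and in barycentric coordinates; divisibility by a linear form then becomes divisibility
  by a coordinate.\<close>

definition bipoly :: "nat \<Rightarrow> ('a \<Rightarrow> real) \<Rightarrow> ('a \<Rightarrow> real) \<Rightarrow> ('a \<Rightarrow> real) set"
  where "bipoly k u v = span {(\<lambda>x. u x ^ i * v x ^ j) | i j. i + j \<le> k}"

abbreviation pol :: "nat \<Rightarrow> (pt \<Rightarrow> real) set"
  where "pol k \<equiv> bipoly k (\<lambda>x. x $ 1) (\<lambda>x. x $ 2)"

lemma bp_monom: "i + j \<le> k \<Longrightarrow> (\<lambda>x. u x ^ i * v x ^ j) \<in> bipoly k u v"
  unfolding bipoly_def by (rule span_base) blast

lemma bp_add:
  assumes "f \<in> bipoly k u v" "g \<in> bipoly k u v" shows "(\<lambda>x. f x + g x) \<in> bipoly k u v"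
  using span_add[of f _ g] assms unfolding bipoly_def plus_fun_def by blast

lemma bp_scale:
  assumes "f \<in> bipoly k u v" shows "(\<lambda>x. c * f x) \<in> bipoly k u v"
  using span_scale[of f _ c] assms unfolding bipoly_def scaleR_fun_def by simp

lemma bp_const: "(\<lambda>x. c) \<in> bipoly k u v"
  using bp_scale[OF bp_monom[of 0 0 k u v], of c] by simp

lemma bp_induct [consumes 1, case_names monom add scale]:
  assumes "f \<in> bipoly k u v"
    and m: "\<And>i j. i + j \<le> k \<Longrightarrow> P (\<lambda>x. u x ^ i * v x ^ j)"
    and a: "\<And>f g. f \<in> bipoly k u v \<Longrightarrow> g \<in> bipoly k u v \<Longrightarrow> P f \<Longrightarrow> P g \<Longrightarrow> P (\<lambda>x. f x + g x)"
    and s: "\<And>c f. f \<in> bipoly k u v \<Longrightarrow> P f \<Longrightarrow> P (\<lambda>x. c * f x)"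
  shows "P f"
proof -
  have "f \<in> bipoly k u v \<and> P f"
    using assms(1) unfolding bipoly_def
  proof (induction rule: span_induct_alt)
    case base
    \<comment> \<open>Zero is a multiple of the constant monomial, so the induction rule does
      without a case for it.\<close>
    have "(0 :: 'a \<Rightarrow> real) = (\<lambda>x. 0 * (u x ^ 0 * v x ^ 0))" by auto
    moreover have "P (\<lambda>x. 0 * (u x ^ 0 * v x ^ 0))" by (rule s[OF bp_monom m]) auto
    ultimately have "P 0" by simp
    then show ?case using span_zero by blast
  next
    case (step c x y)
    then obtain i j where x: "x = (\<lambda>x. u x ^ i * v x ^ j)" "i + j \<le> k" by blast
    have "P x" "x \<in> bipoly k u v" using x m bp_monom by auto
    then have "P (\<lambda>w. c * x w)" "(\<lambda>w. c * x w) \<in> bipoly k u v" using s bp_scale by auto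
    moreover have "c *\<^sub>R x + y = (\<lambda>w. c * x w + y w)" by auto
    ultimately show ?case using a[of "\<lambda>w. c * x w" y] bp_add[of "\<lambda>w. c * x w"] step(2)
      unfolding bipoly_def by simp
  qed
  then show ?thesis by simp
qed

lemma bp_mono: "k \<le> l \<Longrightarrow> bipoly k u v \<subseteq> bipoly l u v"
  unfolding bipoly_def by (rule span_mono) (blast intro: order_trans)

lemma bp_monoD: "f \<in> bipoly k u v \<Longrightarrow> k \<le> l \<Longrightarrow> f \<in> bipoly l u v"
  using bp_mono by blast

lemma bp_minus: "f \<in> bipoly k u v \<Longrightarrow> (\<lambda>x. - f x) \<in> bipoly k u v"
  using bp_scale[of f k u v "-1"] by simp

lemma bp_diff: "f \<in> bipoly k u v \<Longrightarrow> g \<in> bipoly k u v \<Longrightarrow> (\<lambda>x. f x - g x) \<in> bipoly k u v"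
  using bp_add[OF _ bp_minus] by fastforce

lemma bp_sum: "(\<And>i. i \<in> I \<Longrightarrow> f i \<in> bipoly k u v) \<Longrightarrow> (\<lambda>x. \<Sum>i\<in>I. f i x) \<in> bipoly k u v"
  by (induction I rule: infinite_finite_induct) (auto intro: bp_const bp_add)

lemma bp_mult:
  assumes "f \<in> bipoly k u v" "g \<in> bipoly l u v"
  shows "(\<lambda>x. f x * g x) \<in> bipoly (k + l) u v"
  using assms(1)
proof (induction rule: bp_induct)
  case (monom i j)
  show ?case using assms(2)
  proof (induction rule: bp_induct)
    case (monom i' j')
    have "(\<lambda>x. u x ^ i * v x ^ j * (u x ^ i' * v x ^ j')) = (\<lambda>x. u x ^ (i + i') * v x ^ (j + j'))"
      by (simp add: power_add mult_ac)
    then show ?case using bp_monom[of "i + i'" "j + j'" "k + l" u v] monom \<open>i + j \<le> k\<close> by simp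
  next
    case (add f g)
    then show ?case using bp_add by (fastforce simp: distrib_left)
  next
    case (scale c f)
    then show ?case using bp_scale[of "\<lambda>x. u x ^ i * v x ^ j * f x" "k + l" u v c]
      by (simp add: mult_ac)
  qed
next
  case (add f g)
  then show ?case using bp_add by (fastforce simp: distrib_right)
next
  case (scale c f)
  then show ?case using bp_scale[of "\<lambda>x. f x * g x" "k + l" u v c] by (simp add: mult_ac)
qed

lemma bp_power: "f \<in> bipoly k u v \<Longrightarrow> (\<lambda>x. f x ^ n) \<in> bipoly (n * k) u v"
proof (induction n)
  case 0
  then show ?case using bp_const[of 1 0 u v] by simp
next
  case (Suc n)
  then show ?case using bp_mult[of f k u v "\<lambda>x. f x ^ n" "n * k"] by simp
qed

lemma bp_u: "u \<in> bipoly (Suc k) u v" and bp_v: "v \<in> bipoly (Suc k) u v"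
  using bp_monom[of 1 0 "Suc k" u v] bp_monom[of 0 1 "Suc k" u v] by auto

lemma bp_subst:
  assumes "f \<in> bipoly k u' v'" "u' \<in> bipoly 1 u v" "v' \<in> bipoly 1 u v"
  shows "f \<in> bipoly k u v"
  using assms(1)
proof (induction rule: bp_induct)
  case (monom i j)
  have "(\<lambda>x. u' x ^ i * v' x ^ j) \<in> bipoly (i * 1 + j * 1) u v"
    by (intro bp_mult bp_power assms)
  then show ?case using monom bp_monoD by fastforce
qed (auto intro: bp_add bp_scale)

text \<open>Division by the coordinate \<open>u\<close>: the monomials free of \<open>u\<close> form
  a remainder that depends on \<open>v\<close> alone, and on the line \<open>u = 0\<close> only this
  remainder survives.\<close>

lemma bp_split:
  assumes "f \<in> bipoly (Suc k) u v"
  shows "\<exists>g\<in>bipoly k u v. \<exists>P. degree P \<le> Suc k \<and> (\<forall>x. f x = u x * g x + poly P (v x))"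
  using assms
proof (induction rule: bp_induct)
  case (monom i j)
  show ?case
  proof (cases i)
    case 0
    then show ?thesis using monom
      by (intro bexI[of _ "\<lambda>x. 0"] exI[of _ "Polynomial.monom 1 j"] bp_const)
        (auto simp: poly_monom intro: order_trans[OF degree_monom_le])
  next
    case (Suc i')
    then show ?thesis using monom bp_monom[of i' j k u v]
      by (intro bexI[of _ "\<lambda>x. u x ^ i' * v x ^ j"] exI[of _ 0]) auto
  qed
next
  case (add f g)
  then obtain f1 P g1 Q where "f1 \<in> bipoly k u v" "degree P \<le> Suc k" "\<And>x. f x = u x * f1 x + poly P (v x)"
    "g1 \<in> bipoly k u v" "degree Q \<le> Suc k" "\<And>x. g x = u x * g1 x + poly Q (v x)" by blast
  then show ?case
    by (intro bexI[of _ "\<lambda>x. f1 x + g1 x"] exI[of _ "P + Q"] bp_add)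
      (auto simp: algebra_simps intro: degree_add_le)
next
  case (scale c f)
  then obtain f1 P where "f1 \<in> bipoly k u v" "degree P \<le> Suc k" "\<And>x. f x = u x * f1 x + poly P (v x)"
    by blast
  then show ?case
    by (intro bexI[of _ "\<lambda>x. c * f1 x"] exI[of _ "smult c P"] bp_scale)
      (auto simp: algebra_simps intro: order_trans[OF degree_smult_le])
qed

lemma bp_0: "f \<in> bipoly 0 u v \<Longrightarrow> \<exists>c. f = (\<lambda>x. c)"
  by (induction rule: bp_induct) auto

lemma pol_line:
  assumes "f \<in> pol k"
  shows "\<exists>P. degree P \<le> k \<and> (\<forall>t. f (a + t *\<^sub>R d) = poly P t)"
  using assms
proof (induction rule: bp_induct)
  case (monom i j)
  have "degree ([:a $ 1, d $ 1:] ^ i * [:a $ 2, d $ 2:] ^ j) \<le> i + j"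
  proof (rule order_trans[OF degree_mult_le add_mono])
    show "degree ([:a $ 1, d $ 1:] ^ i) \<le> i" "degree ([:a $ 2, d $ 2:] ^ j) \<le> j"
      by (rule order_trans[OF degree_power_le], simp)+
  qed
  then show ?case using monom
    by (intro exI[of _ "[:a $ 1, d $ 1:] ^ i * [:a $ 2, d $ 2:] ^ j"]) auto
next
  case (add f g)
  then obtain P Q where "degree P \<le> k" "degree Q \<le> k" "\<And>t. f (a + t *\<^sub>R d) = poly P t"
    "\<And>t. g (a + t *\<^sub>R d) = poly Q t" by blast
  then show ?case by (intro exI[of _ "P + Q"]) (auto intro: degree_add_le)
next
  case (scale c f)
  then obtain P where "degree P \<le> k" "\<And>t. f (a + t *\<^sub>R d) = poly P t" by blast
  then show ?case
    by (intro exI[of _ "smult c P"]) (auto intro: order_trans[OF degree_smult_le])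
qed

lemma finite_deg: "finite {(i, j). i + j \<le> (k::nat)}"
  by (rule finite_subset[of _ "{..k} \<times> {..k}"]) auto

lemma card_deg: "2 * card {(i, j). i + j \<le> (k::nat)} = (k + 1) * (k + 2)"
proof (induction k)
  case 0
  have "{(i, j). i + j \<le> (0::nat)} = {(0, 0)}" by auto
  then show ?case by simp
next
  case (Suc k)
  have "{(i, j). i + j \<le> Suc k} = {(i, j). i + j \<le> k} \<union> (\<lambda>i. (i, Suc k - i)) ` {..Suc k}"
    by (auto simp: image_iff)
  moreover have "{(i, j). i + j \<le> k} \<inter> (\<lambda>i. (i, Suc k - i)) ` {..Suc k} = {}" by auto
  moreover have "card ((\<lambda>i. (i, Suc k - i)) ` {..Suc k}) = Suc (Suc k)"
    by (subst card_image) (auto simp: inj_on_def)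
  ultimately have "card {(i, j). i + j \<le> Suc k} = card {(i, j). i + j \<le> k} + Suc (Suc k)"
    using card_Un_disjoint[OF finite_deg[of k], of "(\<lambda>i. (i, Suc k - i)) ` {..Suc k}"] by simp
  then show ?case using Suc by simp
qed

lemma pol_iff:
  "f \<in> pol k \<longleftrightarrow> (\<exists>c. \<forall>x. f x = (\<Sum>(i, j) | i + j \<le> k. c i j * (x $ 1) ^ i * (x $ 2) ^ j))"
proof
  assume "f \<in> pol k"
  then show "\<exists>c. \<forall>x. f x = (\<Sum>(i, j) | i + j \<le> k. c i j * (x $ 1) ^ i * (x $ 2) ^ j)"
  proof (induction rule: bp_induct)
    case (monom i j)
    have "(\<Sum>(i', j') | i' + j' \<le> k. (if i' = i \<and> j' = j then 1 else 0) * (x $ 1) ^ i' * (x $ 2) ^ j')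
       = (\<Sum>p | (case p of (i', j') \<Rightarrow> i' + j' \<le> k). if p = (i, j) then (x $ 1) ^ i * (x $ 2) ^ j else 0)"
      for x :: pt
      by (intro sum.cong) (auto split: if_splits)
    then show ?case using monom
      by (intro exI[of _ "\<lambda>i' j'. if i' = i \<and> j' = j then 1 else 0"]) (simp add: finite_deg)
  next
    case (add f g)
    then obtain c d where
      "\<And>x. f x = (\<Sum>(i, j) | i + j \<le> k. c i j * (x $ 1) ^ i * (x $ 2) ^ j)"
      "\<And>x. g x = (\<Sum>(i, j) | i + j \<le> k. d i j * (x $ 1) ^ i * (x $ 2) ^ j)" by blast
    then show ?case
      by (intro exI[of _ "\<lambda>i j. c i j + d i j"])
        (simp add: sum.distrib[symmetric] case_prod_unfold algebra_simps)
  next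
    case (scale a f)
    then obtain c where "\<And>x. f x = (\<Sum>(i, j) | i + j \<le> k. c i j * (x $ 1) ^ i * (x $ 2) ^ j)" by blast
    then show ?case
      by (intro exI[of _ "\<lambda>i j. a * c i j"])
        (simp add: sum_distrib_left case_prod_unfold algebra_simps)
  qed
next
  assume "\<exists>c. \<forall>x. f x = (\<Sum>(i, j) | i + j \<le> k. c i j * (x $ 1) ^ i * (x $ 2) ^ j)"
  then obtain c where c: "\<And>x. f x = (\<Sum>(i, j) | i + j \<le> k. c i j * (x $ 1) ^ i * (x $ 2) ^ j)" by blast
  have "f = (\<lambda>x. \<Sum>p | (case p of (i', j') \<Rightarrow> i' + j' \<le> k). c (fst p) (snd p) * ((x $ 1) ^ fst p * (x $ 2) ^ snd p))"
    by (rule ext) (simp add: c case_prod_unfold mult.assoc)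
  also have "\<dots> \<in> pol k"
    by (intro bp_sum bp_scale bp_monom) auto
  finally show "f \<in> pol k" .
qed

text \<open>Two passes of the univariate argument: coefficients in the first variable are compared
  for a fixed value \<open>y\<close> of the second, and the outcome is a polynomial identity in
  \<open>y\<close>.\<close>

lemma monom_indep:
  assumes z: "\<And>x::pt. (\<Sum>(i, j) | i + j \<le> k. c (i, j) * (x $ 1) ^ i * (x $ 2) ^ j) = 0"
    and "a + b \<le> k"
  shows "c (a, b) = (0::real)"
proof -
  let ?I = "{(i, j). i + j \<le> k}"
  have 1: "(\<Sum>p\<in>?I. if fst p = a then c p * y ^ snd p else 0) = 0" for y
  proof -
    let ?P = "\<Sum>p\<in>?I. Polynomial.monom (c p * y ^ snd p) (fst p)"
    have "poly ?P x = 0" for x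
      using z[of "vector [x, y]"] by (simp add: poly_sum poly_monom case_prod_unfold mult_ac)
    then have "?P = 0" using poly_eq_poly_eq_iff[of ?P 0] by auto
    then have "coeff ?P a = 0" by simp
    then show ?thesis by (simp add: coeff_sum)
  qed
  let ?Q = "\<Sum>p\<in>?I. if fst p = a then Polynomial.monom (c p) (snd p) else 0"
  have "poly ?Q y = 0" for y
  proof -
    have "poly ?Q y = (\<Sum>p\<in>?I. if fst p = a then c p * y ^ snd p else 0)"
      unfolding poly_sum by (intro sum.cong) (auto simp: poly_monom)
    then show ?thesis using 1 by simp
  qed
  then have "?Q = 0" using poly_eq_poly_eq_iff[of ?Q 0] by auto
  then have "coeff ?Q b = 0" by simp
  moreover have "coeff ?Q b = (\<Sum>p\<in>?I. if p = (a, b) then c p else 0)"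
    unfolding coeff_sum by (intro sum.cong) auto
  ultimately show ?thesis using assms(2) finite_deg[of k] by simp
qed

text \<open>On the line from an interior point \<open>c\<close> of \<open>S\<close> to
  \<open>x\<close> the restriction is a univariate polynomial that vanishes for all small positive
  parameters, hence identically, in particular at parameter 1.\<close>

lemma pol_identity:
  assumes f: "f \<in> pol k" and S: "interior S \<noteq> {}" and z: "\<And>x. x \<in> S \<Longrightarrow> f x = 0"
  shows "f x = 0"
proof -
  obtain c e where c: "e > 0" "ball c e \<subseteq> S"
    using S by (meson ex_in_conv mem_interior)
  obtain P where P: "\<And>t. f (c + t *\<^sub>R (x - c)) = poly P t" using pol_line[OF f] by blast
  have "P = 0"
  proof (rule ccontr)
    assume "P \<noteq> 0"
    \<comment> \<open>The summand 1 keeps the denominator positive when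
      \<open>x = c\<close>.\<close>
    define r where "r = e / (norm (x - c) + 1)"
    have r: "r > 0" unfolding r_def using c by (simp add: add_nonneg_pos)
    have "poly P t = 0" if "t \<in> {0<..<r}" for t
    proof -
      have "dist c (c + t *\<^sub>R (x - c)) = t * norm (x - c)" using that by (simp add: dist_norm)
      also have "\<dots> \<le> t * (norm (x - c) + 1)" using that by (simp add: distrib_left)
      also have "\<dots> < e"
      proof -
        have "norm (x - c) + 1 > 0" by (simp add: add_nonneg_pos)
        then show ?thesis using that unfolding r_def by (simp add: pos_less_divide_eq)
      qed
      finally show ?thesis using P z c(2) by (metis mem_ball subsetD)
    qed
    then have "{0<..<r} \<subseteq> {t. poly P t = 0}" by auto
    then show False using poly_roots_finite[OF \<open>P \<noteq> 0\<close>] r infinite_Ioo finite_subset by blast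
  qed
  then show ?thesis using P[of 1] by simp
qed

section \<open>Partial derivatives and potentials of polynomials\<close>

definition pd :: "2 \<Rightarrow> (pt \<Rightarrow> real) \<Rightarrow> pt \<Rightarrow> real"
  where "pd i f x = frechet_derivative f (at x) (axis i 1)"

lemma pdI:
  assumes "(f has_derivative (\<lambda>h. a * h $ 1 + b * h $ 2)) (at x)"
  shows "pd 1 f x = a" "pd 2 f x = b"
  unfolding pd_def frechet_derivative_at[OF assms, symmetric] by (simp_all add: axis_def)

lemma monom_deriv:
  "((\<lambda>x::pt. (x $ 1) ^ i * (x $ 2) ^ j) has_derivative
    (\<lambda>h. (of_nat i * (x $ 1) ^ (i - 1) * (x $ 2) ^ j) * h $ 1 + (of_nat j * (x $ 1) ^ i * (x $ 2) ^ (j - 1)) * h $ 2)) (at x)"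
  by (auto intro!: derivative_eq_intros bounded_linear_imp_has_derivative bounded_linear_vec_nth simp: algebra_simps)

lemma pd_monom:
  "pd 1 (\<lambda>x. (x $ 1) ^ i * (x $ 2) ^ j) = (\<lambda>x. of_nat i * ((x $ 1) ^ (i - 1) * (x $ 2) ^ j))"
  "pd 2 (\<lambda>x. (x $ 1) ^ i * (x $ 2) ^ j) = (\<lambda>x. of_nat j * ((x $ 1) ^ i * (x $ 2) ^ (j - 1)))"
  using pdI[OF monom_deriv] by (auto simp: mult_ac)

lemma pol_deriv:
  assumes "f \<in> pol k"
  shows "(f has_derivative (\<lambda>h. pd 1 f x * h $ 1 + pd 2 f x * h $ 2)) (at x)"
proof -
  have "\<exists>a b. (f has_derivative (\<lambda>h. a * h $ 1 + b * h $ 2)) (at x)"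
    using assms
  proof (induction rule: bp_induct)
    case (monom i j)
    then show ?case using monom_deriv by blast
  next
    case (add f g)
    then obtain a b c d where "(f has_derivative (\<lambda>h. a * h $ 1 + b * h $ 2)) (at x)"
      "(g has_derivative (\<lambda>h. c * h $ 1 + d * h $ 2)) (at x)" by blast
    from has_derivative_add[OF this] show ?case
      by (intro exI[of _ "a + c"] exI[of _ "b + d"]) (simp add: algebra_simps)
  next
    case (scale c f)
    then obtain a b where "(f has_derivative (\<lambda>h. a * h $ 1 + b * h $ 2)) (at x)" by blast
    from has_derivative_mult_right[OF this, of c] show ?case
      by (intro exI[of _ "c * a"] exI[of _ "c * b"]) (simp add: algebra_simps)
  qed
  then obtain a b where ab: "(f has_derivative (\<lambda>h. a * h $ 1 + b * h $ 2)) (at x)" by blast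
  then show ?thesis unfolding pdI[OF ab] .
qed

lemma pd_add: "f \<in> pol k \<Longrightarrow> g \<in> pol l \<Longrightarrow> pd i (\<lambda>x. f x + g x) = (\<lambda>x. pd i f x + pd i g x)"
proof
  fix x assume fg: "f \<in> pol k" "g \<in> pol l"
  have D: "((\<lambda>x. f x + g x) has_derivative (\<lambda>h. (pd 1 f x + pd 1 g x) * h $ 1 + (pd 2 f x + pd 2 g x) * h $ 2)) (at x)"
    using has_derivative_add[OF pol_deriv[OF fg(1)] pol_deriv[OF fg(2)], of x] by (simp add: algebra_simps)
  show "pd i (\<lambda>x. f x + g x) x = pd i f x + pd i g x" using pdI[OF D] exhaust_2[of i] by auto
qed

lemma pd_scale: "f \<in> pol k \<Longrightarrow> pd i (\<lambda>x. c * f x) = (\<lambda>x. c * pd i f x)"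
proof
  fix x assume f: "f \<in> pol k"
  have D: "((\<lambda>x. c * f x) has_derivative (\<lambda>h. (c * pd 1 f x) * h $ 1 + (c * pd 2 f x) * h $ 2)) (at x)"
    using has_derivative_mult_right[OF pol_deriv[OF f], of c x] by (simp add: algebra_simps)
  show "pd i (\<lambda>x. c * f x) x = c * pd i f x" using pdI[OF D] exhaust_2[of i] by auto
qed

lemma pd_mult: "f \<in> pol k \<Longrightarrow> g \<in> pol l \<Longrightarrow> pd i (\<lambda>x. f x * g x) x = f x * pd i g x + pd i f x * g x"
proof -
  assume fg: "f \<in> pol k" "g \<in> pol l"
  have D: "((\<lambda>x. f x * g x) has_derivative (\<lambda>h. (f x * pd 1 g x + pd 1 f x * g x) * h $ 1 + (f x * pd 2 g x + pd 2 f x * g x) * h $ 2)) (at x)"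
    using has_derivative_mult[OF pol_deriv[OF fg(1)] pol_deriv[OF fg(2)], of x] by (simp add: algebra_simps)
  show ?thesis using pdI[OF D] exhaust_2[of i] by auto
qed

lemma pd_minus: "f \<in> pol k \<Longrightarrow> pd i (\<lambda>x. - f x) = (\<lambda>x. - pd i f x)"
  using pd_scale[of f k i "-1"] by simp

lemma pd_diff: "f \<in> pol k \<Longrightarrow> g \<in> pol l \<Longrightarrow> pd i (\<lambda>x. f x - g x) = (\<lambda>x. pd i f x - pd i g x)"
  using pd_add[of f k "\<lambda>x. - g x" l i] pd_minus[of g l i] bp_minus[of g l] by simp

lemma pd_pol: "f \<in> pol k \<Longrightarrow> pd i f \<in> pol (k - 1)"
proof (induction rule: bp_induct)
  case (monom a b)
  consider "i = 1" | "i = 2" using exhaust_2 by blast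
  then show ?case
  proof cases
    case 1
    show ?thesis unfolding 1 pd_monom
    proof (cases a)
      case 0 then show "(\<lambda>x. real a * (x $ 1 ^ (a - 1) * x $ 2 ^ b)) \<in> pol (k - 1)"
        using bp_const[of 0 "k - 1"] by simp
    next
      case (Suc n) then show "(\<lambda>x. real a * (x $ 1 ^ (a - 1) * x $ 2 ^ b)) \<in> pol (k - 1)"
        using monom by (intro bp_scale bp_monom) auto
    qed
  next
    case 2
    show ?thesis unfolding 2 pd_monom
    proof (cases b)
      case 0 then show "(\<lambda>x. real b * (x $ 1 ^ a * x $ 2 ^ (b - 1))) \<in> pol (k - 1)"
        using bp_const[of 0 "k - 1"] by simp
    next
      case (Suc n) then show "(\<lambda>x. real b * (x $ 1 ^ a * x $ 2 ^ (b - 1))) \<in> pol (k - 1)"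
        using monom by (intro bp_scale bp_monom) auto
    qed
  qed
next
  case (add f g)
  then show ?case using pd_add by (auto intro: bp_add)
next
  case (scale c f)
  then show ?case using pd_scale by (auto intro: bp_scale)
qed

lemma pd_commute: "f \<in> pol k \<Longrightarrow> pd 1 (pd 2 f) = pd 2 (pd 1 f)"
proof (induction rule: bp_induct)
  case (monom i j)
  have m: "(\<lambda>x::pt. (x $ 1) ^ i' * (x $ 2) ^ j') \<in> pol (i' + j')" for i' j' by (rule bp_monom) simp
  show ?case by (simp add: pd_monom pd_scale[OF m]) (simp add: mult_ac)
next
  case (add f g)
  then show ?case by (simp add: pd_add[OF add(1,2)] pd_add[OF pd_pol[OF add(1)] pd_pol[OF add(2)]])
next
  case (scale c f)
  then show ?case by (simp add: pd_scale[OF scale(1)] pd_scale[OF pd_pol[OF scale(1)]])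
qed

lemma pol_antideriv2: "f \<in> pol k \<Longrightarrow> \<exists>F\<in>pol (Suc k). pd 2 F = f"
proof (induction rule: bp_induct)
  case (monom i j)
  have m: "(\<lambda>x::pt. (x $ 1) ^ i * (x $ 2) ^ Suc j) \<in> pol (Suc k)" by (rule bp_monom) (use monom in simp)
  show ?case
    by (intro bexI[of _ "\<lambda>x. (1 / real (Suc j)) * ((x $ 1) ^ i * (x $ 2) ^ Suc j)"] bp_scale m)
      (simp only: pd_scale[OF m] pd_monom, simp)
next
  case (add f g)
  then obtain F G where "F \<in> pol (Suc k)" "pd 2 F = f" "G \<in> pol (Suc k)" "pd 2 G = g" by blast
  then show ?case by (intro bexI[of _ "\<lambda>x. F x + G x"] bp_add) (simp_all add: pd_add)
next
  case (scale c f)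
  then obtain F where "F \<in> pol (Suc k)" "pd 2 F = f" by blast
  then show ?case by (intro bexI[of _ "\<lambda>x. c * F x"] bp_scale) (simp_all add: pd_scale)
qed

lemma pol_line_deriv:
  assumes f: "f \<in> pol k" and P: "\<And>t. f (a + t *\<^sub>R d) = poly P t"
  shows "poly (pderiv P) t = pd 1 f (a + t *\<^sub>R d) * d $ 1 + pd 2 f (a + t *\<^sub>R d) * d $ 2"
proof -
  let ?x = "a + t *\<^sub>R d"
  have "((\<lambda>t. a + t *\<^sub>R d) has_derivative (\<lambda>s. s *\<^sub>R d)) (at t)"
    by (auto intro!: derivative_eq_intros)
  from has_derivative_compose[OF this pol_deriv[OF f]]
  have "(poly P has_derivative (\<lambda>s. pd 1 f ?x * (s *\<^sub>R d) $ 1 + pd 2 f ?x * (s *\<^sub>R d) $ 2)) (at t)"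
    by (simp add: P[abs_def])
  moreover have "(\<lambda>s. pd 1 f ?x * (s *\<^sub>R d) $ 1 + pd 2 f ?x * (s *\<^sub>R d) $ 2) = (*) (pd 1 f ?x * d $ 1 + pd 2 f ?x * d $ 2)"
    by (auto simp: algebra_simps)
  ultimately have "(poly P has_field_derivative (pd 1 f ?x * d $ 1 + pd 2 f ?x * d $ 2)) (at t)"
    by (simp add: has_field_derivative_def)
  then show ?thesis using poly_DERIV DERIV_unique by blast
qed

lemma pol_line_const:
  assumes f: "f \<in> pol k" and "\<And>t. pd 1 f (a + t *\<^sub>R d) * d $ 1 + pd 2 f (a + t *\<^sub>R d) * d $ 2 = 0"
  shows "f (a + t *\<^sub>R d) = f a"
proof -
  obtain P where P: "\<And>t. f (a + t *\<^sub>R d) = poly P t" using pol_line[OF f] by blast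
  have "poly (pderiv P) t = 0" for t using pol_line_deriv[OF f P] assms(2) by simp
  then have "pderiv P = 0" using poly_eq_poly_eq_iff[of "pderiv P" 0] by auto
  then obtain c where "P = [:c:]" using pderiv_iszero by blast
  then show ?thesis using P[of t] P[of 0] by simp
qed

text \<open>The Poincare lemma for a field with zero divergence, with control of the degree: a field
  of degree r must give a potential of degree r + 1, the degree of the splines in (f).\<close>

lemma pol_potential:
  assumes u: "u \<in> pol k" and v: "v \<in> pol k" and div: "\<And>x. pd 1 u x + pd 2 v x = 0"
  shows "\<exists>q\<in>pol (Suc k). pd 2 q = u \<and> pd 1 q = (\<lambda>x. - v x)"
proof -
  obtain Q where Q: "Q \<in> pol (Suc k)" "pd 2 Q = u" using pol_antideriv2[OF u] by blast
  \<comment> \<open>The defect of \<open>Q\<close> in the second equation. Its derivative in the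
    second variable is minus the divergence, so it depends on the first variable alone and
    \<open>G\<close> integrates it as a univariate polynomial.\<close>
  define g where "g = (\<lambda>x. - v x - pd 1 Q x)"
  have p1: "pd 1 Q \<in> pol k" using pd_pol[OF Q(1), of 1] by simp
  have g: "g \<in> pol k" unfolding g_def by (intro bp_diff bp_minus v p1)
  have "pd 2 g = (\<lambda>x. - pd 2 v x - pd 2 (pd 1 Q) x)"
    unfolding g_def using pd_diff[OF bp_minus[OF v] p1, of 2] pd_minus[OF v, of 2] by simp
  also have "\<dots> = (\<lambda>x. - (pd 1 u x + pd 2 v x))" using pd_commute[OF Q(1)] Q(2) by auto
  also have "\<dots> = (\<lambda>x. 0)" using div by simp
  finally have g2: "pd 2 g x = 0" for x by simp
  obtain P where P: "degree P \<le> k" "\<And>t. g (0 + t *\<^sub>R axis 1 1) = poly P t" using pol_line[OF g] by blast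
  have gP: "g x = poly P (x $ 1)" for x
  proof -
    have "g ((x $ 1) *\<^sub>R axis 1 1 + (x $ 2) *\<^sub>R axis 2 1) = g ((x $ 1) *\<^sub>R axis 1 1)"
      by (rule pol_line_const[OF g]) (simp add: g2 axis_def)
    moreover have "(x $ 1) *\<^sub>R axis 1 1 + (x $ 2) *\<^sub>R axis 2 1 = x"
      by (simp add: vec_eq_iff forall_2 axis_def)
    ultimately show ?thesis using P(2)[of "x $ 1"] by simp
  qed
  have m: "(\<lambda>x::pt. (x $ 1) ^ Suc i * (x $ 2) ^ 0) \<in> pol (Suc k)" if "i \<le> k" for i
    by (rule bp_monom) (use that in simp)
  define G where "G = (\<lambda>x::pt. \<Sum>i\<le>k. (coeff P i / real (Suc i)) * ((x $ 1) ^ Suc i * (x $ 2) ^ 0))"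
  have G: "G \<in> pol (Suc k)" unfolding G_def by (intro bp_sum bp_scale m) auto
  have "pd j G x = (\<Sum>i\<le>k. (coeff P i / real (Suc i)) * pd j (\<lambda>x. (x $ 1) ^ Suc i * (x $ 2) ^ 0) x)" for j x
  proof -
    have "pd j (\<lambda>x::pt. \<Sum>i\<le>n. (coeff P i / real (Suc i)) * ((x $ 1) ^ Suc i * (x $ 2) ^ 0)) x
      = (\<Sum>i\<le>n. (coeff P i / real (Suc i)) * pd j (\<lambda>x. (x $ 1) ^ Suc i * (x $ 2) ^ 0) x)" if "n \<le> k" for n
      using that
    proof (induction n)
      case 0
      then show ?case using pd_scale[OF m[of 0], of j "coeff P 0 / real (Suc 0)"] by simp
    next
      case (Suc n)
      have "(\<lambda>x::pt. \<Sum>i\<le>n. (coeff P i / real (Suc i)) * ((x $ 1) ^ Suc i * (x $ 2) ^ 0)) \<in> pol (Suc k)"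
        using Suc.prems by (intro bp_sum bp_scale m) auto
      from pd_add[OF this bp_scale[OF m[OF Suc.prems]]] show ?case
        using Suc pd_scale[OF m[OF Suc.prems]] by (simp only: sum.atMost_Suc)
    qed
    then show ?thesis unfolding G_def by simp
  qed
  then have "pd 1 G x = (\<Sum>i\<le>k. coeff P i * (x $ 1) ^ i)" "pd 2 G x = 0" for x
    by (simp_all only: pd_monom) (simp_all del: of_nat_Suc)
  moreover have "(\<Sum>i\<le>k. coeff P i * s ^ i) = poly P s" for s
    unfolding poly_altdef using P(1) by (intro sum.mono_neutral_right) (auto simp: coeff_eq_0)
  ultimately have G1: "pd 1 G = g" and G2: "pd 2 G = (\<lambda>x. 0)" using gP by auto
  show ?thesis
    using pd_add[OF Q(1) G] G1 G2 Q(2)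
    by (intro bexI[of _ "\<lambda>x. Q x + G x"] bp_add Q(1) G) (simp add: g_def)
qed

subsection \<open>Triangles\<close>

definition cross :: "pt \<Rightarrow> pt \<Rightarrow> real"
  where "cross a b = a $ 1 * b $ 2 - a $ 2 * b $ 1"

lemma ccw_cross: "ccw a b c \<longleftrightarrow> 0 < cross (b - a) (c - a)"
  by (simp add: ccw_def cross_def)

lemma cross_simps:
  "cross (a + b) c = cross a c + cross b c" "cross c (a + b) = cross c a + cross c b"
  "cross (a - b) c = cross a c - cross b c" "cross c (a - b) = cross c a - cross c b"
  "cross (r *\<^sub>R a) b = r * cross a b" "cross a (r *\<^sub>R b) = r * cross a b"
  "cross a a = 0" "cross (- a) b = - cross a b" "cross a (- b) = - cross a b"
  by (simp_all add: cross_def algebra_simps)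

lemma cross_commute: "cross a b = - cross b a"
  by (simp add: cross_def)

lemma ccw_rotate: "ccw a b c \<Longrightarrow> ccw b c a"
  unfolding ccw_cross by (simp add: cross_def algebra_simps)

lemma poly_zero_on_unit:
  fixes P :: "real poly"
  assumes "\<And>t. t \<in> {0..1} \<Longrightarrow> poly P t = 0"
  shows "P = 0"
proof (rule ccontr)
  assume "P \<noteq> 0"
  then have "finite {t. poly P t = 0}" by (rule poly_roots_finite)
  moreover have "{0..1} \<subseteq> {t. poly P t = 0}" using assms by auto
  ultimately have "finite {0..1::real}" by (rule rev_finite_subset)
  then show False using infinite_Icc[of 0 "1::real"] by simp
qed

text \<open>Barycentric coordinates as quotients of areas: \<open>al\<close> belongs to the vertex
  \<open>a\<close>, \<open>be\<close> to \<open>b\<close> and \<open>mu\<close> to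
  \<open>o'\<close>. In the split \<open>o'\<close> is \<open>z 0\<close>, so \<open>mu\<close>
  vanishes on the outer edge of a piece.\<close>

definition al :: "pt \<Rightarrow> pt \<Rightarrow> pt \<Rightarrow> pt \<Rightarrow> real"
  where "al o' a b x = cross (x - o') (b - o') / cross (a - o') (b - o')"

definition be :: "pt \<Rightarrow> pt \<Rightarrow> pt \<Rightarrow> pt \<Rightarrow> real"
  where "be o' a b x = cross (a - o') (x - o') / cross (a - o') (b - o')"

definition mu :: "pt \<Rightarrow> pt \<Rightarrow> pt \<Rightarrow> pt \<Rightarrow> real"
  where "mu o' a b x = 1 - al o' a b x - be o' a b x"

lemma pol_affine: "(\<lambda>x::pt. p * x $ 1 + q * x $ 2 + r) \<in> pol 1"
proof -
  have "(\<lambda>x::pt. x $ 1) \<in> pol 1" "(\<lambda>x::pt. x $ 2) \<in> pol 1"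
    using bp_u[of "\<lambda>x::pt. x $ 1" 0 "\<lambda>x. x $ 2"] bp_v[of "\<lambda>x::pt. x $ 2" 0 "\<lambda>x. x $ 1"] by simp_all
  then show ?thesis by (intro bp_add bp_scale bp_const)
qed

lemma pol_cross: "(\<lambda>x. cross (x - o') b / c) \<in> pol 1" "(\<lambda>x. cross a (x - o') / c) \<in> pol 1"
proof -
  have "(\<lambda>x. cross (x - o') b / c) = (\<lambda>x::pt. (b $ 2 / c) * x $ 1 + (- b $ 1 / c) * x $ 2 + (o' $ 2 * b $ 1 - o' $ 1 * b $ 2) / c)"
    by (rule ext) (simp add: cross_def diff_divide_distrib add_divide_distrib algebra_simps)
  then show "(\<lambda>x. cross (x - o') b / c) \<in> pol 1" by (simp only: pol_affine)
  have "(\<lambda>x. cross a (x - o') / c) = (\<lambda>x::pt. (- a $ 2 / c) * x $ 1 + (a $ 1 / c) * x $ 2 + (a $ 2 * o' $ 1 - a $ 1 * o' $ 2) / c)"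
    by (rule ext) (simp add: cross_def diff_divide_distrib add_divide_distrib algebra_simps)
  then show "(\<lambda>x. cross a (x - o') / c) \<in> pol 1" by (simp only: pol_affine)
qed

lemma pol_al: "al o' a b \<in> pol 1" and pol_be: "be o' a b \<in> pol 1" and pol_mu: "mu o' a b \<in> pol 1"
proof -
  show 1: "al o' a b \<in> pol 1" "be o' a b \<in> pol 1"
    unfolding al_def[abs_def] be_def[abs_def] by (rule pol_cross)+
  have "(\<lambda>x. 1 - al o' a b x - be o' a b x) \<in> pol 1" by (intro bp_diff bp_const 1)
  then show "mu o' a b \<in> pol 1" unfolding mu_def[abs_def] .
qed

context
  fixes o' a b :: pt
  assumes ccw: "ccw o' a b"
begin

lemma cross_pos: "cross (a - o') (b - o') > 0"
  using ccw by (simp add: ccw_cross)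

text \<open>Cramer's rule for \<open>x - o'\<close> in the basis \<open>a - o'\<close>,
  \<open>b - o'\<close>.\<close>

lemma tri_decomp: "x = o' + al o' a b x *\<^sub>R (a - o') + be o' a b x *\<^sub>R (b - o')"
proof -
  define u v w where "u = a - o'" and "v = b - o'" and "w = x - o'"
  have c: "cross u v \<noteq> 0" using cross_pos by (simp add: u_def v_def)
  have "cross u v * w $ i = cross w v * u $ i + cross u w * v $ i" for i
    using exhaust_2[of i] by (auto simp: cross_def algebra_simps)
  then have "w $ i = (cross w v / cross u v) * u $ i + (cross u w / cross u v) * v $ i" for i
    using c by (simp add: field_simps)
  then have "w = (cross w v / cross u v) *\<^sub>R u + (cross u w / cross u v) *\<^sub>R v"
    by (simp add: vec_eq_iff)
  then show ?thesis unfolding al_def be_def u_def v_def w_def by (simp add: algebra_simps)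
qed

lemma al_be_unique:
  "al o' a b (o' + s *\<^sub>R (a - o') + t *\<^sub>R (b - o')) = s"
  "be o' a b (o' + s *\<^sub>R (a - o') + t *\<^sub>R (b - o')) = t"
proof -
  have e: "o' + s *\<^sub>R (a - o') + t *\<^sub>R (b - o') - o' = s *\<^sub>R (a - o') + t *\<^sub>R (b - o')" by simp
  show "al o' a b (o' + s *\<^sub>R (a - o') + t *\<^sub>R (b - o')) = s"
    "be o' a b (o' + s *\<^sub>R (a - o') + t *\<^sub>R (b - o')) = t"
    using cross_pos unfolding al_def be_def e cross_simps(1,2,5,6,7) by simp_all
qed

lemma tri_iff: "x \<in> convex hull {o', a, b} \<longleftrightarrow> 0 \<le> al o' a b x \<and> 0 \<le> be o' a b x \<and> 0 \<le> mu o' a b x"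
proof
  assume "x \<in> convex hull {o', a, b}"
  then obtain u v where "x = o' + u *\<^sub>R (a - o') + v *\<^sub>R (b - o')" "0 \<le> u" "0 \<le> v" "u + v \<le> 1"
    unfolding convex_hull_3_alt by blast
  then show "0 \<le> al o' a b x \<and> 0 \<le> be o' a b x \<and> 0 \<le> mu o' a b x"
    using al_be_unique[of u v] by (simp add: mu_def)
next
  assume "0 \<le> al o' a b x \<and> 0 \<le> be o' a b x \<and> 0 \<le> mu o' a b x"
  then show "x \<in> convex hull {o', a, b}"
    unfolding convex_hull_3_alt mem_Collect_eq
    by (intro exI[of _ "al o' a b x"] exI[of _ "be o' a b x"] conjI tri_decomp) (auto simp: mu_def)
qed

lemma al_be_mu_vertices:
  "al o' a b o' = 0" "be o' a b o' = 0" "mu o' a b o' = 1"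
  "al o' a b a = 1" "be o' a b a = 0" "mu o' a b a = 0"
  "al o' a b b = 0" "be o' a b b = 1" "mu o' a b b = 0"
  using al_be_unique[of 0 0] al_be_unique[of 1 0] al_be_unique[of 0 1] by (simp_all add: mu_def)

lemma al_be_mu_outer:
  "al o' a b (linepath a b t) = 1 - t" "be o' a b (linepath a b t) = t" "mu o' a b (linepath a b t) = 0"
proof -
  have "linepath a b t = o' + (1 - t) *\<^sub>R (a - o') + t *\<^sub>R (b - o')"
    by (simp add: linepath_def algebra_simps)
  then show "al o' a b (linepath a b t) = 1 - t" "be o' a b (linepath a b t) = t" "mu o' a b (linepath a b t) = 0"
    using al_be_unique[of "1 - t" t] by (simp_all add: mu_def)
qed

lemma be_linepath: "be o' a b (linepath o' a t) = 0" "mu o' a b (linepath o' a t) = 1 - t"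
    "al o' a b (linepath o' a t) = t"
  and al_linepath: "al o' a b (linepath o' b t) = 0" "mu o' a b (linepath o' b t) = 1 - t"
    "be o' a b (linepath o' b t) = t"
proof -
  have "linepath o' a t = o' + t *\<^sub>R (a - o') + 0 *\<^sub>R (b - o')" "linepath o' b t = o' + 0 *\<^sub>R (a - o') + t *\<^sub>R (b - o')"
    by (simp_all add: linepath_def algebra_simps)
  then show "be o' a b (linepath o' a t) = 0" "mu o' a b (linepath o' a t) = 1 - t" "al o' a b (linepath o' a t) = t"
    "al o' a b (linepath o' b t) = 0" "mu o' a b (linepath o' b t) = 1 - t" "be o' a b (linepath o' b t) = t"
    using al_be_unique[of t 0] al_be_unique[of 0 t] by (simp_all add: mu_def)
qed

lemma coords_bp: "(\<lambda>x. x $ i) \<in> bipoly 1 (mu o' a b) (be o' a b)"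
proof -
  have e: "x $ i = o' $ i + (a - o') $ i * (1 - mu o' a b x - be o' a b x) + (b - o') $ i * be o' a b x" for x
  proof -
    have "x $ i = (o' + al o' a b x *\<^sub>R (a - o') + be o' a b x *\<^sub>R (b - o')) $ i"
      by (rule arg_cong[OF tri_decomp])
    also have "\<dots> = o' $ i + (a - o') $ i * (1 - mu o' a b x - be o' a b x) + (b - o') $ i * be o' a b x"
      by (simp add: mu_def mult.commute)
    finally show ?thesis .
  qed
  have "(\<lambda>x. x $ i) = (\<lambda>x. o' $ i + (a - o') $ i * (1 - mu o' a b x - be o' a b x) + (b - o') $ i * be o' a b x)"
    by (rule ext) (rule e)
  also have "\<dots> \<in> bipoly 1 (mu o' a b) (be o' a b)"
    using bp_u[of "mu o' a b" 0 "be o' a b"] bp_v[of "be o' a b" 0 "mu o' a b"]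
    by (intro bp_add bp_scale bp_diff bp_const) auto
  finally show ?thesis .
qed

text \<open>In the coordinates \<open>mu\<close>, \<open>be\<close> the remainder of the division by
  \<open>mu\<close> is a polynomial in \<open>be\<close>. On the edge \<open>mu\<close> is 0 and
  \<open>be\<close> equals the parameter, so the remainder has infinitely many zeros.\<close>

lemma pol_divide_mu:
  assumes f: "f \<in> pol (Suc k)" and z: "\<And>t. t \<in> {0..1} \<Longrightarrow> f (linepath a b t) = 0"
  shows "\<exists>g\<in>pol k. \<forall>x. f x = mu o' a b x * g x"
proof -
  have "f \<in> bipoly (Suc k) (mu o' a b) (be o' a b)"
    by (rule bp_subst[OF f]) (rule coords_bp)+
  then obtain g P where g: "g \<in> bipoly k (mu o' a b) (be o' a b)"
    and P: "\<And>x. f x = mu o' a b x * g x + poly P (be o' a b x)"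
    using bp_split by blast
  have "poly P t = 0" if "t \<in> {0..1}" for t
    using P[of "linepath a b t"] z[OF that] by (simp add: al_be_mu_outer)
  then have "P = 0" by (rule poly_zero_on_unit)
  moreover have "g \<in> pol k" by (rule bp_subst[OF g]) (rule pol_mu pol_be)+
  ultimately show ?thesis using P by auto
qed

lemma tri_open:
  assumes "al o' a b x > 0" "be o' a b x > 0" "mu o' a b x > 0"
  shows "x \<in> interior (convex hull {o', a, b})"
proof -
  have c: "continuous_on UNIV (al o' a b)" "continuous_on UNIV (be o' a b)" "continuous_on UNIV (mu o' a b)"
    unfolding mu_def[abs_def] al_def[abs_def] be_def[abs_def] cross_def[abs_def]
    by (intro continuous_intros ccw; use cross_pos in \<open>simp add: cross_def\<close>)+
  have "open ({x. 0 < al o' a b x} \<inter> {x. 0 < be o' a b x} \<inter> {x. 0 < mu o' a b x})"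
    using c by (intro open_Int open_Collect_less continuous_on_const) auto
  moreover have "{x. 0 < al o' a b x} \<inter> {x. 0 < be o' a b x} \<inter> {x. 0 < mu o' a b x} \<subseteq> convex hull {o', a, b}"
    unfolding subset_eq tri_iff by auto
  ultimately show ?thesis using assms interiorI by blast
qed

lemma tri_interior_nonempty: "interior (convex hull {o', a, b}) \<noteq> {}"
proof -
  have "o' + (1/3) *\<^sub>R (a - o') + (1/3) *\<^sub>R (b - o') \<in> interior (convex hull {o', a, b})"
    by (rule tri_open) (simp_all only: mu_def al_be_unique)
  then show ?thesis by blast
qed

lemma tri_sides_negligible: "negligible {x. al o' a b x = 0 \<or> be o' a b x = 0 \<or> mu o' a b x = 0}"
proof -
  have ne: "a - o' \<noteq> 0" "b - o' \<noteq> 0" "b - a \<noteq> 0" using cross_pos by (auto simp: cross_def)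
  have neg: "negligible {x. cross d x = c}" if d: "d \<noteq> 0" for d c
  proof -
    let ?n = "vector [- d $ 2, d $ 1] :: pt"
    have "?n \<noteq> 0" using d by (simp add: vec_eq_iff forall_2) argo
    moreover have "{x. cross d x = c} = {x. ?n \<bullet> x = c}"
      by (auto simp: cross_def inner_vec_def sum_2)
    ultimately show ?thesis using negligible_hyperplane by metis
  qed
  have "{x. al o' a b x = 0} = {x. cross (b - o') x = cross (b - o') o'}"
    using cross_pos by (auto simp: al_def cross_def algebra_simps)
  moreover have "{x. be o' a b x = 0} = {x. cross (a - o') x = cross (a - o') o'}"
    using cross_pos by (auto simp: be_def cross_def algebra_simps)
  moreover have "{x. mu o' a b x = 0} = {x. cross (b - a) x = cross (b - a) a}"
  proof -
    have e: "mu o' a b x * cross (a - o') (b - o') = cross (b - a) x - cross (b - a) a" for x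
    proof -
      have "mu o' a b x * cross (a - o') (b - o') = cross (a - o') (b - o') - cross (x - o') (b - o') - cross (a - o') (x - o')"
        using cross_pos unfolding mu_def al_def be_def by (simp add: field_simps)
      also have "\<dots> = cross (b - a) x - cross (b - a) a" by (simp add: cross_def algebra_simps)
      finally show ?thesis .
    qed
    have "mu o' a b x = 0 \<longleftrightarrow> mu o' a b x * cross (a - o') (b - o') = 0" for x
      using cross_pos by simp
    then show ?thesis unfolding e by simp
  qed
  ultimately have "{x. al o' a b x = 0 \<or> be o' a b x = 0 \<or> mu o' a b x = 0} =
    {x. cross (b - o') x = cross (b - o') o'} \<union> {x. cross (a - o') x = cross (a - o') o'} \<union> {x. cross (b - a) x = cross (b - a) a}"
    by blast
  then show ?thesis using neg ne by (simp add: negligible_Un)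
qed

end

text \<open>The right-hand side involves only the outer edge, which makes the functions
  \<open>mu\<close> of neighbouring triangles comparable when their outer edges are
  collinear.\<close>

lemma mu_cross:
  assumes "ccw o' a b"
  shows "mu o' a b x * cross (a - o') (b - o') = cross (b - a) (x - a)"
proof -
  have "mu o' a b x * cross (a - o') (b - o') = cross (a - o') (b - o') - cross (x - o') (b - o') - cross (a - o') (x - o')"
    using cross_pos[OF assms] unfolding mu_def al_def be_def by (simp add: field_simps)
  also have "\<dots> = cross (b - a) (x - a)" by (simp add: cross_def algebra_simps)
  finally show ?thesis .
qed

text \<open>A derivative within a convex set is compared only in directions from \<open>x\<close> to
  points of the set; restriction to the segment from \<open>x\<close> to \<open>y\<close> reduces
  the question to one variable.\<close>

lemma has_derivative_unique_convex:
  fixes g :: "'a::real_normed_vector \<Rightarrow> real"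
  assumes S: "convex S" "x \<in> S" "y \<in> S"
    and A: "(g has_derivative A) (at x within S)" and B: "(g has_derivative B) (at x within S)"
  shows "A (y - x) = B (y - x)"
proof -
  have *: "((\<lambda>t. g (x + t *\<^sub>R (y - x))) has_vector_derivative C (y - x)) (at 0 within {0..1})"
    if C: "(g has_derivative C) (at x within S)" for C
  proof -
    have "((\<lambda>t. x + t *\<^sub>R (y - x)) has_derivative (\<lambda>t. t *\<^sub>R (y - x))) (at 0 within {0..1})"
      by (auto intro!: derivative_eq_intros)
    moreover have "(g has_derivative C) (at (x + 0 *\<^sub>R (y - x)) within (\<lambda>t. x + t *\<^sub>R (y - x)) ` {0..1})"
    proof (rule has_derivative_subset)
      show "(g has_derivative C) (at (x + 0 *\<^sub>R (y - x)) within S)" using C by simp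
      have "x + t *\<^sub>R (y - x) \<in> S" if "t \<in> {0..1}" for t
        using convexD_alt[OF S, of t] that by (simp add: algebra_simps)
      then show "(\<lambda>t. x + t *\<^sub>R (y - x)) ` {0..1} \<subseteq> S" by blast
    qed
    ultimately have "((\<lambda>t. g (x + t *\<^sub>R (y - x))) has_derivative (\<lambda>t. C (t *\<^sub>R (y - x)))) (at 0 within {0..1})"
      using has_derivative_in_compose by blast
    moreover have "(\<lambda>t. C (t *\<^sub>R (y - x))) = (\<lambda>t. t *\<^sub>R C (y - x))"
      using linear_scale[OF has_derivative_linear[OF C]] by blast
    ultimately show ?thesis by (simp add: has_vector_derivative_def)
  qed
  have "at (0::real) within {0..1} \<noteq> bot"
    by (simp add: at_within_Icc_at_right trivial_limit_at_right_real)
  then show ?thesis using vector_derivative_unique_within *[OF A] *[OF B] by blast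
qed

text \<open>Directions into the triangle span the plane even at a vertex, so a derivative within the
  triangle must be that of the representing polynomial.\<close>

lemma tri_deriv_unique:
  assumes ccw: "ccw o' a b" and f: "f \<in> pol k" and x: "x \<in> convex hull {o', a, b}"
    and eq: "\<And>y. y \<in> convex hull {o', a, b} \<Longrightarrow> g y = f y"
    and A: "(g has_derivative A) (at x within convex hull {o', a, b})"
  shows "A h = pd 1 f x * h $ 1 + pd 2 f x * h $ 2"
proof -
  let ?K = "convex hull {o', a, b}"
  let ?B = "\<lambda>h::pt. pd 1 f x * h $ 1 + pd 2 f x * h $ 2"
  have B: "(g has_derivative ?B) (at x within ?K)"
    using has_derivative_transform[OF x eq has_derivative_at_withinI[OF pol_deriv[OF f]]] by simp
  have v: "o' \<in> ?K" "a \<in> ?K" "b \<in> ?K" by (auto intro: hull_inc)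
  have u: "A (y - x) = ?B (y - x)" if "y \<in> ?K" for y
    by (rule has_derivative_unique_convex[OF convex_convex_hull x that A B])
  have lin: "linear A" "linear ?B" by (rule has_derivative_linear[OF A], rule has_derivative_linear[OF B])
  have "A (y - o') = ?B (y - o')" if "y \<in> ?K" for y
  proof -
    have "A (y - o') = A (y - x) - A (o' - x)"
      using linear_diff[OF lin(1), of "y - x" "o' - x"] by simp
    also have "\<dots> = ?B (y - x) - ?B (o' - x)" using u[OF that] u[OF v(1)] by simp
    also have "\<dots> = ?B (y - o')" using linear_diff[OF lin(2), of "y - x" "o' - x"] by simp
    finally show ?thesis .
  qed
  then have ab: "A (a - o') = ?B (a - o')" "A (b - o') = ?B (b - o')" using v by blast+
  define s t where "s = al o' a b (o' + h)" and "t = be o' a b (o' + h)"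
  have h: "h = s *\<^sub>R (a - o') + t *\<^sub>R (b - o')"
    using tri_decomp[OF ccw, of "o' + h"] unfolding s_def t_def by simp
  have "A h = s *\<^sub>R A (a - o') + t *\<^sub>R A (b - o')"
    unfolding h using linear_add[OF lin(1)] linear_scale[OF lin(1)] by metis
  also have "\<dots> = s *\<^sub>R ?B (a - o') + t *\<^sub>R ?B (b - o')" using ab by simp
  also have "\<dots> = ?B h"
    unfolding h by (simp add: algebra_simps)
  finally show ?thesis .
qed

text \<open>The clockwise rotation by a right angle. On a triangle traversed counter-clockwise it
  turns the direction of an edge into an outward one.\<close>

definition rot_right :: "pt \<Rightarrow> pt"
  where "rot_right d = vector [d $ 2, - d $ 1]"

lemma rot_right_inner: "rot_right d \<bullet> w = - cross d w"
  by (simp add: rot_right_def cross_def inner_vec_def sum_2)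

lemma norm_rot_right: "norm (rot_right d) = norm d"
  by (simp add: norm_vec_def L2_set_def sum_2 rot_right_def add.commute)

lemma outer_normal_ccw:
  assumes "ccw a b c"
  shows "outer_normal (convex hull {a, b, c}) (closed_segment a b) = (1 / norm (b - a)) *\<^sub>R rot_right (b - a)"
  unfolding outer_normal_def
proof (rule the_equality)
  let ?n = "(1 / norm (b - a)) *\<^sub>R rot_right (b - a)"
  have pos: "cross (b - a) (c - a) > 0" using assms by (simp add: ccw_cross)
  then have ba: "b - a \<noteq> 0" by (auto simp: cross_def)
  then have l: "norm (b - a) > 0" by simp
  have seg: "\<exists>s. x = a + s *\<^sub>R (b - a)" if "x \<in> closed_segment a b" for x
    using that by (auto simp: closed_segment_def algebra_simps)
  show "norm ?n = 1 \<and> (\<forall>x\<in>closed_segment a b. \<forall>y\<in>closed_segment a b. ?n \<bullet> (x - y) = 0) \<and>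
    (\<forall>x\<in>convex hull {a, b, c}. \<forall>y\<in>closed_segment a b. ?n \<bullet> (x - y) \<le> 0)"
  proof (intro conjI ballI)
    show "norm ?n = 1" using l by (simp add: norm_rot_right)
    fix y assume y: "y \<in> closed_segment a b"
    obtain s where s: "y = a + s *\<^sub>R (b - a)" using seg[OF y] by blast
    show "?n \<bullet> (x - y) = 0" if x: "x \<in> closed_segment a b" for x
    proof -
      obtain t where t: "x = a + t *\<^sub>R (b - a)" using seg[OF x] by blast
      have "x - y = (t - s) *\<^sub>R (b - a)" unfolding s t by (simp add: algebra_simps)
      then show ?thesis by (simp add: rot_right_inner cross_simps(6,7))
    qed
    show "?n \<bullet> (x - y) \<le> 0" if x: "x \<in> convex hull {a, b, c}" for x
    proof -
      obtain u v where uv: "x = a + u *\<^sub>R (b - a) + v *\<^sub>R (c - a)" "0 \<le> v"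
        using x unfolding convex_hull_3_alt by blast
      have "x - y = (u - s) *\<^sub>R (b - a) + v *\<^sub>R (c - a)" unfolding s uv by (simp add: algebra_simps)
      then have "?n \<bullet> (x - y) = - (v * cross (b - a) (c - a)) / norm (b - a)"
        by (simp only: inner_scaleR_left rot_right_inner cross_simps(2,6,7)) simp
      then show ?thesis using uv(2) pos l by simp
    qed
  qed
  fix m assume m: "norm m = 1 \<and> (\<forall>x\<in>closed_segment a b. \<forall>y\<in>closed_segment a b. m \<bullet> (x - y) = 0) \<and>
    (\<forall>x\<in>convex hull {a, b, c}. \<forall>y\<in>closed_segment a b. m \<bullet> (x - y) \<le> 0)"
  define d where "d = b - a"
  have m1: "m \<bullet> d = 0" using m by (simp add: d_def)
  have m2: "m \<bullet> (c - a) \<le> 0" using m by (simp add: hull_inc)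
  \<comment> \<open>A vector orthogonal to \<open>d\<close> is a multiple of
    \<open>rot_right d\<close>. The unit length fixes the absolute value of the factor, the third
    vertex \<open>c\<close> its sign.\<close>
  define t where "t = (m \<bullet> rot_right d) / (norm d)\<^sup>2"
  have dd: "(norm d)\<^sup>2 = d $ 1 * d $ 1 + d $ 2 * d $ 2" "(norm d)\<^sup>2 \<noteq> 0"
    using ba by (simp_all add: d_def) (simp add: power2_norm_eq_inner inner_vec_def sum_2)
  have "(norm d)\<^sup>2 * m $ i = (m \<bullet> rot_right d) * rot_right d $ i" for i
  proof -
    have "m $ 1 * d $ 1 = - m $ 2 * d $ 2" using m1 by (simp add: inner_vec_def sum_2)
    then have "d $ 1 * (m $ 1 * d $ 1) = - d $ 1 * (m $ 2 * d $ 2)" "d $ 2 * (m $ 1 * d $ 1) = - d $ 2 * (m $ 2 * d $ 2)"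
      by simp_all
    then show ?thesis using exhaust_2[of i] unfolding dd(1)
      by (auto simp: rot_right_def inner_vec_def sum_2 algebra_simps)
  qed
  then have mt: "m = t *\<^sub>R rot_right d"
    unfolding t_def using dd(2) by (simp add: vec_eq_iff field_simps)
  have "\<bar>t\<bar> * norm d = 1" using m unfolding mt by (simp add: norm_rot_right)
  moreover have "t \<ge> 0"
  proof -
    have "t * cross d (c - a) \<ge> 0" using m2 unfolding mt by (simp add: rot_right_inner)
    then show ?thesis using pos unfolding d_def by (simp add: zero_le_mult_iff)
  qed
  ultimately have "t = 1 / norm d" using l unfolding d_def by (simp add: field_simps)
  then show "m = ?n" using mt unfolding d_def by simp
qed

section \<open>Univariate moments, and integrals of nonnegative functions\<close>

lemma poly_moments_square:
  assumes deg: "degree P \<le> k"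
    and mom: "\<And>j. j + 2 \<le> k \<Longrightarrow> integral {0..1} (\<lambda>t. poly P t * t ^ j) = 0"
  shows "integral {0..1} (\<lambda>t. (poly (pderiv P) t)\<^sup>2)
    = poly P 1 * poly (pderiv P) 1 - poly P 0 * poly (pderiv P) (0::real)"
proof -
  let ?D = "pderiv P" and ?D2 = "pderiv (pderiv P)"
  have int: "(\<lambda>t. poly Q t) integrable_on {0..1}" for Q :: "real poly"
    by (intro integrable_continuous_real continuous_intros)
  have "((\<lambda>t. poly P t * poly ?D2 t + poly ?D t * poly ?D t) has_integral
      poly P 1 * poly ?D 1 - poly P 0 * poly ?D 0) {0..1}"
    by (rule fundamental_theorem_of_calculus)
      (auto simp flip: has_real_derivative_iff_has_vector_derivative intro!: derivative_eq_intros)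
  then have 1: "integral {0..1} (\<lambda>t. poly P t * poly ?D2 t + poly ?D t * poly ?D t)
    = poly P 1 * poly ?D 1 - poly P 0 * poly ?D 0" by (rule integral_unique)
  \<comment> \<open>A monomial t^j occurring in P'' comes from t^(j+2) in P, so
    \<open>j + 2 \<le> k\<close> and its moment against P vanishes.\<close>
  have "integral {0..1} (\<lambda>t. poly P t * poly ?D2 t) = 0"
  proof -
    have "(\<lambda>t. poly P t * poly ?D2 t) = (\<lambda>t. \<Sum>j\<le>degree ?D2. coeff ?D2 j * (poly P t * t ^ j))"
      by (rule ext) (simp add: poly_altdef[of ?D2] sum_distrib_left mult_ac)
    then have "integral {0..1} (\<lambda>t. poly P t * poly ?D2 t)
      = (\<Sum>j\<le>degree ?D2. integral {0..1} (\<lambda>t. coeff ?D2 j * (poly P t * t ^ j)))"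
      by (simp only:) (intro integral_sum integrable_continuous_real continuous_intros, auto)
    also have "\<dots> = 0"
    proof (rule sum.neutral, rule ballI)
      fix j
      show "integral {0..1} (\<lambda>t. coeff ?D2 j * (poly P t * t ^ j)) = 0"
      proof (cases "coeff ?D2 j = 0")
        case False
        then have "coeff P (Suc (Suc j)) \<noteq> 0" by (simp add: coeff_pderiv)
        then have "j + 2 \<le> k" using deg le_degree by fastforce
        then show ?thesis using mom by simp
      qed simp
    qed
    finally show ?thesis .
  qed
  moreover have "integral {0..1} (\<lambda>t. poly P t * poly ?D2 t + poly ?D t * poly ?D t)
    = integral {0..1} (\<lambda>t. poly P t * poly ?D2 t) + integral {0..1} (\<lambda>t. poly ?D t * poly ?D t)"
    using int[of "P * ?D2"] int[of "?D * ?D"] by (intro Henstock_Kurzweil_Integration.integral_add) simp_all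
  ultimately show ?thesis using 1 by (simp add: power2_eq_square)
qed

lemma poly_square_integral:
  fixes P :: "real poly"
  shows "integral {0..1} (\<lambda>t. (poly P t)\<^sup>2) \<ge> 0"
    and "integral {0..1} (\<lambda>t. (poly P t)\<^sup>2) = 0 \<Longrightarrow> P = 0"
proof -
  have c: "continuous_on {0..1} (\<lambda>t. (poly P t)\<^sup>2)" by (intro continuous_intros)
  then show "integral {0..1} (\<lambda>t. (poly P t)\<^sup>2) \<ge> 0"
    by (intro integral_nonneg integrable_continuous_real) auto
  assume "integral {0..1} (\<lambda>t. (poly P t)\<^sup>2) = 0"
  then have "\<forall>t\<in>{0..1}. (poly P t)\<^sup>2 = 0" using integral_eq_0_iff[OF c] by simp
  then show "P = 0" by (intro poly_zero_on_unit) simp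
qed

text \<open>If \<open>h\<close> is the function composed of \<open>P\<close> and \<open>Q\<close> on adjacent intervals of lengths \<open>l\<close> and \<open>l'\<close>, then the moments
  annihilate \<open>h''\<close> and integrating \<open>h h''\<close> by parts leaves only \<open>\<integral>h'\<^sup>2 = 0\<close>.\<close>

lemma two_piece_zero:
  fixes P Q :: "real poly"
  assumes deg: "degree P \<le> k" "degree Q \<le> k" and l: "l > 0" "l' > 0"
    and bc: "poly P 0 = 0" "poly Q 1 = 0" "poly P 1 = poly Q 0"
    and join: "poly P 1 = 0 \<or> l' * poly (pderiv P) 1 = l * poly (pderiv Q) 0"
    and momP: "\<And>j. j + 2 \<le> k \<Longrightarrow> integral {0..1} (\<lambda>t. poly P t * t ^ j) = 0"
    and momQ: "\<And>j. j + 2 \<le> k \<Longrightarrow> integral {0..1} (\<lambda>t. poly Q t * t ^ j) = 0"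
  shows "P = 0" "Q = 0"
proof -
  let ?IP = "integral {0..1} (\<lambda>t. (poly (pderiv P) t)\<^sup>2)" and ?IQ = "integral {0..1} (\<lambda>t. (poly (pderiv Q) t)\<^sup>2)"
  have IP: "?IP = poly P 1 * poly (pderiv P) 1" using poly_moments_square[OF deg(1) momP] bc by simp
  have IQ: "?IQ = - (poly P 1 * poly (pderiv Q) 0)" using poly_moments_square[OF deg(2) momQ] bc by simp
  \<comment> \<open>Both pieces are parametrised over [0, 1], so the integral of the squared arc
    length derivative is \<open>?IP / l + ?IQ / l'\<close>; the identity is multiplied by
    \<open>l * l'\<close>.\<close>
  have s: "l' * ?IP + l * ?IQ = 0"
  proof -
    have "l' * ?IP + l * ?IQ = poly P 1 * (l' * poly (pderiv P) 1 - l * poly (pderiv Q) 0)"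
      unfolding IP IQ by (simp add: algebra_simps)
    then show ?thesis using join by auto
  qed
  have nn: "l' * ?IP \<ge> 0" "l * ?IQ \<ge> 0" using l poly_square_integral(1) by simp_all
  then have "l' * ?IP = 0" "l * ?IQ = 0" using s by linarith+
  then have "?IP = 0" "?IQ = 0" using l by simp_all
  then have "pderiv P = 0" "pderiv Q = 0" using poly_square_integral(2) by blast+
  then obtain c d where cd: "P = [:c:]" "Q = [:d:]" using pderiv_iszero by meson
  then show "P = 0" "Q = 0" using bc by simp_all
qed

text \<open>The corresponding fact for closures of open sets applies to the interior of
  \<open>K\<close>: the frontier of a convex set is negligible, so interior and closure have the
  same measure.\<close>

lemma integral_zero_imp_zero:
  fixes f :: "'a::euclidean_space \<Rightarrow> real"
  assumes K: "convex K" "compact K" "interior K \<noteq> {}" and f: "continuous_on K f" "\<And>x. x \<in> K \<Longrightarrow> f x \<ge> 0"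
    and int: "(f has_integral 0) K" and x: "x \<in> K"
  shows "f x = 0"
proof -
  have cl: "closure (interior K) = K"
    using K convex_closure_interior[OF K(1,3)] by (simp add: compact_imp_closed)
  have fr: "negligible (frontier K)" by (rule negligible_convex_frontier[OF K(1)])
  have bd: "bounded (interior K)" using K(2) compact_imp_bounded bounded_interior by blast
  have eq: "emeasure lborel K = emeasure lborel (interior K)"
  proof -
    have "K = interior K \<union> frontier K" using K(2) compact_imp_closed frontier_def closure_closed interior_subset by fast
    moreover have "interior K \<inter> frontier K = {}" unfolding frontier_def by blast
    moreover have "emeasure lborel (frontier K) = 0"
    proof -
      have "frontier K \<in> sets lborel" by simp
      moreover from this have "emeasure lebesgue (frontier K) = 0"
        using fr negligible_iff_emeasure0 sets_completionI_sets by blast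
      ultimately show ?thesis using emeasure_completion[of "frontier K" lborel] by simp
    qed
    ultimately show ?thesis
      by (metis add.right_neutral borel_closed borel_open frontier_closed open_interior plus_emeasure sets_lborel)
  qed
  show ?thesis
  proof (rule has_integral_0_closure_imp_0[of "interior K" f])
    show "continuous_on (closure (interior K)) f" "(f has_integral 0) (closure (interior K))"
      "x \<in> closure (interior K)" using f int x unfolding cl by auto
    show "0 \<le> f x" if "x \<in> interior K" for x using f(2) that interior_subset by blast
    show "0 < emeasure lborel (interior K)"
    proof -
      obtain c e where ce: "e > 0" "ball c e \<subseteq> interior K"
        using K(3) open_contains_ball[of "interior K"] by (metis all_not_in_conv open_interior)
      have "emeasure lborel (ball c e) \<noteq> 0"
        using content_ball_pos[OF ce(1), of c] by (auto simp: Sigma_Algebra.measure_def)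
      moreover have "emeasure lborel (ball c e) \<le> emeasure lborel (interior K)"
        using ce(2) by (intro emeasure_mono) auto
      ultimately show ?thesis using not_gr_zero by fastforce
    qed
    show "emeasure lborel (interior K) < \<infinity>" using bd by (rule emeasure_bounded_finite)
    show "emeasure lborel (closure (interior K)) = emeasure lborel (interior K)" using eq cl by simp
  qed simp
qed

lemma integrable_on_compact:
  fixes f :: "pt \<Rightarrow> real"
  assumes "compact K" "continuous_on K f"
  shows "f integrable_on K"
proof -
  have "integrable lborel (\<lambda>x. indicator K x *\<^sub>R f x)" by (rule borel_integrable_compact[OF assms])
  then have "(\<lambda>x. indicator K x *\<^sub>R f x) integrable_on UNIV"
    using has_integral_integral_lborel integrable_on_def by blast
  moreover have "(\<lambda>x. indicator K x *\<^sub>R f x) = (\<lambda>x. if x \<in> K then f x else 0)" by auto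
  ultimately show ?thesis using integrable_restrict_UNIV by metis
qed

subsection \<open>Geometry of the split\<close>

text \<open>Corners of the triangle are two indices apart and are addressed as
  \<open>p (s + 2)\<close>; these rules would rewrite that into iterated \<open>Suc\<close>.\<close>

declare add_2_eq_Suc [simp del] add_2_eq_Suc' [simp del]

locale powell_sabin =
  fixes z :: "nat \<Rightarrow> pt"
  assumes powell_sabin: "powell_sabin_points z"
begin

text \<open>The boundary vertices of the split are numbered counter-clockwise, with period \<open>6\<close>: even indices are corners of
  the triangle, odd ones the points \<open>z\<^sub>4, z\<^sub>5, z\<^sub>6\<close>. The pieces adjacent to \<open>z (3 + i)\<close> are \<open>K s\<close> and \<open>K (Suc s)\<close>
  with \<open>s = 2 (i - 1)\<close>.\<close>

definition p :: "nat \<Rightarrow> pt"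
  where "p s = z ([2, 4, 3, 5, 1, 6] ! (s mod 6))"

definition K :: "nat \<Rightarrow> pt set"
  where "K s = convex hull {z 0, p s, p (Suc s)}"

abbreviation "alpha s \<equiv> al (z 0) (p s) (p (Suc s))"
abbreviation "beta s \<equiv> be (z 0) (p s) (p (Suc s))"
abbreviation "m s \<equiv> mu (z 0) (p s) (p (Suc s))"
abbreviation "rim s \<equiv> linepath (p s) (p (Suc s))"
abbreviation "spoke s \<equiv> linepath (z 0) (p s)"

lemma p_mod: "p (s mod 6 + n) = p (s + n)"
  by (simp add: p_def mod_add_left_eq)

lemma p_period: "p (s + 6) = p s"
  by (simp add: p_def)

lemma p_mod6: "p (s mod 6) = p s"
  using p_mod[of s 0] by simp

lemma K_mod: "K (s mod 6) = K s"
  unfolding K_def using p_mod[of s 0] p_mod[of s 1] by simp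

lemma p_vals: "p 0 = z 2" "p 1 = z 4" "p 2 = z 3" "p 3 = z 5" "p 4 = z 1" "p 5 = z 6" "p 6 = z 2"
  "p 7 = z 4" "p 8 = z 3"
  by (simp_all add: p_def)

lemma nx_vals: "nx 1 = 2" "nx 2 = 3" "nx 3 = 1"
  by (simp_all add: nx_def)

text \<open>The dictionary between the cyclic numbering and the index \<open>i\<close> of the
  degrees of freedom: \<open>p (Suc s)\<close> splits the edge opposite \<open>z i\<close>.\<close>

lemma even_cases:
  assumes "even s"
  obtains i where "i \<in> {1..3}" "p s = z (nx i)" "p (Suc s) = z (3 + i)" "p (s + 2) = z (nx (nx i))" "p (s + 4) = z i"
proof -
  have "s mod 6 = 0 \<or> s mod 6 = 2 \<or> s mod 6 = 4" using assms by presburger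
  then show thesis
  proof (elim disjE)
    assume 1: "s mod 6 = 0"
    have "p s = z 2" "p (s + 1) = z 4" "p (s + 2) = z 3" "p (s + 4) = z 1"
      using p_mod[of s 0] p_mod[of s 1] p_mod[of s 2] p_mod[of s 4] unfolding 1
      by (simp_all add: p_vals del: One_nat_def)
    then show ?thesis using that[of 1] nx_vals by simp
  next
    assume 2: "s mod 6 = 2"
    have "p s = z 3" "p (s + 1) = z 5" "p (s + 2) = z 1" "p (s + 4) = z 2"
      using p_mod[of s 0] p_mod[of s 1] p_mod[of s 2] p_mod[of s 4] unfolding 2
      by (simp_all add: p_vals del: One_nat_def)
    then show ?thesis using that[of 2] nx_vals by simp
  next
    assume 3: "s mod 6 = 4"
    have "p s = z 1" "p (s + 1) = z 6" "p (s + 2) = z 2" "p (s + 4) = z 3"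
      using p_mod[of s 0] p_mod[of s 1] p_mod[of s 2] p_mod[of s 4] unfolding 3
      by (simp_all add: p_vals del: One_nat_def)
    then show ?thesis using that[of 3] nx_vals by simp
  qed
qed

lemma K1_K: "i \<in> {1..3} \<Longrightarrow> K1 z i = K (2 * (i - 1))"
  and K2_K: "i \<in> {1..3} \<Longrightarrow> K2 z i = K (Suc (2 * (i - 1)))"
proof -
  assume "i \<in> {1..3}"
  then have "i = 1 \<or> i = 2 \<or> i = 3" by auto
  then show "K1 z i = K (2 * (i - 1))" "K2 z i = K (Suc (2 * (i - 1)))"
    unfolding K1_def K2_def K_def by (auto simp: p_def nx_vals nx_vals(1)[unfolded One_nat_def])
qed

lemma ps_split_K: "ps_split z = K ` {..<6}"
proof -
  have "{1..3} = {1, 2, 3::nat}" by auto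
  then have "ps_split z = {K 0, K 2, K 4, K 1, K 3, K 5}"
    unfolding ps_split_def using K1_K[of 1] K1_K[of 2] K1_K[of 3] K2_K[of 1] K2_K[of 2] K2_K[of 3] by auto
  moreover have "{..<6} = {0, 1, 2, 3, 4, 5::nat}" by auto
  ultimately show ?thesis by auto
qed

lemma tri_p: "tri z = convex hull {p 4, p 0, p 2}"
  by (simp add: tri_def p_vals)

lemma bary:
  obtains c1 c2 c3 where "c1 > 0" "c2 > 0" "c3 > 0" "c1 + c2 + c3 = 1"
    "z 0 = c1 *\<^sub>R z 1 + c2 *\<^sub>R z 2 + c3 *\<^sub>R z 3"
proof -
  have ccw: "ccw (z 1) (z 2) (z 3)" and z0: "z 0 \<in> interior (tri z)" using powell_sabin by (auto simp: powell_sabin_points_def)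
  have "\<not> collinear {z 1, z 2, z 3}"
  proof
    assume "collinear {z 1, z 2, z 3}"
    then obtain u where u: "\<And>x y. x \<in> {z 1, z 2, z 3} \<Longrightarrow> y \<in> {z 1, z 2, z 3} \<Longrightarrow> \<exists>c. x - y = c *\<^sub>R u"
      unfolding collinear_def by blast
    obtain a where a: "z 2 - z 1 = a *\<^sub>R u" using u by blast
    obtain b where b: "z 3 - z 1 = b *\<^sub>R u" using u by blast
    show False using ccw unfolding ccw_cross a b cross_simps by simp
  qed
  from interior_convex_hull_3_minimal[OF this] z0 that show thesis
    unfolding tri_def by auto
qed

lemma tri_ccw: "even s \<Longrightarrow> cross (p (s + 2) - p s) (p (s + 4) - p (s + 2)) > 0"
proof -
  assume "even s"
  then obtain i where i: "i \<in> {1..3}" "p s = z (nx i)" "p (s + 2) = z (nx (nx i))" "p (s + 4) = z i"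
    by (rule even_cases)
  have ccw: "ccw (z 1) (z 2) (z 3)" using powell_sabin by (auto simp: powell_sabin_points_def)
  have "i = 1 \<or> i = 2 \<or> i = 3" using i(1) by auto
  then show ?thesis using ccw unfolding i
    by (auto simp: nx_vals nx_vals(1)[unfolded One_nat_def] ccw_cross cross_def algebra_simps)
qed

lemma big_ccw: "even s \<Longrightarrow> ccw (z 0) (p s) (p (s + 2))"
proof -
  assume "even s"
  then obtain i where i: "i \<in> {1..3}" "p s = z (nx i)" "p (s + 2) = z (nx (nx i))"
    by (rule even_cases)
  have ccw: "cross (z 2 - z 1) (z 3 - z 1) > 0" using powell_sabin by (auto simp: powell_sabin_points_def ccw_cross)
  obtain c1 c2 c3 where c: "c1 > 0" "c2 > 0" "c3 > 0" "c1 + c2 + c3 = 1"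
    "z 0 = c1 *\<^sub>R z 1 + c2 *\<^sub>R z 2 + c3 *\<^sub>R z 3" by (rule bary)
  have c1: "c1 = 1 - c2 - c3" using c by simp
  let ?D = "cross (z 2 - z 1) (z 3 - z 1)"
  \<comment> \<open>The areas of the three triangles with apex \<open>z 0\<close> are the
    barycentric coordinates of \<open>z 0\<close> times the area of the whole triangle, hence
    positive.\<close>
  have "cross (z 2 - z 0) (z 3 - z 0) = c1 * ?D"
    unfolding c(5) c1 by (simp add: cross_def algebra_simps)
  moreover have "cross (z 3 - z 0) (z 1 - z 0) = c2 * ?D"
    unfolding c(5) c1 by (simp add: cross_def algebra_simps)
  moreover have "cross (z 1 - z 0) (z 2 - z 0) = c3 * ?D"
    unfolding c(5) c1 by (simp add: cross_def algebra_simps)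
  moreover have "i = 1 \<or> i = 2 \<or> i = 3" using i(1) by auto
  ultimately show ?thesis unfolding i ccw_cross using ccw c(1,2,3)
    by (auto simp only: nx_vals mult_pos_pos)
qed

lemma mid:
  assumes "even s"
  obtains t where "0 < t" "t < 1" "p (Suc s) = (1 - t) *\<^sub>R p s + t *\<^sub>R p (s + 2)"
proof -
  obtain i where i: "i \<in> {1..3}" "p s = z (nx i)" "p (Suc s) = z (3 + i)" "p (s + 2) = z (nx (nx i))"
    using assms by (rule even_cases)
  have ne: "p s \<noteq> p (s + 2)" using tri_ccw[OF assms] by (auto simp: cross_def)
  have "p (Suc s) \<in> rel_interior (edge z i)" using powell_sabin i by (auto simp: powell_sabin_points_def)
  then have "p (Suc s) \<in> open_segment (p s) (p (s + 2))"
    using ne unfolding edge_def i by (simp add: rel_interior_closed_segment)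
  then show thesis using that unfolding in_segment by blast
qed

lemma mid_diff:
  assumes "p (Suc s) = (1 - t) *\<^sub>R p s + t *\<^sub>R p (s + 2)"
  shows "p (Suc s) - p s = t *\<^sub>R (p (s + 2) - p s)" "p (s + 2) - p (Suc s) = (1 - t) *\<^sub>R (p (s + 2) - p s)"
    "p (Suc s) - z 0 = (1 - t) *\<^sub>R (p s - z 0) + t *\<^sub>R (p (s + 2) - z 0)"
  unfolding assms by (simp_all add: algebra_simps)

lemma K_ccw: "ccw (z 0) (p s) (p (Suc s))"
proof (cases "even s")
  case True
  obtain t where t: "0 < t" "t < 1" "p (Suc s) = (1 - t) *\<^sub>R p s + t *\<^sub>R p (s + 2)" by (rule mid[OF True])
  show ?thesis using big_ccw[OF True] t(1) unfolding ccw_cross mid_diff[OF t(3)] cross_simps by simp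
next
  case False
  \<comment> \<open>Modulo 6, \<open>s + 5\<close> is the predecessor of \<open>s\<close>; this form
    avoids truncated subtraction.\<close>
  then have ev: "even (s + 5)" by simp
  obtain t where t: "0 < t" "t < 1" "p (Suc (s + 5)) = (1 - t) *\<^sub>R p (s + 5) + t *\<^sub>R p (s + 5 + 2)" by (rule mid[OF ev])
  have e: "p (Suc (s + 5)) = p s" "p (s + 5 + 2) = p (Suc s)"
    using p_period[of s] p_period[of "Suc s"] by (simp_all add: eval_nat_numeral)
  have "cross (p s - z 0) (p (Suc s) - z 0) = (1 - t) * cross (p (s + 5) - z 0) (p (Suc s) - z 0)"
    unfolding mid_diff(3)[OF t(3), unfolded e] by (simp only: cross_simps(1,5,7) mult_zero_right add_0_right)
  then show ?thesis using big_ccw[OF ev] t(2) unfolding ccw_cross e by simp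
qed

lemmas Kiff = tri_iff[OF K_ccw, folded K_def]

lemma K_p: "z 0 \<in> K s" "p s \<in> K s" "p (Suc s) \<in> K s"
  unfolding K_def by (auto intro: hull_inc)

lemma K_convex: "convex (K s)" and K_compact: "compact (K s)" and K_closed: "closed (K s)"
  and K_int: "interior (K s) \<noteq> {}"
  unfolding K_def
  by (simp_all add: finite_imp_compact_convex_hull compact_imp_closed tri_interior_nonempty[OF K_ccw])

lemma seg_K:
  assumes "t \<in> {0..1}"
  shows "spoke s t \<in> K s" "spoke (Suc s) t \<in> K s" "rim s t \<in> K s"
  using K_p[of s] K_convex[of s] assms closed_segment_subset[OF _ _ K_convex]
  by (metis linepath_in_path subsetD)+

lemma K_decomp:
  assumes "x \<in> K s"
  obtains a b where "a \<ge> 0" "b \<ge> 0" "x = z 0 + a *\<^sub>R (p s - z 0) + b *\<^sub>R (p (Suc s) - z 0)" "a + b \<le> 1"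
  using assms unfolding K_def convex_hull_3_alt by blast

text \<open>The two pieces lie on opposite sides of the spoke to \<open>p (Suc s)\<close>: one and
  the same cross product is nonpositive on \<open>K s\<close> and nonnegative on
  \<open>K (Suc s)\<close>.\<close>

lemma inter_same:
  assumes s: "even s" and x: "x \<in> K s" "x \<in> K (Suc s)"
  shows "x \<in> closed_segment (z 0) (p (Suc s))"
proof -
  obtain a b where ab: "a \<ge> 0" "b \<ge> 0" "x = z 0 + a *\<^sub>R (p s - z 0) + b *\<^sub>R (p (Suc s) - z 0)" "a + b \<le> 1"
    using K_decomp[OF x(1)] .
  obtain c d where cd: "c \<ge> 0" "d \<ge> 0" "x = z 0 + c *\<^sub>R (p (Suc s) - z 0) + d *\<^sub>R (p (Suc (Suc s)) - z 0)"
    using K_decomp[OF x(2)] by metis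
  have "cross (p (Suc s) - z 0) (x - z 0) = - (a * cross (p s - z 0) (p (Suc s) - z 0))"
    unfolding ab(3) by (simp add: cross_def algebra_simps)
  moreover have "cross (p (Suc s) - z 0) (x - z 0) = d * cross (p (Suc s) - z 0) (p (Suc (Suc s)) - z 0)"
    unfolding cd(3) by (simp add: cross_def algebra_simps)
  moreover have "cross (p s - z 0) (p (Suc s) - z 0) > 0" "cross (p (Suc s) - z 0) (p (Suc (Suc s)) - z 0) > 0"
    using K_ccw by (auto simp: ccw_cross)
  moreover from this have "a * cross (p s - z 0) (p (Suc s) - z 0) \<ge> 0"
    "d * cross (p (Suc s) - z 0) (p (Suc (Suc s)) - z 0) \<ge> 0" using ab(1) cd(2) by simp_all
  ultimately have "a * cross (p s - z 0) (p (Suc s) - z 0) = 0" by linarith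
  then have "a = 0" using K_ccw[of s] by (auto simp: ccw_cross)
  then have "x = z 0 + b *\<^sub>R (p (Suc s) - z 0)" "0 \<le> b" "b \<le> 1" using ab by simp_all
  then show ?thesis unfolding in_segment by (intro exI[of _ b]) (simp add: algebra_simps)
qed

text \<open>The pieces \<open>K s\<close> and \<open>K (Suc s)\<close> make up the triangle with
  vertices \<open>z 0\<close>, \<open>p s\<close>, \<open>p (s + 2)\<close>, whose coordinates are
  used. The implications for \<open>a = 0\<close> and \<open>b = 0\<close> record that each half
  meets the far side through \<open>z 0\<close> only in \<open>z 0\<close>.\<close>

lemma big_decomp:
  assumes s: "even s" and x: "x \<in> K s \<or> x \<in> K (Suc s)"
  obtains a b where "a \<ge> 0" "b \<ge> 0" "x = z 0 + a *\<^sub>R (p s - z 0) + b *\<^sub>R (p (s + 2) - z 0)"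
    "a = 0 \<Longrightarrow> x \<in> K s \<Longrightarrow> x = z 0" "b = 0 \<Longrightarrow> x \<in> K (Suc s) \<Longrightarrow> x = z 0" "a + b \<le> 1"
proof -
  obtain t where t: "0 < t" "t < 1" "p (Suc s) = (1 - t) *\<^sub>R p s + t *\<^sub>R p (s + 2)" by (rule mid[OF s])
  note md = mid_diff(3)[OF t(3)]
  note u = al_be_unique[OF big_ccw[OF s]]
  have 1: "\<exists>a b. a \<ge> 0 \<and> b \<ge> 0 \<and> x = z 0 + a *\<^sub>R (p s - z 0) + b *\<^sub>R (p (s + 2) - z 0) \<and> a + b \<le> 1 \<and> (a = 0 \<longrightarrow> x = z 0)"
    if xs: "x \<in> K s"
  proof -
    obtain c d where cd: "c \<ge> 0" "d \<ge> 0" "x = z 0 + c *\<^sub>R (p s - z 0) + d *\<^sub>R (p (Suc s) - z 0)" "c + d \<le> 1"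
      using K_decomp[OF xs] by metis
    have "x = z 0 + (c + d * (1 - t)) *\<^sub>R (p s - z 0) + (d * t) *\<^sub>R (p (s + 2) - z 0)"
      unfolding cd(3) md by (simp add: algebra_simps)
    moreover have "d * (1 - t) \<ge> 0" "d * t \<ge> 0" using cd t by simp_all
    moreover have "c + d * (1 - t) + d * t = c + d" by (simp add: algebra_simps)
    moreover have "x = z 0" if "c + d * (1 - t) = 0"
    proof -
      have "d * (1 - t) \<ge> 0" using cd t by simp
      then have "c = 0" "d * (1 - t) = 0" using that cd(1) by linarith+
      then show ?thesis using cd(3) t(2) by simp
    qed
    ultimately show ?thesis using cd by (intro exI[of _ "c + d * (1 - t)"] exI[of _ "d * t"]) auto
  qed
  have 2: "\<exists>a b. a \<ge> 0 \<and> b \<ge> 0 \<and> x = z 0 + a *\<^sub>R (p s - z 0) + b *\<^sub>R (p (s + 2) - z 0) \<and> a + b \<le> 1 \<and> (b = 0 \<longrightarrow> x = z 0)"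
    if xs: "x \<in> K (Suc s)"
  proof -
    obtain c d where cd: "c \<ge> 0" "d \<ge> 0" "x = z 0 + c *\<^sub>R (p (Suc s) - z 0) + d *\<^sub>R (p (s + 2) - z 0)" "c + d \<le> 1"
      using K_decomp[OF xs] by (metis Suc_1 add_2_eq_Suc')
    have "x = z 0 + (c * (1 - t)) *\<^sub>R (p s - z 0) + (c * t + d) *\<^sub>R (p (s + 2) - z 0)"
      unfolding cd(3) md by (simp add: algebra_simps)
    moreover have "c * (1 - t) \<ge> 0" "c * t \<ge> 0" using cd t by simp_all
    moreover have "c * (1 - t) + (c * t + d) = c + d" by (simp add: algebra_simps)
    moreover have "x = z 0" if "c * t + d = 0"
    proof -
      have "c * t \<ge> 0" using cd t by simp
      then have "d = 0" "c * t = 0" using that cd(2) by linarith+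
      then show ?thesis using cd(3) t(1) by simp
    qed
    ultimately show ?thesis using cd by (intro exI[of _ "c * (1 - t)"] exI[of _ "c * t + d"]) auto
  qed
  obtain a b where ab: "a \<ge> 0" "b \<ge> 0" "x = z 0 + a *\<^sub>R (p s - z 0) + b *\<^sub>R (p (s + 2) - z 0)" "a + b \<le> 1"
    using 1 2 x by blast
  have a: "x = z 0" if a0: "a = 0" "x \<in> K s"
  proof -
    obtain a' b' where *: "x = z 0 + a' *\<^sub>R (p s - z 0) + b' *\<^sub>R (p (s + 2) - z 0)" "a' = 0 \<longrightarrow> x = z 0"
      using 1[OF a0(2)] by blast
    have "a' = a" using u(1)[of a b] u(1)[of a' b'] ab(3) *(1) by metis
    then show ?thesis using * a0 by simp
  qed
  have b: "x = z 0" if b0: "b = 0" "x \<in> K (Suc s)"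
  proof -
    obtain a' b' where *: "x = z 0 + a' *\<^sub>R (p s - z 0) + b' *\<^sub>R (p (s + 2) - z 0)" "b' = 0 \<longrightarrow> x = z 0"
      using 2[OF b0(2)] by blast
    have "b' = b" using u(2)[of a b] u(2)[of a' b'] ab(3) *(1) by metis
    then show ?thesis using * b0 by simp
  qed
  show thesis using that[OF ab(1,2,3) a b ab(4)] .
qed

text \<open>The same comparison of signs for two neighbouring big triangles, which share the spoke
  to the corner \<open>p (s + 2)\<close>.\<close>

lemma inter_diff:
  assumes s: "even s" and x: "x \<in> K s \<or> x \<in> K (Suc s)" and y: "x \<in> K (s + 2) \<or> x \<in> K (s + 3)"
  shows "x \<in> closed_segment (z 0) (p (s + 2))" "x \<in> K s \<Longrightarrow> x = z 0" "x \<in> K (s + 3) \<Longrightarrow> x = z 0"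
proof -
  have e3: "Suc (s + 2) = s + 3" by simp
  have s2: "even (s + 2)" using s by simp
  have y': "x \<in> K (s + 2) \<or> x \<in> K (Suc (s + 2))" using y unfolding e3 .
  obtain a b where ab: "a \<ge> 0" "b \<ge> 0" "x = z 0 + a *\<^sub>R (p s - z 0) + b *\<^sub>R (p (s + 2) - z 0)"
    "a = 0 \<Longrightarrow> x \<in> K s \<Longrightarrow> x = z 0" "a + b \<le> 1" using big_decomp[OF s x] by metis
  obtain c d where cd: "c \<ge> 0" "d \<ge> 0" "x = z 0 + c *\<^sub>R (p (s + 2) - z 0) + d *\<^sub>R (p (s + 2 + 2) - z 0)"
    "d = 0 \<Longrightarrow> x \<in> K (Suc (s + 2)) \<Longrightarrow> x = z 0" using big_decomp[OF s2 y'] by metis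
  have "cross (p (s + 2) - z 0) (x - z 0) = - (a * cross (p s - z 0) (p (s + 2) - z 0))"
    unfolding ab(3) by (simp add: cross_def algebra_simps)
  moreover have "cross (p (s + 2) - z 0) (x - z 0) = d * cross (p (s + 2) - z 0) (p (s + 2 + 2) - z 0)"
    unfolding cd(3) by (simp add: cross_def algebra_simps)
  moreover have pos: "cross (p s - z 0) (p (s + 2) - z 0) > 0" "cross (p (s + 2) - z 0) (p (s + 2 + 2) - z 0) > 0"
    using big_ccw[OF s] big_ccw[OF s2] by (auto simp: ccw_cross)
  moreover have "a * cross (p s - z 0) (p (s + 2) - z 0) \<ge> 0" "d * cross (p (s + 2) - z 0) (p (s + 2 + 2) - z 0) \<ge> 0"
    using pos ab(1) cd(2) by simp_all
  ultimately have "a * cross (p s - z 0) (p (s + 2) - z 0) = 0" "d * cross (p (s + 2) - z 0) (p (s + 2 + 2) - z 0) = 0"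
    by linarith+
  then have ad: "a = 0" "d = 0" using pos by auto
  have "x = z 0 + b *\<^sub>R (p (s + 2) - z 0)" "0 \<le> b" "b \<le> 1" using ab ad by simp_all
  then show "x \<in> closed_segment (z 0) (p (s + 2))"
    unfolding in_segment by (intro exI[of _ b]) (simp add: algebra_simps)
  show "x \<in> K s \<Longrightarrow> x = z 0" using ab ad by blast
  show "x \<in> K (s + 3) \<Longrightarrow> x = z 0" using cd(4) ad unfolding e3 by simp
qed

lemma K_inter:
  assumes "s < t" "t < 6" "x \<in> K s" "x \<in> K t"
  shows "x = z 0 \<or> (t = Suc s \<and> x \<in> closed_segment (z 0) (p t)) \<or> (s = 0 \<and> t = 5 \<and> x \<in> closed_segment (z 0) (p 0))"
proof -
  define u v where "u = 2 * (s div 2)" and "v = 2 * (t div 2)"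
  have ev: "even u" "even v" and su: "s = u \<or> s = Suc u" and tv: "t = v \<or> t = Suc v"
    unfolding u_def v_def by presburger+
  \<comment> \<open>Taken in pairs, the pieces form three big triangles, any two of which are
    neighbours. The last alternative is the wrap-around from index 4 to index 0.\<close>
  have "v = u \<or> v = u + 2 \<or> (u = 0 \<and> v = 4)"
    using assms(1,2) unfolding u_def v_def by presburger
  then show ?thesis
  proof (elim disjE)
    assume 1: "v = u"
    then have "s = u" "t = Suc u" using su tv assms(1) by auto
    then show ?thesis using inter_same[of u x] ev assms by simp
  next
    assume 2: "v = u + 2"
    have e3: "Suc (u + 2) = u + 3" by simp
    have "x \<in> K u \<or> x \<in> K (Suc u)" "x \<in> K (u + 2) \<or> x \<in> K (u + 3)"
      using su tv assms(3,4) unfolding 2 e3 by auto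
    note d = inter_diff[OF ev(1) this]
    show ?thesis using su tv d assms(3,4) unfolding 2 e3 by auto
  next
    assume 3: "u = 0 \<and> v = 4"
    have K6: "K (4 + 2) = K 0" "K (4 + 3) = K 1" "p (4 + 2) = p 0"
      using K_mod[of 6] K_mod[of 7] p_period[of 0] by simp_all
    have "x \<in> K 4 \<or> x \<in> K (Suc 4)" "x \<in> K (4 + 2) \<or> x \<in> K (4 + 3)"
      unfolding K6 using su tv assms(3,4) 3 by auto
    note d = inter_diff[OF _ this, unfolded K6]
    show ?thesis using su tv d assms(3,4) 3 by auto
  qed
qed

text \<open>Phrased through barycentric coordinates because their zero sets are known to be
  negligible.\<close>

lemma K_overlap:
  assumes "s < 6" "t < 6" "s \<noteq> t" "x \<in> K s" "x \<in> K t"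
  shows "alpha s x = 0 \<or> beta s x = 0"
proof -
  have p6: "p 6 = p 0" using p_period[of 0] by simp
  have "x = z 0 \<or> x \<in> closed_segment (z 0) (p s) \<or> x \<in> closed_segment (z 0) (p (Suc s))"
  proof (cases "s < t")
    case True
    then show ?thesis using K_inter[of s t x] assms by auto
  next
    case False
    then have "t < s" using assms by simp
    then show ?thesis using K_inter[of t s x] assms p6 by auto
  qed
  then have "x \<in> spoke s ` {0..1} \<or> x \<in> spoke (Suc s) ` {0..1}"
    unfolding linepath_image_01 by auto
  then show ?thesis using be_linepath(1)[OF K_ccw] al_linepath(1)[OF K_ccw] by auto
qed

lemma K_inj: "inj_on K {..<6}"
proof (rule inj_onI, rule ccontr)
  fix s t assume st: "s \<in> {..<6}" "t \<in> {..<6}" "K s = K t" "s \<noteq> t"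
  let ?x = "z 0 + (1/3) *\<^sub>R (p s - z 0) + (1/3) *\<^sub>R (p (Suc s) - z 0)"
  note u = al_be_unique[OF K_ccw, of s "1/3" "1/3"]
  have "?x \<in> K s" unfolding Kiff mu_def u by simp
  then show False using K_overlap[of s t ?x] st unfolding u by simp
qed

text \<open>Pieces that are not neighbours meet only in \<open>z 0\<close>, and there the equations
  with \<open>t = 0\<close> form a chain through all six pieces.\<close>

lemma glue:
  fixes F :: "nat \<Rightarrow> pt \<Rightarrow> real"
  assumes A: "\<And>s t. s < 6 \<Longrightarrow> t \<in> {0..1} \<Longrightarrow>
      F s (spoke (Suc s) t) = F (Suc s mod 6) (spoke (Suc s) t)"
    and st: "s < 6" "t < 6" and x: "x \<in> K s" "x \<in> K t"
  shows "F s x = F t x"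
proof -
  have z0: "F n (z 0) = F 0 (z 0)" if "n < 6" for n
    using that
  proof (induction n)
    case (Suc n)
    then show ?case using A[of n 0] by (simp add: linepath_0')
  qed simp
  have seg: "F n y = F (Suc n mod 6) y" if "n < 6" "y \<in> closed_segment (z 0) (p (Suc n))" for n y
    using A[OF that(1)] that(2) unfolding linepath_image_01[symmetric] by blast
  have *: "F s x = F t x" if "s < t" "s < 6" "t < 6" "x \<in> K s" "x \<in> K t" for s t
  proof -
    from K_inter[OF that(1,3,4,5)] show ?thesis
    proof (elim disjE conjE)
      assume "x = z 0"
      then show ?thesis using z0[of s] z0[of t] that(2,3) by simp
    next
      assume 2: "t = Suc s" "x \<in> closed_segment (z 0) (p t)"
      then have "Suc s mod 6 = t" using that(3) by simp
      then show ?thesis using seg[of s x] that(2) 2 by metis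
    next
      assume "s = 0" "t = 5" "x \<in> closed_segment (z 0) (p 0)"
      then show ?thesis using seg[of 5 x] p_period[of 0] by simp
    qed
  qed
  show ?thesis
  proof (rule linorder_cases[of s t])
    assume "t < s"
    then show ?thesis using *[of t s] st x by simp
  qed (use * st x in auto)
qed

lemma K_subset: "K s \<subseteq> tri z"
proof -
  have T: "convex (tri z)" unfolding tri_def by simp
  have z0: "z 0 \<in> tri z" using powell_sabin interior_subset by (auto simp: powell_sabin_points_def)
  have v: "p 0 \<in> tri z" "p 2 \<in> tri z" "p 4 \<in> tri z" unfolding tri_p by (auto intro: hull_inc)
  have c: "p t \<in> tri z" if "even t" for t
  proof -
    have "t mod 6 = 0 \<or> t mod 6 = 2 \<or> t mod 6 = 4" using that by presburger
    then show ?thesis using v p_mod6[of t] by auto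
  qed
  have "p t \<in> tri z" for t
  proof (cases "even t")
    case False
    then have ev: "even (t + 5)" by simp
    obtain u where u: "0 < u" "u < 1" "p (Suc (t + 5)) = (1 - u) *\<^sub>R p (t + 5) + u *\<^sub>R p (t + 5 + 2)"
      by (rule mid[OF ev])
    have "p (Suc (t + 5)) = p t" using p_period[of t] by (simp add: eval_nat_numeral)
    then show ?thesis using u convexD_alt[OF T c[OF ev] c[of "t + 5 + 2"]] ev by simp
  qed (rule c)
  then show ?thesis unfolding K_def using z0 T by (intro hull_minimal) auto
qed

text \<open>Which half contains the point is decided by the side of the spoke to
  \<open>p (Suc s)\<close>. In each half \<open>p (Suc s)\<close> takes over from the corner that
  this half lacks.\<close>

lemma big_K:
  assumes s: "even s" and n: "u \<ge> 0" "a \<ge> 0" "b \<ge> 0" "u + a + b = 1"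
  shows "u *\<^sub>R z 0 + a *\<^sub>R p s + b *\<^sub>R p (s + 2) \<in> K s \<union> K (Suc s)"
proof -
  obtain t where t: "0 < t" "t < 1" "p (Suc s) = (1 - t) *\<^sub>R p s + t *\<^sub>R p (s + 2)" by (rule mid[OF s])
  let ?x = "u *\<^sub>R z 0 + a *\<^sub>R p s + b *\<^sub>R p (s + 2)"
  show ?thesis
  proof (cases "b * (1 - t) \<le> a * t")
    case True
    \<comment> \<open>Expressing the share \<open>b\<close> of \<open>p (s + 2)\<close> through
      \<open>p (Suc s)\<close> uses up the amount \<open>c\<close> of the weight of
      \<open>p s\<close>; the case hypothesis says that this much is available.\<close>
    define c where "c = b * (1 - t) / t"
    have c: "a - c \<ge> 0" "b / t - c = b" unfolding c_def using True t by (simp_all add: field_simps)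
    have "(b / t) *\<^sub>R p (Suc s) = c *\<^sub>R p s + b *\<^sub>R p (s + 2)"
      unfolding t(3) c_def using t(1) by (simp add: scaleR_add_right)
    then have "?x = u *\<^sub>R z 0 + (a - c) *\<^sub>R p s + (b / t) *\<^sub>R p (Suc s)"
      by (simp add: algebra_simps)
    moreover have "u + (a - c) + b / t = 1" using n(4) c(2) by linarith
    ultimately show ?thesis unfolding K_def convex_hull_3 using n t c
      by (intro UnI1 CollectI exI[of _ u] exI[of _ "a - c"] exI[of _ "b / t"]) simp
  next
    case False
    define c where "c = a * t / (1 - t)"
    have e: "(a / (1 - t)) * (1 - t) = a" "(a / (1 - t)) * t = c" unfolding c_def using t by simp_all
    have "a / (1 - t) - c = (a / (1 - t)) * (1 - t)"
      unfolding e(2)[symmetric] by (simp only: right_diff_distrib mult_1_right)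
    then have c: "a / (1 - t) - c = a" unfolding e(1) .
    have c': "b - c \<ge> 0" unfolding c_def using False t by (simp add: field_simps)
    have e2: "Suc (Suc s) = s + 2" by simp
    have "(a / (1 - t)) *\<^sub>R p (Suc s) = a *\<^sub>R p s + c *\<^sub>R p (s + 2)"
      unfolding t(3) scaleR_add_right scaleR_scaleR e ..
    then have "?x = u *\<^sub>R z 0 + (a / (1 - t)) *\<^sub>R p (Suc s) + (b - c) *\<^sub>R p (s + 2)"
      by (simp add: algebra_simps)
    moreover have "u + a / (1 - t) + (b - c) = 1" using n(4) c by linarith
    ultimately show ?thesis unfolding K_def e2 convex_hull_3 using n(1,2) t(1,2) c'
      by (intro UnI2 CollectI exI[of _ u] exI[of _ "a / (1 - t)"] exI[of _ "b - c"]) simp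
  qed
qed

lemma tri_Union: "tri z = (\<Union>s<6. K s)"
proof
  show "(\<Union>s<6. K s) \<subseteq> tri z" using K_subset by blast
  obtain c1 c2 c3 where c: "c1 > 0" "c2 > 0" "c3 > 0" "c1 + c2 + c3 = 1"
    "z 0 = c1 *\<^sub>R z 1 + c2 *\<^sub>R z 2 + c3 *\<^sub>R z 3" by (rule bary)
  show "tri z \<subseteq> (\<Union>s<6. K s)"
  proof
    fix x assume "x \<in> tri z"
    then obtain u v w where x: "u \<ge> 0" "v \<ge> 0" "w \<ge> 0" "u + v + w = 1"
      "x = u *\<^sub>R z 1 + v *\<^sub>R z 2 + w *\<^sub>R z 3"
      unfolding tri_def convex_hull_3 by blast
    \<comment> \<open>The largest multiple of \<open>z 0\<close> that can be split off with
      nonnegative remaining weights. One of these weights then vanishes, which places the point in a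
      big triangle.\<close>
    define r where "r = min (u / c1) (min (v / c2) (w / c3))"
    have r: "r \<ge> 0" using x c unfolding r_def by simp
    have "r \<le> u / c1" "r \<le> v / c2" "r \<le> w / c3" unfolding r_def by simp_all
    then have le: "0 \<le> u - r * c1" "0 \<le> v - r * c2" "0 \<le> w - r * c3"
      using c by (simp_all add: pos_le_divide_eq)
    have "r = u / c1 \<or> r = v / c2 \<or> r = w / c3" unfolding r_def by (simp add: min_def)
    then have eq: "u - r * c1 = 0 \<or> v - r * c2 = 0 \<or> w - r * c3 = 0" using c by auto
    have xe: "x = r *\<^sub>R z 0 + (u - r * c1) *\<^sub>R z 1 + (v - r * c2) *\<^sub>R z 2 + (w - r * c3) *\<^sub>R z 3"
      unfolding x(5) c(5) by (simp add: algebra_simps)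
    have "r * c1 + r * c2 + r * c3 = r" using c(4) by (metis distrib_left mult.right_neutral)
    then have sum: "r + (u - r * c1) + (v - r * c2) + (w - r * c3) = 1" using x(4) by linarith
    have K': "K s \<union> K (Suc s) \<subseteq> (\<Union>s<6. K s)" if "s < 5" for s
      using that by (intro Un_least UN_upper) auto
    from eq show "x \<in> (\<Union>s<6. K s)"
    proof (elim disjE)
      assume 0: "u - r * c1 = 0"
      then show ?thesis using big_K[of 0 r "v - r * c2" "w - r * c3"] r le sum xe K'[of 0] p_vals by auto
    next
      assume 0: "v - r * c2 = 0"
      have "x = r *\<^sub>R z 0 + (w - r * c3) *\<^sub>R z 3 + (u - r * c1) *\<^sub>R z 1" using xe 0 by (simp add: algebra_simps)
      then show ?thesis using big_K[of 2 r "w - r * c3" "u - r * c1"] r le sum 0 K'[of 2] p_vals by auto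
    next
      assume 0: "w - r * c3 = 0"
      then show ?thesis using big_K[of 4 r "u - r * c1" "v - r * c2"] r le sum xe K'[of 4] p_vals by auto
    qed
  qed
qed

lemma rim_Un:
  assumes "even s"
  shows "closed_segment (p s) (p (Suc s)) \<union> closed_segment (p (Suc s)) (p (s + 2)) = closed_segment (p s) (p (s + 2))"
proof (rule Un_closed_segment)
  obtain t where "0 < t" "t < 1" "p (Suc s) = (1 - t) *\<^sub>R p s + t *\<^sub>R p (s + 2)" by (rule mid[OF assms])
  then show "p (Suc s) \<in> closed_segment (p s) (p (s + 2))" unfolding in_segment by (metis less_imp_le)
qed

lemma frontier_tri: "frontier (tri z) = (\<Union>s<6. closed_segment (p s) (p (Suc s)))"
proof -
  have "frontier (tri z) = closed_segment (p 4) (p 0) \<union> closed_segment (p 0) (p 2) \<union> closed_segment (p 2) (p 4)"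
    unfolding tri_p by (rule frontier_of_triangle) simp
  also have "\<dots> = closed_segment (p 0) (p (0 + 2)) \<union> closed_segment (p 2) (p (2 + 2)) \<union> closed_segment (p 4) (p (4 + 2))"
    using p_period[of 0] by auto
  also have "\<dots> = (\<Union>s\<in>{0, 1, 2, 3, 4, 5}. closed_segment (p s) (p (Suc s)))"
    using rim_Un[of 0] rim_Un[of 2] rim_Un[of 4] by (auto simp flip: numeral_2_eq_2)
  also have "{0, 1, 2, 3, 4, 5::nat} = {..<6}" by auto
  finally show ?thesis .
qed

lemma tri_closed: "closed (tri z)" and tri_compact: "compact (tri z)" and tri_convex: "convex (tri z)"
  and tri_interior: "interior (tri z) \<noteq> {}"
  using powell_sabin unfolding tri_def
  by (auto simp: finite_imp_compact_convex_hull compact_imp_closed powell_sabin_points_def tri_def)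

text \<open>Both are the affine function that is 1 at \<open>z 0\<close> and 0 on the line through
  \<open>p s\<close> and \<open>p (s + 2)\<close>, since \<open>p (Suc s)\<close> lies on this line.
  The C^1 conditions at the split points rest on this.\<close>

lemma m_even:
  assumes "even s"
  shows "m (Suc s) = m s"
proof
  fix x
  obtain t where t: "0 < t" "t < 1" "p (Suc s) = (1 - t) *\<^sub>R p s + t *\<^sub>R p (s + 2)" by (rule mid[OF assms])
  note md = mid_diff[OF t(3)]
  let ?C = "cross (p s - z 0) (p (s + 2) - z 0)"
  have C: "?C > 0" using big_ccw[OF assms] by (simp add: ccw_cross)
  have "m s x * cross (p s - z 0) (p (Suc s) - z 0) = cross (p (Suc s) - p s) (x - p s)"
    by (rule mu_cross[OF K_ccw])
  then have "t * (m s x * ?C) = t * cross (p (s + 2) - p s) (x - p s)"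
    unfolding md cross_simps(2,5,6,7) by (simp add: mult_ac)
  then have 1: "m s x * ?C = cross (p (s + 2) - p s) (x - p s)" using t by simp
  have "m (Suc s) x * cross (p (Suc s) - z 0) (p (Suc (Suc s)) - z 0) = cross (p (Suc (Suc s)) - p (Suc s)) (x - p (Suc s))"
    by (rule mu_cross[OF K_ccw])
  moreover have "Suc (Suc s) = s + 2" by simp
  ultimately have "m (Suc s) x * cross (p (Suc s) - z 0) (p (s + 2) - z 0) = cross (p (s + 2) - p (Suc s)) (x - p (Suc s))" by metis
  then have "(1 - t) * (m (Suc s) x * ?C) = (1 - t) * cross (p (s + 2) - p s) (x - p (Suc s))"
    unfolding md cross_simps(1,5,6,7) by (simp add: mult_ac)
  then have "m (Suc s) x * ?C = cross (p (s + 2) - p s) (x - p (Suc s))" using t by simp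
  also have "x - p (Suc s) = (x - p s) - (p (Suc s) - p s)" by simp
  also have "cross (p (s + 2) - p s) \<dots> = cross (p (s + 2) - p s) (x - p s)"
    by (simp only: md cross_simps(4)[of _ "x - p s" "t *\<^sub>R _"] cross_simps(6,7) mult_zero_right diff_0_right)
  finally show "m (Suc s) x = m s x" using 1 C by (metis less_irrefl mult_right_cancel)
qed

text \<open>Here \<open>p (Suc s)\<close> is a corner: \<open>p s\<close> lies on the preceding edge
  of the triangle, off the line on which \<open>m (Suc s)\<close> vanishes. As \<open>m s\<close>
  does vanish at \<open>p s\<close>, the two functions differ.\<close>

lemma m_odd:
  assumes "odd s"
  shows "m (Suc s) (p s) \<noteq> 0"
proof -
  have e: "p (s + 5 + 1) = p s" "p (s + 5 + 2) = p (Suc s)" "p (s + 5 + 3) = p (s + 2)" "p (s + 5 + 4) = p (s + 3)"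
    using p_period[of s] p_period[of "Suc s"] p_period[of "s + 2"] p_period[of "s + 3"] by (simp_all add: eval_nat_numeral)
  have ev: "even (s + 5)" "even (s + 1)" using assms by simp_all
  obtain t where t: "0 < t" "t < 1" "p (Suc (s + 5)) = (1 - t) *\<^sub>R p (s + 5) + t *\<^sub>R p (s + 5 + 2)" by (rule mid[OF ev(1)])
  obtain r where r: "0 < r" "r < 1" "p (Suc (s + 1)) = (1 - r) *\<^sub>R p (s + 1) + r *\<^sub>R p (s + 1 + 2)" by (rule mid[OF ev(2)])
  have 1: "p (Suc s) - p s = (1 - t) *\<^sub>R (p (Suc s) - p (s + 5))" using mid_diff(2)[OF t(3)] e by simp
  have 2: "p (Suc (Suc s)) - p (Suc s) = r *\<^sub>R (p (s + 3) - p (Suc s))"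
    using mid_diff(1)[OF r(3)] by (simp add: eval_nat_numeral)
  have "m (Suc s) (p s) * cross (p (Suc s) - z 0) (p (Suc (Suc s)) - z 0) = cross (p (Suc (Suc s)) - p (Suc s)) (p s - p (Suc s))"
    by (rule mu_cross[OF K_ccw])
  also have "p s - p (Suc s) = - (p (Suc s) - p s)" by simp
  also have "cross (p (Suc (Suc s)) - p (Suc s)) \<dots> = r * (1 - t) * cross (p (Suc s) - p (s + 5)) (p (s + 3) - p (Suc s))"
    unfolding 1 2 by (simp only: cross_simps(5,6,9)) (simp add: cross_commute[of "p (Suc s) - _"])
  also have "\<dots> > 0" using tri_ccw[OF ev(1)] r t unfolding e by simp
  finally show ?thesis by auto
qed

end

subsection \<open>Piecewise polynomials\<close>

lemma poly_on_iff:
  "q \<in> poly_on (int k) S \<longleftrightarrow> (\<exists>f\<in>pol k. \<forall>x\<in>S. q x = f x) \<and> (\<forall>x. x \<notin> S \<longrightarrow> q x = 0)"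
proof -
  have e: "{(i, j). int i + int j \<le> int k} = {(i, j). i + j \<le> k}"
    by (auto simp flip: of_nat_add)
  have "(\<exists>c. \<forall>x\<in>S. q x = (\<Sum>(i, j) | i + j \<le> k. c i j * (x $ 1) ^ i * (x $ 2) ^ j))
     \<longleftrightarrow> (\<exists>f\<in>pol k. \<forall>x\<in>S. q x = f x)"
  proof
    assume "\<exists>c. \<forall>x\<in>S. q x = (\<Sum>(i, j) | i + j \<le> k. c i j * (x $ 1) ^ i * (x $ 2) ^ j)"
    then obtain c where "\<forall>x\<in>S. q x = (\<Sum>(i, j) | i + j \<le> k. c i j * (x $ 1) ^ i * (x $ 2) ^ j)" by blast
    then show "\<exists>f\<in>pol k. \<forall>x\<in>S. q x = f x"
      by (intro bexI[of _ "\<lambda>x. \<Sum>(i, j) | i + j \<le> k. c i j * (x $ 1) ^ i * (x $ 2) ^ j"])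
        (auto simp: pol_iff)
  next
    assume "\<exists>f\<in>pol k. \<forall>x\<in>S. q x = f x"
    then obtain f where f: "f \<in> pol k" "\<forall>x\<in>S. q x = f x" by blast
    obtain c where "\<forall>x. f x = (\<Sum>(i, j) | i + j \<le> k. c i j * (x $ 1) ^ i * (x $ 2) ^ j)"
      using f(1) unfolding pol_iff by blast
    then show "\<exists>c. \<forall>x\<in>S. q x = (\<Sum>(i, j) | i + j \<le> k. c i j * (x $ 1) ^ i * (x $ 2) ^ j)"
      using f(2) by (intro exI[of _ c]) simp
  qed
  then show ?thesis unfolding poly_on_def e by simp
qed

text \<open>The degree \<open>r - 2\<close> for \<open>r = 1\<close>, where the edge moments
  disappear.\<close>

lemma poly_on_neg: "poly_on (- 1) S = {0}"
proof -
  have "{(i, j). int i + int j \<le> - 1} = {}" by auto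
  then show ?thesis unfolding poly_on_def by (auto simp: fun_eq_iff) blast
qed

lemma pol_continuous: "f \<in> pol k \<Longrightarrow> continuous_on S f"
  using pol_deriv has_derivative_continuous
  by (meson continuous_at_imp_continuous_on)

lemma subspace_poly_on: "subspace (poly_on (int k) S)"
proof (rule subspaceI)
  show "0 \<in> poly_on (int k) S" unfolding poly_on_iff by (auto intro!: bexI[OF _ bp_const[of 0]])
  show "q + q' \<in> poly_on (int k) S" if q: "q \<in> poly_on (int k) S" "q' \<in> poly_on (int k) S" for q q'
  proof -
    obtain f g where "f \<in> pol k" "\<forall>x\<in>S. q x = f x" "g \<in> pol k" "\<forall>x\<in>S. q' x = g x"
      using q unfolding poly_on_iff by blast
    then show ?thesis using q unfolding poly_on_iff by (auto intro!: bexI[OF _ bp_add[of f _ _ _ g]])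
  qed
  show "c *\<^sub>R q \<in> poly_on (int k) S" if q: "q \<in> poly_on (int k) S" for c q
  proof -
    obtain f where "f \<in> pol k" "\<forall>x\<in>S. q x = f x" using q unfolding poly_on_iff by blast
    then show ?thesis using q unfolding poly_on_iff by (auto intro!: bexI[OF _ bp_scale[of f _ _ _ c]])
  qed
qed

text \<open>The affine function inverting \<open>linepath a b\<close>. As it is defined on the whole
  plane, polynomials in the segment parameter are restrictions of bivariate ones.\<close>

definition seg_coord :: "pt \<Rightarrow> pt \<Rightarrow> pt \<Rightarrow> real"
  where "seg_coord a b x = ((x - a) \<bullet> (b - a)) / ((b - a) \<bullet> (b - a))"

lemma seg_coord_pol: "seg_coord a b \<in> pol 1"
proof -
  have inner2: "x \<bullet> y = x $ 1 * y $ 1 + x $ 2 * y $ 2" for x y :: pt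
    by (simp add: inner_vec_def sum_2)
  have "(\<lambda>x. ((x - a) \<bullet> d) / c) = (\<lambda>x::pt. (d $ 1 / c) * x $ 1 + (d $ 2 / c) * x $ 2 + (- (a \<bullet> d) / c))" for d :: pt and c
    by (rule ext) (simp add: inner2 diff_divide_distrib add_divide_distrib algebra_simps)
  then show ?thesis unfolding seg_coord_def[abs_def] by (simp only: pol_affine)
qed

lemma seg_coord_linepath: "a \<noteq> b \<Longrightarrow> seg_coord a b (linepath a b t) = t"
proof -
  assume "a \<noteq> b"
  then have "(b - a) \<bullet> (b - a) \<noteq> 0" by simp
  moreover have "linepath a b t - a = t *\<^sub>R (b - a)" by (simp add: linepath_def algebra_simps)
  ultimately show ?thesis by (simp add: seg_coord_def)
qed

lemma linepath_line: "linepath a b t = a + t *\<^sub>R (b - a)"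
  by (simp add: linepath_def algebra_simps)

lemma pol_linepath: "f \<in> pol k \<Longrightarrow> \<exists>P. degree P \<le> k \<and> (\<forall>t. f (linepath a b t) = poly P t)"
  using pol_line[of f k a "b - a"] by (simp add: linepath_line)

text \<open>Bivariate polynomials may differ off the line and still have the same restriction; the
  powers of the segment parameter remain as a basis.\<close>

lemma dim_poly_on_segment:
  assumes "a \<noteq> b"
  shows "dim (poly_on (int k) (closed_segment a b)) = Suc k" "dimle (poly_on (int k) (closed_segment a b)) (Suc k)"
proof -
  let ?S = "closed_segment a b" and ?u = "seg_coord a b"
  let ?b = "\<lambda>j x. if x \<in> ?S then ?u x ^ j else 0"
  have fin: "finite {..k}" by simp
  have ap: "(\<Sum>j\<in>{..k}. c j *\<^sub>R ?b j) x = (if x \<in> ?S then \<Sum>j\<le>k. c j * ?u x ^ j else 0)" for c x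
    by (simp add: sum_fun_apply)
  have seg: "linepath a b t \<in> ?S" if "t \<in> {0..1}" for t using that by (rule linepath_in_path)
  have ind: "\<forall>j\<in>{..k}. c j = 0" if z: "(\<Sum>j\<in>{..k}. c j *\<^sub>R ?b j) = 0" for c
  proof -
    let ?P = "\<Sum>j\<le>k. Polynomial.monom (c j) j"
    have "poly ?P t = 0" if "t \<in> {0..1}" for t
      using ap[of c "linepath a b t"] z seg[OF that] by (simp add: poly_sum poly_monom seg_coord_linepath[OF assms])
    then have "?P = 0" by (rule poly_zero_on_unit)
    then have "coeff ?P j = 0" for j by (simp only: coeff_0)
    moreover have "coeff ?P j = (if j \<le> k then c j else 0)" for j by (simp add: coeff_sum)
    ultimately show ?thesis by (metis atMost_iff)
  qed
  have eq: "poly_on (int k) ?S = {\<Sum>j\<in>{..k}. c j *\<^sub>R ?b j | c. True}"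
  proof (intro subset_antisym subsetI)
    fix q assume "q \<in> poly_on (int k) ?S"
    then obtain f where f: "f \<in> pol k" "\<And>x. x \<in> ?S \<Longrightarrow> q x = f x" "\<And>x. x \<notin> ?S \<Longrightarrow> q x = 0"
      unfolding poly_on_iff by blast
    obtain P where P: "degree P \<le> k" "\<And>t. f (linepath a b t) = poly P t" using pol_linepath[OF f(1)] by blast
    have "q = (\<Sum>j\<in>{..k}. coeff P j *\<^sub>R ?b j)"
    proof
      fix x
      show "q x = (\<Sum>j\<in>{..k}. coeff P j *\<^sub>R ?b j) x"
      proof (cases "x \<in> ?S")
        case True
        then obtain t where t: "t \<in> {0..1}" "x = linepath a b t" unfolding linepath_image_01[symmetric] by blast
        have "poly P t = (\<Sum>j\<le>k. coeff P j * t ^ j)"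
          unfolding poly_altdef using P(1) by (intro sum.mono_neutral_left) (auto simp: coeff_eq_0)
        then show ?thesis unfolding ap using True f(2)[OF True] P(2)[of t] unfolding t(2)
          by (simp add: seg_coord_linepath[OF assms])
      next
        case False
        then show ?thesis unfolding ap using f(3) by simp
      qed
    qed
    then show "q \<in> {\<Sum>j\<in>{..k}. c j *\<^sub>R ?b j | c. True}" by blast
  next
    fix q assume "q \<in> {\<Sum>j\<in>{..k}. c j *\<^sub>R ?b j | c. True}"
    then obtain c where c: "q = (\<Sum>j\<in>{..k}. c j *\<^sub>R ?b j)" by blast
    have "(\<lambda>x. \<Sum>j\<le>k. c j * ?u x ^ j) \<in> pol k"
    proof (intro bp_sum bp_scale)
      fix j assume "j \<in> {..k}"
      then show "(\<lambda>x. ?u x ^ j) \<in> pol k" using bp_power[OF seg_coord_pol[of a b], of j] bp_monoD[of _ "j * 1" _ _ k] by auto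
    qed
    then show "q \<in> poly_on (int k) ?S" unfolding poly_on_iff c ap by auto
  qed
  show "dim (poly_on (int k) ?S) = Suc k" "dimle (poly_on (int k) ?S) (Suc k)"
    using dim_family[OF fin ind eq] by simp_all
qed

lemma dim_vpoly_on_segment:
  assumes "a \<noteq> b" "r \<ge> 1"
  shows "dim (vpoly_on (int r - 2) (closed_segment a b)) = 2 * (r - 1)"
proof (cases "r = 1")
  case True
  have "vpoly_on (int r - 2) (closed_segment a b) = {0}"
    using True by (auto simp: vpoly_on_def poly_on_neg fun_eq_iff vec_eq_iff)
  moreover have "dimle {0 :: pt \<Rightarrow> pt} 0" unfolding dimle_def by (intro exI[of _ "{}"]) simp
  ultimately show ?thesis using True dimle_imp by fastforce
next
  case False
  then have r: "int r - 2 = int (r - 2)" using assms(2) by simp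
  show ?thesis
    unfolding vpoly_on_def r
    using dim_componentwise(1)[OF subspace_poly_on dim_poly_on_segment(2)[OF assms(1), of "r - 2"], where 'n = 2]
      dim_poly_on_segment(1)[OF assms(1), of "r - 2"] False assms(2) by simp
qed

text \<open>A polynomial of degree at most \<open>k\<close> has too many zeros. For
  \<open>k = 0\<close> the single node is 0/0 = 0, which suffices for a constant.\<close>

lemma poly_nodes_zero:
  fixes P :: "real poly"
  assumes deg: "degree P \<le> k" and z: "\<And>j. j \<le> k \<Longrightarrow> poly P (real j / real k) = 0"
  shows "P = 0"
proof (rule ccontr)
  assume ne: "P \<noteq> 0"
  show False
  proof (cases "k = 0")
    case True
    then obtain c where "P = [:c:]" using deg degree_0_id by (metis le_zero_eq)
    then show False using z[of 0] ne by simp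
  next
    case False
    have "inj_on (\<lambda>j. real j / real k) {..k}" using False by (auto simp: inj_on_def)
    then have "Suc k = card ((\<lambda>j. real j / real k) ` {..k})" by (simp add: card_image)
    also have "\<dots> \<le> card {x. poly P x = 0}" using z poly_roots_finite[OF ne] by (intro card_mono) auto
    also have "\<dots> \<le> degree P" by (rule card_poly_roots_bound[OF ne])
    finally show False using deg by simp
  qed
qed

lemma poly_eq_half_open:
  fixes P Q :: "real poly"
  assumes "\<And>t. t \<in> {0<..<1} \<Longrightarrow> poly P t = poly Q t"
  shows "P = Q"
proof (rule ccontr)
  assume "P \<noteq> Q"
  then have "finite {t. poly (P - Q) t = 0}" by (intro poly_roots_finite) simp
  moreover have "{0<..<1} \<subseteq> {t. poly (P - Q) t = 0}" using assms by auto
  ultimately have "finite {0<..<1::real}" by (rule rev_finite_subset)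
  then show False using infinite_Ioo[of 0 "1::real"] by simp
qed

section \<open>Dimensions of spaces of piecewise polynomials\<close>

context powell_sabin
begin

abbreviation "CP k \<equiv> cont_pw_poly (int k) z"
abbreviation "PW k \<equiv> pw_poly (int k) z"

lemma m_mod: "m (s mod 6) = m s"
  using p_mod[of s 0] p_mod[of s 1] by simp

lemma pieces_eq: "pieces z q (K s) = (\<lambda>x. if x \<in> K s then q x else 0)" if "s < 6"
  using that unfolding pieces_def ps_split_K by auto

lemma pieces_other: "L \<notin> ps_split z \<Longrightarrow> pieces z q L = 0"
  unfolding pieces_def by auto

lemma PW_iff:
  "q \<in> PW k \<longleftrightarrow> (\<forall>s<6. (\<exists>f\<in>pol k. \<forall>x\<in>K s. q (K s) x = f x) \<and> (\<forall>x. x \<notin> K s \<longrightarrow> q (K s) x = 0)) \<and>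
    (\<forall>L. L \<notin> K ` {..<6} \<longrightarrow> q L = 0)"
  unfolding pw_poly_def ps_split_K by (auto simp: poly_on_iff)

text \<open>Continuity comes for free: \<open>q\<close> is single valued and coincides with a
  polynomial on each of finitely many closed pieces.\<close>

lemma CP_iff: "q \<in> CP k \<longleftrightarrow> (\<forall>s<6. \<exists>f\<in>pol k. \<forall>x\<in>K s. q x = f x) \<and> (\<forall>x. x \<notin> tri z \<longrightarrow> q x = 0)"
proof -
  have 1: "pieces z q \<in> PW k \<longleftrightarrow> (\<forall>s<6. \<exists>f\<in>pol k. \<forall>x\<in>K s. q x = f x)"
  proof -
    have "(\<exists>f\<in>pol k. \<forall>x\<in>K s. pieces z q (K s) x = f x) \<and> (\<forall>x. x \<notin> K s \<longrightarrow> pieces z q (K s) x = 0)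
      \<longleftrightarrow> (\<exists>f\<in>pol k. \<forall>x\<in>K s. q x = f x)" if "s < 6" for s
      unfolding pieces_eq[OF that] by auto
    then show ?thesis unfolding PW_iff using pieces_other ps_split_K by simp
  qed
  have 2: "continuous_on (tri z) q" if h: "\<forall>s<6. \<exists>f\<in>pol k. \<forall>x\<in>K s. q x = f x"
    unfolding tri_Union
  proof (rule continuous_on_closed_Union)
    fix s assume "s \<in> {..<6::nat}"
    then obtain f where f: "f \<in> pol k" "\<forall>x\<in>K s. q x = f x" using h by auto
    show "continuous_on (K s) q"
      using pol_continuous[OF f(1), of "K s"] f(2) by (subst continuous_on_cong[OF refl]) auto
  qed (auto simp: K_closed)
  show ?thesis unfolding cont_pw_poly_def using 1 2 by auto
qed

lemma CP_continuous: "q \<in> CP k \<Longrightarrow> continuous_on (tri z) q"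
  unfolding cont_pw_poly_def by simp

lemma CP_zero: "q \<in> CP k \<Longrightarrow> x \<notin> tri z \<Longrightarrow> q x = 0"
  unfolding cont_pw_poly_def by simp

lemma CP_piece:
  assumes "q \<in> CP k" "s < 6"
  obtains f where "f \<in> pol k" "\<And>x. x \<in> K s \<Longrightarrow> q x = f x"
  using assms unfolding CP_iff by blast

lemma subspace_CP: "subspace (CP k)"
proof (rule subspaceI)
  show "0 \<in> CP k" unfolding CP_iff by (auto intro!: bexI[OF _ bp_const[of 0]])
  show "q + q' \<in> CP k" if q: "q \<in> CP k" "q' \<in> CP k" for q q'
    unfolding CP_iff
  proof (intro conjI allI impI)
    fix s :: nat assume s: "s < 6"
    obtain f where f: "f \<in> pol k" "\<And>x. x \<in> K s \<Longrightarrow> q x = f x" by (rule CP_piece[OF q(1) s]) blast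
    obtain g where g: "g \<in> pol k" "\<And>x. x \<in> K s \<Longrightarrow> q' x = g x" by (rule CP_piece[OF q(2) s]) blast
    show "\<exists>f\<in>pol k. \<forall>x\<in>K s. (q + q') x = f x" using f g by (auto intro!: bexI[OF _ bp_add[of f _ _ _ g]])
  next
    fix x assume "x \<notin> tri z"
    then show "(q + q') x = 0" using CP_zero[OF q(1)] CP_zero[OF q(2)] by simp
  qed
  show "c *\<^sub>R q \<in> CP k" if q: "q \<in> CP k" for c q
    unfolding CP_iff
  proof (intro conjI allI impI)
    fix s :: nat assume s: "s < 6"
    obtain f where f: "f \<in> pol k" "\<And>x. x \<in> K s \<Longrightarrow> q x = f x" by (rule CP_piece[OF q(1) s]) blast
    show "\<exists>f\<in>pol k. \<forall>x\<in>K s. (c *\<^sub>R q) x = f x" using f by (auto intro!: bexI[OF _ bp_scale[of f _ _ _ c]])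
  next
    fix x assume "x \<notin> tri z"
    then show "(c *\<^sub>R q) x = 0" using CP_zero[OF q] by simp
  qed
qed

text \<open>The least index is merely a definite choice of a piece containing \<open>x\<close>;
  \<open>glued_eq\<close> frees the later arguments from it.\<close>

definition glued :: "(nat \<Rightarrow> pt \<Rightarrow> real) \<Rightarrow> pt \<Rightarrow> real"
  where "glued F x = (if x \<in> tri z then F (LEAST s. s < 6 \<and> x \<in> K s) x else 0)"

lemma glued_eq:
  assumes A: "\<And>s t. s < 6 \<Longrightarrow> t \<in> {0..1} \<Longrightarrow>
      F s (spoke (Suc s) t) = F (Suc s mod 6) (spoke (Suc s) t)"
    and s: "s < 6" "x \<in> K s"
  shows "glued F x = F s x"
proof -
  let ?P = "\<lambda>s. s < 6 \<and> x \<in> K s"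
  have "?P (LEAST s. ?P s)" by (rule LeastI[of ?P s]) (use s in simp)
  then have "F (LEAST s. ?P s) x = F s x" using glue[OF A, of "LEAST s. ?P s" s x] s by blast
  moreover have "x \<in> tri z" using s K_subset by blast
  ultimately show ?thesis by (simp add: glued_def)
qed

lemma glued_CP:
  assumes A: "\<And>s t. s < 6 \<Longrightarrow> t \<in> {0..1} \<Longrightarrow>
      F s (spoke (Suc s) t) = F (Suc s mod 6) (spoke (Suc s) t)"
    and F: "\<And>s. s < 6 \<Longrightarrow> F s \<in> pol k"
  shows "glued F \<in> CP k"
  unfolding CP_iff using glued_eq[OF A] F by (auto simp: glued_def)

text \<open>\<open>MU\<close> is the continuous piecewise linear function with value \<open>1\<close> at \<open>z 0\<close> and \<open>0\<close> on the boundary.\<close>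

definition MU :: "pt \<Rightarrow> real"
  where "MU = glued m"

lemma m_spoke: "m s (spoke s t) = 1 - t" "m s (spoke (Suc s) t) = 1 - t"
  using be_linepath(2)[OF K_ccw] al_linepath(2)[OF K_ccw] by auto

lemma m_glue: "m s (spoke (Suc s) t) = m (Suc s mod 6) (spoke (Suc s) t)"
  unfolding m_mod m_spoke by simp

lemma MU_K: "s < 6 \<Longrightarrow> x \<in> K s \<Longrightarrow> MU x = m s x"
  unfolding MU_def by (rule glued_eq) (use m_glue in auto)

definition bdry_zero :: "(pt \<Rightarrow> real) \<Rightarrow> bool"
  where "bdry_zero q \<longleftrightarrow> (\<forall>s<6. \<forall>t\<in>{0..1}. q (rim s t) = 0)"

lemma bdry_zero_iff: "bdry_zero q \<longleftrightarrow> (\<forall>x\<in>frontier (tri z). q x = 0)"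
  unfolding bdry_zero_def frontier_tri linepath_image_01[symmetric] by auto

text \<open>The quotients are formed piece by piece. On a spoke both functions \<open>m\<close>
  equal \<open>1 - t\<close>, so the quotients agree for \<open>t < 1\<close>, and at the outer end
  by equality of polynomials.\<close>

lemma CP_divide:
  assumes q: "q \<in> CP (Suc k)" and z: "bdry_zero q"
  shows "\<exists>g\<in>CP k. q = (\<lambda>x. MU x * g x)"
proof -
  have "\<exists>g\<in>pol k. \<forall>x\<in>K s. q x = m s x * g x" if s: "s < 6" for s
  proof -
    obtain f where f: "f \<in> pol (Suc k)" "\<And>x. x \<in> K s \<Longrightarrow> q x = f x" using CP_piece[OF q s] by blast
    have "f (rim s t) = 0" if "t \<in> {0..1}" for t
      using f(2)[OF seg_K(3)[OF that]] z s that unfolding bdry_zero_def by simp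
    then show ?thesis using pol_divide_mu[OF K_ccw f(1)] f(2) by metis
  qed
  then have "\<forall>s. \<exists>g. s < 6 \<longrightarrow> g \<in> pol k \<and> (\<forall>x\<in>K s. q x = m s x * g x)" by blast
  then obtain G where G: "\<And>s. s < 6 \<Longrightarrow> G s \<in> pol k" "\<And>s x. s < 6 \<Longrightarrow> x \<in> K s \<Longrightarrow> q x = m s x * G s x"
    by metis
  have A: "G s (spoke (Suc s) t) = G (Suc s mod 6) (spoke (Suc s) t)"
    if s: "s < 6" for s t
  proof -
    have s': "Suc s mod 6 < 6" by simp
    obtain P Q where P: "\<And>t. G s (spoke (Suc s) t) = poly P t"
      and Q: "\<And>t. G (Suc s mod 6) (spoke (Suc s) t) = poly Q t"
      using pol_linepath[OF G(1)[OF s]] pol_linepath[OF G(1)[OF s']] by metis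
    have "poly P t = poly Q t" if t: "t \<in> {0<..<1}" for t
    proof -
      let ?x = "spoke (Suc s) t"
      have t': "t \<in> {0..1}" using t by simp
      have "?x \<in> K s" "?x \<in> K (Suc s mod 6)" using seg_K(2)[OF t'] seg_K(1)[OF t', of "Suc s"] K_mod by simp_all
      then have "(1 - t) * poly P t = (1 - t) * poly Q t"
        using G(2)[OF s, of ?x] G(2)[OF s', of ?x] unfolding P Q m_mod m_spoke by auto
      then show ?thesis using t by auto
    qed
    then have "P = Q" by (rule poly_eq_half_open)
    then show ?thesis unfolding P Q by simp
  qed
  have "q x = MU x * glued G x" for x
  proof (cases "x \<in> tri z")
    case True
    then obtain s where "s < 6" "x \<in> K s" unfolding tri_Union by auto
    then show ?thesis using MU_K glued_eq[OF A] G(2) by simp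
  next
    case False
    then show ?thesis using CP_zero[OF q] by (simp add: glued_def)
  qed
  then show ?thesis using glued_CP[OF A G(1)] by (intro bexI[of _ "glued G"]) auto
qed

lemma CP0_const:
  assumes "q \<in> CP 0" "s < 6"
  obtains c where "\<And>x. x \<in> K s \<Longrightarrow> q x = c"
proof -
  obtain f where f: "f \<in> pol 0" "\<And>x. x \<in> K s \<Longrightarrow> q x = f x" using CP_piece[OF assms] by blast
  then obtain c where "f = (\<lambda>x. c)" using bp_0 by blast
  then show thesis using f(2) that by simp
qed

lemma linear_eval: "linear (\<lambda>q. q x :: real)"
  by (rule linearI) simp_all

lemma lin_on_MU: "lin_on S (\<lambda>q x. MU x * q x)"
  by (rule lin_onI) (auto simp: fun_eq_iff distrib_left)

text \<open>Degree \<open>k + 1\<close> calls for \<open>k + 2\<close> nodes on an edge, but the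
  last one is the first node of the next edge; \<open>k + 1\<close> nodes for each edge
  remain.\<close>

lemma bdry_zero_of_nodes:
  assumes q: "q \<in> CP (Suc k)"
    and z: "\<And>s j. s < 6 \<Longrightarrow> j \<le> k \<Longrightarrow> q (rim s (real j / real (Suc k))) = 0"
  shows "bdry_zero q"
  unfolding bdry_zero_def
proof (intro allI impI ballI)
  fix s :: nat and t :: real assume s: "s < 6" and t: "t \<in> {0..1}"
  have zp: "q (p s) = 0" for s
    using z[of "s mod 6" 0] p_mod[of s 0] by (simp add: linepath_0')
  obtain f where f: "f \<in> pol (Suc k)" "\<And>x. x \<in> K s \<Longrightarrow> q x = f x" using CP_piece[OF q s] by blast
  obtain P where P: "degree P \<le> Suc k" "\<And>t. f (rim s t) = poly P t"
    using pol_linepath[OF f(1)] by blast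
  have qP: "q (rim s t) = poly P t" if "t \<in> {0..1}" for t
    using f(2)[OF seg_K(3)[OF that]] P(2) by simp
  have "P = 0"
  proof (rule poly_nodes_zero[OF P(1)])
    fix j assume j: "j \<le> Suc k"
    show "poly P (real j / real (Suc k)) = 0"
    proof (cases "j = Suc k")
      case True
      then show ?thesis using qP[of 1] zp[of "Suc s"] by (simp add: linepath_1')
    next
      case False
      then show ?thesis using qP[of "real j / real (Suc k)"] z[OF s, of j] j by simp
    qed
  qed
  then show "q (rim s t) = 0" using qP[OF t] by simp
qed

lemma dimle_CP_Suc:
  assumes "dimle {q \<in> CP (Suc k). bdry_zero q} n"
  shows "dimle (CP (Suc k)) (6 * Suc k + n)"
proof -
  let ?I = "{..<6::nat} \<times> {..k}"
  let ?x = "\<lambda>(s, j). rim s (real j / real (Suc k))"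
  have "{q \<in> CP (Suc k). \<forall>i\<in>?I. q (?x i) = 0} \<subseteq> {q \<in> CP (Suc k). bdry_zero q}"
    using bdry_zero_of_nodes by auto
  from dimle_mono[OF assms this order_refl]
  have "dimle (CP (Suc k)) (card ?I + n)"
    by (intro dimle_functionals[where l = "\<lambda>i q. q (?x i)"] subspace_CP linear_imp_lin_on linear_eval) auto
  moreover have "card ?I = 6 * Suc k" by (simp add: card_cartesian_product)
  ultimately show ?thesis by simp
qed

text \<open>The bound is 1 plus the sum of 6 j for j = 1, ..., k: in degree j the vanishing at 6 j
  boundary nodes permits a division by \<open>MU\<close>, and in degree 0 the value at
  \<open>z 0\<close> decides.\<close>

lemma CP_dim_upper: "dimle (CP k) (3 * k^2 + 3 * k + 1)"
proof (induction k)
  case 0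
  have "q = 0" if q: "q \<in> CP 0" "q (z 0) = 0" for q
  proof
    fix x
    show "q x = 0 x"
    proof (cases "x \<in> tri z")
      case True
      then obtain s where s: "s < 6" "x \<in> K s" unfolding tri_Union by auto
      obtain c where c: "\<And>x. x \<in> K s \<Longrightarrow> q x = c" by (rule CP0_const[OF q(1) s(1)]) blast
      show ?thesis using c[OF s(2)] c[OF K_p(1)] q(2) by simp
    qed (use CP_zero[OF q(1)] in simp)
  qed
  then have "{q \<in> CP 0. q (z 0) = 0} \<subseteq> {0}" by blast
  then have "dimle {q \<in> CP 0. q (z 0) = 0} 0" unfolding dimle_def by (intro exI[of _ "{}"]) simp
  then have "dimle (CP 0) (Suc 0)"
    by (rule dimle_functional[OF subspace_CP linear_imp_lin_on[OF linear_eval]])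
  moreover have "3 * 0^2 + 3 * 0 + 1 = Suc 0" by simp
  ultimately show ?case by metis
next
  case (Suc k)
  have "{q \<in> CP (Suc k). bdry_zero q} \<subseteq> (\<lambda>q x. MU x * q x) ` CP k" using CP_divide by blast
  from dimle_mono[OF dimle_image[OF subspace_CP lin_on_MU Suc] this order_refl]
  have "dimle (CP (Suc k)) (6 * Suc k + (3 * k^2 + 3 * k + 1))" by (rule dimle_CP_Suc)
  moreover have "6 * Suc k + (3 * k^2 + 3 * k + 1) = 3 * (Suc k)^2 + 3 * Suc k + 1"
    by (simp add: power2_eq_square)
  ultimately show ?case by metis
qed

lemma bdry_zero_CP_dim:
  shows "dim (CP (Suc k)) \<le> 6 * Suc k + dim {q \<in> CP (Suc k). bdry_zero q}"
    "dimle {q \<in> CP (Suc k). bdry_zero q} (3 * (Suc k)^2 + 3 * Suc k + 1)"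
    "subspace {q \<in> CP (Suc k). bdry_zero q}"
proof -
  show d: "dimle {q \<in> CP (Suc k). bdry_zero q} (3 * (Suc k)^2 + 3 * Suc k + 1)"
    by (rule dimle_mono[OF CP_dim_upper _ order_refl]) auto
  show "dim (CP (Suc k)) \<le> 6 * Suc k + dim {q \<in> CP (Suc k). bdry_zero q}"
    by (rule dimle_imp[OF dimle_CP_Suc[OF dimle_dim[OF d]]])
  have "subspace {q \<in> CP (Suc k). \<forall>i\<in>{..<6} \<times> {0..1}. (\<lambda>(s, t) q. q (rim s t)) i q = 0}"
  proof (rule subspace_kernels[OF subspace_CP])
    show "lin_on (CP (Suc k)) ((\<lambda>(s, t) q. q (rim s t)) i)" for i
      by (cases i) (simp add: linear_imp_lin_on linear_eval)
  qed
  moreover have "{q \<in> CP (Suc k). \<forall>i\<in>{..<6} \<times> {0..1}. (\<lambda>(s, t) q. q (rim s t)) i q = 0}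
    = {q \<in> CP (Suc k). bdry_zero q}" unfolding bdry_zero_def by auto
  ultimately show "subspace {q \<in> CP (Suc k). bdry_zero q}" by simp
qed

text \<open>The pieces are pairwise different sets (\<open>K_inj\<close>), so a family indexed by
  sets carries six independent polynomials, each from a space of dimension (k + 1) (k + 2) /
  2.\<close>

lemma PW_dim: "dim (PW k) = 3 * (k + 1) * (k + 2)" "dimle (PW k) (3 * (k + 1) * (k + 2))" "subspace (PW k)"
proof -
  let ?D = "{(i, j). i + j \<le> k}"
  let ?I = "{..<6::nat} \<times> ?D"
  let ?b = "\<lambda>i L x. if L = K (fst i) \<and> x \<in> K (fst i) then (x $ 1) ^ fst (snd i) * (x $ 2) ^ snd (snd i) else 0"
  have fin: "finite ?I" using finite_deg by simp
  have apK: "(\<Sum>i\<in>?I. c i *\<^sub>R ?b i) (K s) x = (if x \<in> K s then \<Sum>ij\<in>?D. c (s, ij) * ((x $ 1) ^ fst ij * (x $ 2) ^ snd ij) else 0)"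
    if s: "s < 6" for c s x
  proof -
    have kk: "K s = K t \<longleftrightarrow> t = s" if "t < 6" for t
      using K_inj s that by (auto simp: inj_on_def)
    have "(\<Sum>i\<in>?I. c i *\<^sub>R ?b i) (K s) x = (\<Sum>i\<in>?I. c i * ?b i (K s) x)"
      by (simp only: sum_fun_apply scaleR_fun_apply real_scaleR_def)
    also have "\<dots> = (\<Sum>t\<in>{..<6}. \<Sum>ij\<in>?D. c (t, ij) * ?b (t, ij) (K s) x)"
      unfolding sum.cartesian_product by (intro sum.cong refl) (simp only: case_prod_unfold prod.collapse)
    also have "\<dots> = (\<Sum>t\<in>{..<6}. if t = s then (if x \<in> K s then \<Sum>ij\<in>?D. c (s, ij) * ((x $ 1) ^ fst ij * (x $ 2) ^ snd ij) else 0) else 0)"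
      by (intro sum.cong refl) (simp add: kk)
    also have "\<dots> = (if x \<in> K s then \<Sum>ij\<in>?D. c (s, ij) * ((x $ 1) ^ fst ij * (x $ 2) ^ snd ij) else 0)"
      using s by simp
    finally show ?thesis .
  qed
  have pl: "(\<lambda>x. \<Sum>ij\<in>?D. d ij * ((x $ 1) ^ fst ij * (x $ 2) ^ snd ij)) \<in> pol k" for d
    by (intro bp_sum bp_scale bp_monom) auto
  have ind: "\<forall>i\<in>?I. c i = 0" if zz: "(\<Sum>i\<in>?I. c i *\<^sub>R ?b i) = 0" for c
  proof -
    have "c (s, (i, j)) = 0" if s: "s < 6" and ij: "i + j \<le> k" for s i j
    proof (rule monom_indep[OF _ ij, where c = "\<lambda>ij. c (s, ij)"])
      fix x :: pt
      have "(\<Sum>ij\<in>?D. c (s, ij) * ((x $ 1) ^ fst ij * (x $ 2) ^ snd ij)) = 0"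
      proof (rule pol_identity[OF pl K_int[of s]])
        fix y assume y: "y \<in> K s"
        show "(\<Sum>ij\<in>?D. c (s, ij) * ((y $ 1) ^ fst ij * (y $ 2) ^ snd ij)) = 0"
          using apK[OF s, of c y] y unfolding zz by simp
      qed
      then show "(\<Sum>(i, j)\<in>?D. c (s, i, j) * (x $ 1) ^ i * (x $ 2) ^ j) = 0"
        by (simp add: case_prod_unfold mult.assoc)
    qed
    then show ?thesis by auto
  qed
  have eq: "PW k = {\<Sum>i\<in>?I. c i *\<^sub>R ?b i | c. True}"
  proof (intro subset_antisym subsetI)
    fix q assume q: "q \<in> PW k"
    have "\<exists>d. \<forall>x\<in>K s. q (K s) x = (\<Sum>ij\<in>?D. d ij * ((x $ 1) ^ fst ij * (x $ 2) ^ snd ij))" if s: "s < 6" for s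
    proof -
      obtain f where f: "f \<in> pol k" "\<forall>x\<in>K s. q (K s) x = f x" using q s unfolding PW_iff by blast
      obtain d where "\<forall>x. f x = (\<Sum>(i, j) | i + j \<le> k. d i j * (x $ 1) ^ i * (x $ 2) ^ j)" using f(1) unfolding pol_iff by blast
      then show ?thesis using f(2)
        by (intro exI[of _ "\<lambda>ij. d (fst ij) (snd ij)"]) (simp add: case_prod_unfold mult.assoc)
    qed
    then have "\<forall>s. \<exists>d. s < 6 \<longrightarrow> (\<forall>x\<in>K s. q (K s) x = (\<Sum>ij\<in>?D. d ij * ((x $ 1) ^ fst ij * (x $ 2) ^ snd ij)))" by blast
    from choice[OF this] obtain d where
      d: "\<And>s x. s < 6 \<Longrightarrow> x \<in> K s \<Longrightarrow> q (K s) x = (\<Sum>ij\<in>?D. d s ij * ((x $ 1) ^ fst ij * (x $ 2) ^ snd ij))"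
      by blast
    have "q = (\<Sum>i\<in>?I. (\<lambda>(s, ij). d s ij) i *\<^sub>R ?b i)"
    proof (intro ext)
      fix L x
      show "q L x = (\<Sum>i\<in>?I. (\<lambda>(s, ij). d s ij) i *\<^sub>R ?b i) L x"
      proof (cases "L \<in> K ` {..<6}")
        case True
        then obtain s where s: "s < 6" "L = K s" by auto
        show ?thesis unfolding s(2) apK[OF s(1)] using d[OF s(1), of x] q s(1) unfolding PW_iff by auto
      next
        case False
        then have "(\<Sum>i\<in>?I. (\<lambda>(s, ij). d s ij) i *\<^sub>R ?b i) L x = 0"
          unfolding sum_fun_apply by (intro sum.neutral) auto
        moreover have "q L = 0" using q False unfolding PW_iff by blast
        ultimately show ?thesis by simp
      qed
    qed
    then show "q \<in> {\<Sum>i\<in>?I. c i *\<^sub>R ?b i | c. True}" by blast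
  next
    fix q assume "q \<in> {\<Sum>i\<in>?I. c i *\<^sub>R ?b i | c. True}"
    then obtain c where c: "q = (\<Sum>i\<in>?I. c i *\<^sub>R ?b i)" by blast
    show "q \<in> PW k" unfolding PW_iff
    proof (intro conjI allI impI)
      fix s :: nat assume s: "s < 6"
      show "\<exists>f\<in>pol k. \<forall>x\<in>K s. q (K s) x = f x"
        by (rule bexI[OF _ pl[of "\<lambda>ij. c (s, ij)"]]) (simp add: c apK[OF s])
      show "q (K s) x = 0" if "x \<notin> K s" for x unfolding c apK[OF s] using that by simp
    next
      fix L assume "L \<notin> K ` {..<6}"
      then have "q L x = 0" for x unfolding c sum_fun_apply by (intro sum.neutral) auto
      then show "q L = 0" by auto
    qed
  qed
  have "card ?I = 3 * (2 * card ?D)" by (simp add: card_cartesian_product)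
  also have "\<dots> = 3 * (k + 1) * (k + 2)" unfolding card_deg by (simp only: mult.assoc)
  finally have "card ?I = 3 * (k + 1) * (k + 2)" .
  then show "dim (PW k) = 3 * (k + 1) * (k + 2)" "dimle (PW k) (3 * (k + 1) * (k + 2))" "subspace (PW k)"
    using dim_family[OF fin ind eq] by simp_all
qed

text \<open>Lower bound: continuity imposes \<open>k\<close> conditions on each of the six spokes and five at \<open>z 0\<close>.\<close>

lemma CP_dim: "dim (CP k) = 3 * k^2 + 3 * k + 1"
proof (rule antisym)
  show "dim (CP k) \<le> 3 * k^2 + 3 * k + 1" by (rule dimle_imp[OF CP_dim_upper])
  let ?J = "{..<6::nat} \<times> {1..k} \<union> {..<5} \<times> {0}"
  \<comment> \<open>For \<open>k = 0\<close> only \<open>j = 0\<close> occurs in \<open>?J\<close>,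
    and the node 0/0 = 0 is again \<open>z 0\<close>.\<close>
  let ?x = "\<lambda>(s, j). spoke (Suc s) (real j / real k)"
  let ?l = "\<lambda>i q. q (K (fst i)) (?x i) - q (K (Suc (fst i) mod 6)) (?x i) :: real"
  have sub: "{q \<in> PW k. \<forall>i\<in>?J. ?l i q = 0} \<subseteq> pieces z ` CP k"
  proof clarify
    fix q assume q: "q \<in> PW k" and l: "\<forall>i\<in>?J. ?l i q = 0"
    have "\<forall>s. \<exists>f. s < 6 \<longrightarrow> f \<in> pol k \<and> (\<forall>x\<in>K s. q (K s) x = f x)" using q unfolding PW_iff by blast
    then obtain F where F: "\<And>s. s < 6 \<Longrightarrow> F s \<in> pol k" "\<And>s x. s < 6 \<Longrightarrow> x \<in> K s \<Longrightarrow> q (K s) x = F s x"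
      by metis
    have node: "F s (spoke (Suc s) (real j / real k)) = F (Suc s mod 6) (spoke (Suc s) (real j / real k))"
      if "(s, j) \<in> ?J" for s j
    proof -
      have s: "s < 6" "Suc s mod 6 < 6" "real j / real k \<in> {0..1}" using that by (auto simp: divide_le_eq_1)
      have "q (K s) (?x (s, j)) = q (K (Suc s mod 6)) (?x (s, j))" using bspec[OF l that] by simp
      then show ?thesis using F(2)[OF s(1) seg_K(2)[OF s(3)]] F(2)[OF s(2), of "?x (s, j)"]
          seg_K(1)[OF s(3), of "Suc s"] K_mod[of "Suc s"] by simp
    qed
    have z0: "F s (z 0) = F 0 (z 0)" if "s < 6" for s
      using that
    proof (induction s)
      case (Suc s)
      then show ?case using node[of s 0] by (simp add: linepath_0')
    qed simp
    have A: "F s (spoke (Suc s) t) = F (Suc s mod 6) (spoke (Suc s) t)" if s: "s < 6" for s t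
    proof -
      have s': "Suc s mod 6 < 6" by simp
      obtain P Q where P: "degree P \<le> k" "\<And>t. F s (spoke (Suc s) t) = poly P t"
        and Q: "degree Q \<le> k" "\<And>t. F (Suc s mod 6) (spoke (Suc s) t) = poly Q t"
        using pol_linepath[OF F(1)[OF s]] pol_linepath[OF F(1)[OF s']] by metis
      have "P - Q = 0"
      proof (rule poly_nodes_zero)
        show "degree (P - Q) \<le> k" using P Q by (intro degree_diff_le)
        fix j assume j: "j \<le> k"
        show "poly (P - Q) (real j / real k) = 0"
        proof (cases "j = 0")
          case True
          then show ?thesis using P(2)[of 0] Q(2)[of 0] z0[OF s] z0[OF s'] by (simp add: linepath_0')
        next
          case False
          then show ?thesis using node[of s j] s j P(2) Q(2) by simp
        qed
      qed
      then show ?thesis using P Q by simp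
    qed
    have "q = pieces z (glued F)"
    proof (intro ext)
      fix L x
      show "q L x = pieces z (glued F) L x"
      proof (cases "L \<in> K ` {..<6}")
        case True
        then obtain s where s: "s < 6" "L = K s" by auto
        show ?thesis unfolding s(2) pieces_eq[OF s(1)]
          using glued_eq[OF A s(1)] F(2)[OF s(1)] q s(1) unfolding PW_iff by auto
      next
        case False
        then show ?thesis using q pieces_other[of L] unfolding PW_iff ps_split_K by simp
      qed
    qed
    then show "q \<in> pieces z ` CP k" using glued_CP[OF A F(1)] by blast
  qed
  have lp: "lin_on (CP k) (pieces z)" by (rule lin_onI) (auto simp: pieces_def fun_eq_iff)
  have fd: "dimle {q \<in> PW k. \<forall>i\<in>?J. ?l i q = 0} (3 * (k + 1) * (k + 2))"
    by (rule dimle_mono[OF PW_dim(2) _ order_refl]) auto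
  have "dim {q \<in> PW k. \<forall>i\<in>?J. ?l i q = 0} \<le> dim (CP k)"
    by (rule dim_image_le[OF subspace_CP lp CP_dim_upper sub])
  moreover have "dimle (PW k) (card ?J + dim {q \<in> PW k. \<forall>i\<in>?J. ?l i q = 0})"
  proof (rule dimle_functionals[where l = ?l])
    show "lin_on (PW k) (?l i)" for i by (rule lin_onI) (auto simp: algebra_simps)
    show "dimle {q \<in> PW k. \<forall>i\<in>?J. ?l i q = 0} (dim {q \<in> PW k. \<forall>i\<in>?J. ?l i q = 0})"
      by (rule dimle_dim[OF fd])
  qed (auto simp: PW_dim)
  from dimle_imp[OF this] have "3 * (k + 1) * (k + 2) \<le> card ?J + dim {q \<in> PW k. \<forall>i\<in>?J. ?l i q = 0}"
    unfolding PW_dim(1) .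
  ultimately have "3 * (k + 1) * (k + 2) \<le> card ?J + dim (CP k)" by linarith
  moreover have "card ?J = 6 * k + 5"
    by (subst card_Un_disjoint) (auto simp: card_cartesian_product)
  ultimately show "3 * k^2 + 3 * k + 1 \<le> dim (CP k)" by (simp add: power2_eq_square algebra_simps)
qed

lemma L1_dim: "dim (L1_space (int k) z) = 6 * k^2 + 6 * k + 2"
  unfolding L1_space_def dim_componentwise(1)[OF subspace_CP CP_dim_upper, where 'n = 2] CP_dim by simp

end

section \<open>Lebesgue integrals and Lipschitz bounds\<close>

lemma set_integrable_compact:
  fixes f :: "pt \<Rightarrow> real"
  assumes "compact S" "continuous_on S f"
  shows "set_integrable lborel S f"
  unfolding set_integrable_def by (rule borel_integrable_compact[OF assms])

lemma integral_translate:
  fixes f :: "pt \<Rightarrow> real"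
  assumes "f \<in> borel_measurable borel"
  shows "integral\<^sup>L lborel (\<lambda>x. f (x + h)) = integral\<^sup>L lborel f"
proof -
  have "integral\<^sup>L lborel f = integral\<^sup>L (distr lborel borel ((+) h)) f" by (simp add: lborel_distr_plus)
  also have "\<dots> = integral\<^sup>L lborel (\<lambda>x. f (h + x))"
    using assms by (intro integral_distr) auto
  finally show ?thesis by (simp add: add.commute)
qed

lemma negligible_AE_lborel:
  fixes N :: "'a::euclidean_space set"
  assumes "negligible N" "closed N"
  shows "AE x in lborel. x \<notin> N"
proof -
  have N: "N \<in> sets lborel" using assms(2) by simp
  then have "emeasure lebesgue N = 0"
    using assms(1) negligible_iff_emeasure0 sets_completionI_sets by blast
  then have "emeasure lborel N = 0" using emeasure_completion[of N lborel] N by simp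
  then show ?thesis using N by (intro AE_I'[of N]) (auto simp: null_sets_def)
qed

lemma linear_form_onorm:
  fixes a b :: real
  shows "onorm (\<lambda>h::pt. a * h $ 1 + b * h $ 2) \<le> \<bar>a\<bar> + \<bar>b\<bar>"
proof (rule onorm_bound)
  fix h :: pt
  have "norm (a * h $ 1 + b * h $ 2) \<le> \<bar>a\<bar> * \<bar>h $ 1\<bar> + \<bar>b\<bar> * \<bar>h $ 2\<bar>"
    by (metis abs_mult abs_triangle_ineq real_norm_def)
  also have "\<dots> \<le> \<bar>a\<bar> * norm h + \<bar>b\<bar> * norm h"
    by (intro add_mono mult_left_mono component_le_norm_cart) auto
  finally show "norm (a * h $ 1 + b * h $ 2) \<le> (\<bar>a\<bar> + \<bar>b\<bar>) * norm h" by (simp add: distrib_right)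
qed simp

lemma pol_lipschitz:
  assumes f: "f \<in> pol k" and S: "compact S" "convex S"
  shows "\<exists>C\<ge>0. C-lipschitz_on S f"
proof -
  have "continuous_on S (\<lambda>x. \<bar>pd 1 f x\<bar> + \<bar>pd 2 f x\<bar>)"
    by (intro continuous_intros pol_continuous[OF pd_pol[OF f]])
  then have "bounded ((\<lambda>x. \<bar>pd 1 f x\<bar> + \<bar>pd 2 f x\<bar>) ` S)"
    using S compact_continuous_image compact_imp_bounded by blast
  then obtain C where C: "C > 0" "\<And>x. x \<in> S \<Longrightarrow> norm (\<bar>pd 1 f x\<bar> + \<bar>pd 2 f x\<bar>) \<le> C"
    unfolding bounded_pos by auto
  have "C-lipschitz_on S f"
  proof (rule bounded_derivative_imp_lipschitz[OF _ S(2)])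
    fix x assume x: "x \<in> S"
    show "(f has_derivative (\<lambda>h. pd 1 f x * h $ 1 + pd 2 f x * h $ 2)) (at x within S)"
      by (rule has_derivative_at_withinI[OF pol_deriv[OF f]])
    show "onorm (\<lambda>h::pt. pd 1 f x * h $ 1 + pd 2 f x * h $ 2) \<le> C"
      using linear_form_onorm[of "pd 1 f x" "pd 2 f x"] C(2)[OF x] by simp
  qed (use C in simp)
  then show ?thesis using C(1) by (intro exI[of _ C]) simp
qed

section \<open>Counting edge moments and test functions; integrals of derivatives\<close>

context powell_sabin
begin

lemma bdry_edges_p: "bdry_edges z = (\<lambda>s. (p s, p (Suc s))) ` {..<6}"
proof -
  have e: "{1..3} = {1, 2, 3::nat}" "{..<6} = {0, 1, 2, 3, 4, 5::nat}" by auto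
  have n: "nx 1 = 2" "nx 2 = 3" "nx 3 = 1" by (simp_all add: nx_def)
  have v: "p 0 = z 2" "p 1 = z 4" "p 2 = z 3" "p 3 = z 5" "p 4 = z 1" "p 5 = z 6"
    "p (Suc 0) = z 4" "p (Suc 1) = z 3" "p (Suc 2) = z 5" "p (Suc 3) = z 1" "p (Suc 4) = z 6" "p (Suc 5) = z 2"
    by (simp_all add: p_def)
  show ?thesis unfolding bdry_edges_def e image_insert image_empty n v by auto
qed

lemma p_ne: "p s \<noteq> p (Suc s)" "p s \<noteq> z 0" "p (Suc s) \<noteq> z 0"
  using K_ccw[of s] by (auto simp: ccw_cross cross_def)

lemma p_inj: "inj_on p {..<6}"
proof -
  have "p s \<noteq> p t" if st: "s < t" "t < 6" for s t
  proof
    assume eq: "p s = p t"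
    have "p s \<in> K s" "p s \<in> K t" using K_p(2)[of s] K_p(2)[of t] eq by simp_all
    from K_inter[OF st this] show False
    proof (elim disjE conjE)
      assume "p s = z 0" then show False using p_ne by simp
    next
      assume "t = Suc s" then show False using eq p_ne by simp
    next
      assume "s = 0" "t = 5"
      then show False using eq p_ne(1)[of 5] p_period[of 0] by simp
    qed
  qed
  then show ?thesis by (metis (no_types, lifting) inj_onI lessThan_iff linorder_neqE_nat)
qed

lemma num_edge_dofs_eq: "r \<ge> 1 \<Longrightarrow> num_edge_dofs r z = 12 * (r - 1)"
proof -
  assume r: "r \<ge> 1"
  have "inj_on (\<lambda>s. (p s, p (Suc s))) {..<6}" using p_inj by (auto simp: inj_on_def)
  then have "num_edge_dofs r z = (\<Sum>s<6. dim (vpoly_on (int r - 2) (closed_segment (p s) (p (Suc s)))))"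
    unfolding num_edge_dofs_def bdry_edges_p by (simp add: sum.reindex)
  also have "\<dots> = (\<Sum>s<6::nat. 2 * (r - 1))" using dim_vpoly_on_segment[OF p_ne(1) r] by simp
  finally show ?thesis by simp
qed

lemma jumps_K:
  "(\<forall>i\<in>{1..3}. P (K1 z i) (K2 z i) (z (3 + i))) \<longleftrightarrow> P (K 0) (K 1) (p 1) \<and> P (K 2) (K 3) (p 3) \<and> P (K 4) (K 5) (p 5)"
proof -
  have e: "{1..3} = {1, 2, 3::nat}" by auto
  have "K1 z 1 = K 0" "K1 z 2 = K 2" "K1 z 3 = K 4" "K2 z 1 = K 1" "K2 z 2 = K 3" "K2 z 3 = K 5"
    using K1_K[of 1] K1_K[of 2] K1_K[of 3] K2_K[of 1] K2_K[of 2] K2_K[of 3] by auto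
  moreover have "z (3 + 1) = p 1" "z (3 + 2) = p 3" "z (3 + 3) = p 5" by (simp_all add: p_def)
  ultimately show ?thesis unfolding e by simp
qed

lemma PW_integrable: "q \<in> PW k \<Longrightarrow> s < 6 \<Longrightarrow> q (K s) integrable_on K s"
proof -
  assume q: "q \<in> PW k" and s: "s < 6"
  obtain f where f: "f \<in> pol k" "\<forall>x\<in>K s. q (K s) x = f x" using q s unfolding PW_iff by blast
  have "continuous_on (K s) (q (K s))"
    using pol_continuous[OF f(1), of "K s"] f(2) by (subst continuous_on_cong[OF refl]) auto
  then show ?thesis by (rule integrable_on_compact[OF K_compact])
qed

lemma sum_split: "(\<Sum>L\<in>ps_split z. h L) = (\<Sum>s<6. h (K s))"
  unfolding ps_split_K using K_inj by (simp add: sum.reindex)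

text \<open>An exact count needs the four conditions to be independent. The indicators of the pieces
  0, 2 and 4 violate one point condition each, and the constant 1 satisfies all three but has
  nonzero mean. The first claim is written with \<open>+ 4\<close> to avoid truncated
  subtraction.\<close>

lemma V2_dim: "dim (V2_space (int k) z) + 4 = 3 * (k + 1) * (k + 2)"
  "dimle (V2_space (int k) z) (3 * (k + 1) * (k + 2))" "subspace (V2_space (int k) z)"
proof -
  let ?l = "\<lambda>s q. q (K s) (p (Suc s)) - q (K (Suc s)) (p (Suc s)) :: real"
  let ?I = "\<lambda>q. \<Sum>s<6. integral (K s) (q (K s)) :: real"
  have lin: "lin_on S (?l s)" for s S by (rule lin_onI) (auto simp: algebra_simps)
  \<comment> \<open>Additivity of the integral depends on integrability, so the functional is linear
    only relative to \<open>PW k\<close>.\<close>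
  have linI: "lin_on (PW k) ?I"
  proof (rule lin_onI)
    fix q q' assume q: "q \<in> PW k" "q' \<in> PW k"
    have "integral (K s) ((q + q') (K s)) = integral (K s) (q (K s)) + integral (K s) (q' (K s))" if "s < 6" for s
      using Henstock_Kurzweil_Integration.integral_add[OF PW_integrable[OF q(1) that] PW_integrable[OF q(2) that]]
      by (simp add: plus_fun_def)
    then show "?I (q + q') = ?I q + ?I q'" by (simp add: sum.distrib)
  next
    fix c q assume q: "q \<in> PW k"
    have "integral (K s) ((c *\<^sub>R q) (K s)) = c * integral (K s) (q (K s))" for s
      by (simp add: scaleR_fun_def)
    then show "?I (c *\<^sub>R q) = c *\<^sub>R ?I q" by (simp add: sum_distrib_left)
  qed
  define S1 where "S1 = {q \<in> PW k. ?l 0 q = 0}"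
  define S2 where "S2 = {q \<in> S1. ?l 2 q = 0}"
  define S3 where "S3 = {q \<in> S2. ?l 4 q = 0}"
  define S4 where "S4 = {q \<in> S3. ?I q = 0}"
  have V: "V2_space (int k) z = S4"
    unfolding V2_space_def S4_def S3_def S2_def S1_def sum_split
    by (subst jumps_K) (auto simp: eval_nat_numeral)
  have sub: "S1 \<subseteq> PW k" "S2 \<subseteq> S1" "S3 \<subseteq> S2" "S4 \<subseteq> S3" unfolding S1_def S2_def S3_def S4_def by auto
  have ss: "subspace S1" "subspace S2" "subspace S3" "subspace S4"
  proof -
    show 1: "subspace S1" unfolding S1_def by (rule subspace_kernel[OF PW_dim(3) lin])
    show 2: "subspace S2" unfolding S2_def by (rule subspace_kernel[OF 1 lin])
    show 3: "subspace S3" unfolding S3_def by (rule subspace_kernel[OF 2 lin])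
    show "subspace S4" unfolding S4_def
      by (rule subspace_kernel[OF 3 lin_on_subset[OF linI]]) (use sub in blast)
  qed
  have fd: "dimle S1 (3 * (k + 1) * (k + 2))" "dimle S2 (3 * (k + 1) * (k + 2))" "dimle S3 (3 * (k + 1) * (k + 2))"
    "dimle S4 (3 * (k + 1) * (k + 2))"
    using sub by (auto intro!: dimle_mono[OF PW_dim(2)])
  define e where "e J L x = (if L \<in> K ` J \<and> x \<in> L then 1 else (0::real))" for J and L :: "pt set" and x :: pt
  have ePW: "e J \<in> PW k" if "J \<subseteq> {..<6}" for J
    unfolding PW_iff
  proof (intro conjI allI impI)
    fix s :: nat
    show "\<exists>f\<in>pol k. \<forall>x\<in>K s. e J (K s) x = f x"
      by (intro bexI[of _ "\<lambda>x. if K s \<in> K ` J then 1 else 0"]) (auto simp: e_def bp_const)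
  qed (use that in \<open>auto simp: e_def fun_eq_iff\<close>)
  have eK: "e J (K s) x = (if s \<in> J \<and> x \<in> K s then 1 else 0)" if "s < 6" "J \<subseteq> {..<6}" for J s x
  proof -
    have "K s \<in> K ` J \<longleftrightarrow> s \<in> J" using K_inj that unfolding inj_on_def by blast
    then show ?thesis by (simp add: e_def)
  qed
  have KP: "p (Suc 0) \<in> K 0" "p (Suc 0) \<in> K (Suc 0)" "p 3 \<in> K 2" "p 3 \<in> K 3" "p 5 \<in> K 4" "p 5 \<in> K 5"
    using K_p(3)[of 0] K_p(2)[of "Suc 0"] K_p(3)[of 2] K_p(2)[of 3] K_p(3)[of 4] K_p(2)[of 5] by simp_all
  have "dim (PW k) = Suc (dim S1)" unfolding S1_def
    by (rule dim_hyperplane[OF PW_dim(3) lin PW_dim(2), of "e {0}"]) (simp_all add: ePW eK KP)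
  moreover have "dim S1 = Suc (dim S2)" unfolding S2_def
    by (rule dim_hyperplane[OF ss(1) lin fd(1), of "e {2}"]) (simp_all add: ePW eK KP S1_def)
  moreover have "dim S2 = Suc (dim S3)" unfolding S3_def
    by (rule dim_hyperplane[OF ss(2) lin fd(2), of "e {4}"]) (simp_all add: ePW eK KP S1_def S2_def)
  moreover have "dim S3 = Suc (dim S4)" unfolding S4_def
  proof (rule dim_hyperplane[OF ss(3) lin_on_subset[OF linI] fd(3), of "e {..<6}"])
    show "S3 \<subseteq> PW k" using sub by blast
    show "e {..<6} \<in> S3" unfolding S3_def S2_def S1_def by (simp add: ePW eK KP)
    show "?I (e {..<6}) \<noteq> 0"
    proof
      assume z: "?I (e {..<6}) = 0"
      have nn: "integral (K s) (e {..<6} (K s)) \<ge> 0" if "s < 6" for s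
        using PW_integrable[OF ePW that] by (intro integral_nonneg) (auto simp: e_def)
      have "integral (K 0) (e {..<6} (K 0)) = 0"
        using z nn sum_nonneg_eq_0_iff[of "{..<6}" "\<lambda>s. integral (K s) (e {..<6} (K s))"] by auto
      then have i: "(e {..<6} (K 0) has_integral 0) (K 0)"
        using PW_integrable[OF ePW, of "{..<6}" 0] by (simp add: has_integral_iff)
      have "continuous_on (K 0) (e {..<6} (K 0)) \<longleftrightarrow> continuous_on (K 0) (\<lambda>x. 1 :: real)"
        by (rule continuous_on_cong) (auto simp: eK)
      then have "e {..<6} (K 0) (z 0) = 0"
        by (intro integral_zero_imp_zero[OF K_convex K_compact K_int _ _ i]) (auto simp: K_p e_def)
      then show False by (simp add: eK K_p)
    qed
  qed
  ultimately show "dim (V2_space (int k) z) + 4 = 3 * (k + 1) * (k + 2)" unfolding V PW_dim(1) by simp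
  show "dimle (V2_space (int k) z) (3 * (k + 1) * (k + 2))" "subspace (V2_space (int k) z)"
    unfolding V using fd ss by simp_all
qed

text \<open>The points \<open>x\<close> and \<open>y\<close> may lie in different pieces or outside
  the triangle. Along the segment between them the zero extension is Lipschitz on finitely many
  closed sets of parameters covering the interval, hence on the whole interval.\<close>

lemma CP_lipschitz:
  assumes f: "f \<in> CP k" and b: "bdry_zero f"
  shows "\<exists>L\<ge>0. \<forall>x y. \<bar>f x - f y\<bar> \<le> L * norm (x - y)"
proof -
  have "\<exists>C\<ge>0. C-lipschitz_on (K s) f" if s: "s < 6" for s
  proof -
    obtain g where g: "g \<in> pol k" "\<And>x. x \<in> K s \<Longrightarrow> f x = g x" by (rule CP_piece[OF f s]) blast
    obtain C where "C \<ge> 0" "C-lipschitz_on (K s) g" using pol_lipschitz[OF g(1) K_compact K_convex] by blast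
    then show ?thesis using g(2) by (metis lipschitz_on_transform)
  qed
  then have "\<forall>s. \<exists>C. s < 6 \<longrightarrow> C \<ge> 0 \<and> C-lipschitz_on (K s) f" by blast
  from choice[OF this] obtain C where C: "\<And>s. s < 6 \<Longrightarrow> C s \<ge> 0 \<and> (C s)-lipschitz_on (K s) f" by blast
  define L where "L = (\<Sum>s<6. C s)"
  have L: "L \<ge> 0" unfolding L_def using C by (intro sum_nonneg) auto
  have LK: "L-lipschitz_on (K s) f" if "s < 6" for s
  proof (rule lipschitz_on_mono[OF _ order_refl])
    show "(C s)-lipschitz_on (K s) f" using C that by blast
    show "C s \<le> L" unfolding L_def using C that by (intro member_le_sum) auto
  qed
  have "\<bar>f x - f y\<bar> \<le> L * norm (x - y)" for x y
  proof -
    let ?g = "\<lambda>t. x + t *\<^sub>R (y - x)"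
    let ?M = "L * norm (y - x)"
    \<comment> \<open>Index 6 stands for the outside. Taking the complement of the interior makes
      the set closed, and \<open>f\<close> vanishes on it because of its boundary values.\<close>
    let ?U = "\<lambda>s::nat. if s < 6 then ?g -` K s else ?g -` (- interior (tri z))"
    have gd: "dist (?g t) (?g u) = \<bar>t - u\<bar> * norm (y - x)" for t u
      by (metis (no_types, lifting) add_diff_cancel_left dist_norm norm_scaleR scaleR_left_diff_distrib)
    have gc: "continuous_on UNIV ?g" by (intro continuous_intros)
    have M: "?M \<ge> 0" using L by simp
    have "?M-lipschitz_on {0..1} (\<lambda>t. f (?g t))"
    proof (rule lipschitz_on_closed_Union[where I = "{..6}" and U = ?U])
      fix s :: nat assume "s \<in> {..6}"
      show "?M-lipschitz_on (?U s) (\<lambda>t. f (?g t))"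
      proof (cases "s < 6")
        case True
        show ?thesis
        proof (rule lipschitz_onI)
          fix t u assume "t \<in> ?U s" "u \<in> ?U s"
          then have "?g t \<in> K s" "?g u \<in> K s" using True by auto
          then have "dist (f (?g t)) (f (?g u)) \<le> L * dist (?g t) (?g u)"
            using LK[OF True] lipschitz_onD by blast
          then show "dist (f (?g t)) (f (?g u)) \<le> ?M * dist t u"
            unfolding gd by (simp add: dist_real_def mult_ac)
        qed (rule M)
      next
        case False
        have z: "f w = 0" if "w \<notin> interior (tri z)" for w
        proof (cases "w \<in> tri z")
          case True
          then have "w \<in> frontier (tri z)" using that tri_closed by (simp add: frontier_def)
          then show ?thesis using b unfolding bdry_zero_iff by blast
        qed (use CP_zero[OF f] in blast)
        show ?thesis
        proof (rule lipschitz_onI)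
          fix t u assume "t \<in> ?U s" "u \<in> ?U s"
          then have "f (?g t) = 0" "f (?g u) = 0" using z False by auto
          then show "dist (f (?g t)) (f (?g u)) \<le> ?M * dist t u" using M by simp
        qed (rule M)
      qed
      show "closed (?U s)"
        using gc by (cases "s < 6") (auto intro!: closed_vimage K_closed)
    next
      show "{0..1} \<subseteq> (\<Union>s\<in>{..6}. ?U s)"
      proof
        fix t :: real
        show "t \<in> (\<Union>s\<in>{..6}. ?U s)"
        proof (cases "?g t \<in> tri z")
          case True
          then obtain s where "s < 6" "?g t \<in> K s" unfolding tri_Union by auto
          then show ?thesis by (intro UN_I[of s]) auto
        next
          case False
          then have "?g t \<notin> interior (tri z)" using interior_subset by blast
          then show ?thesis by (intro UN_I[of 6]) auto
        qed
      qed
    qed (use M in auto)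
    then have "dist (f (?g 0)) (f (?g 1)) \<le> ?M * dist 0 (1::real)" by (rule lipschitz_onD) auto
    then show ?thesis by (simp add: dist_real_def norm_minus_commute)
  qed
  then show ?thesis using L by blast
qed

lemma continuous_of_lipschitz:
  assumes L: "\<forall>x y. \<bar>f x - f y\<bar> \<le> L * norm (x - y)" "L \<ge> 0"
  shows "continuous_on UNIV (f :: pt \<Rightarrow> real)"
proof -
  have "L-lipschitz_on UNIV f" using L by (intro lipschitz_onI) (auto simp: dist_real_def dist_norm)
  then show ?thesis by (rule lipschitz_on_continuous_on)
qed

lemma pol_difference_quotient:
  assumes f: "f \<in> pol k"
  shows "(\<lambda>n. real (Suc n) * (f (x + (1 / real (Suc n)) *\<^sub>R axis i 1) - f x)) \<longlonglongrightarrow> pd i f x"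
proof -
  obtain P where P: "\<And>t. f (x + t *\<^sub>R axis i 1) = poly P t" using pol_line[OF f] by blast
  have d: "poly (pderiv P) 0 = pd i f x"
    using pol_line_deriv[OF f P, of 0] exhaust_2[of i] by (auto simp: axis_def)
  have "((\<lambda>h. (poly P (0 + h) - poly P 0) / h) \<longlongrightarrow> poly (pderiv P) 0) (at 0)"
    using poly_DERIV[of P 0] unfolding DERIV_def .
  moreover have "filterlim (\<lambda>n. 1 / real (Suc n)) (at 0) sequentially"
    using LIMSEQ_inverse_real_of_nat by (intro filterlim_atI) (auto simp: inverse_eq_divide)
  ultimately have "(\<lambda>n. (poly P (0 + 1 / real (Suc n)) - poly P 0) / (1 / real (Suc n))) \<longlonglongrightarrow> poly (pderiv P) 0"
    by (rule filterlim_compose)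
  moreover have "f x = poly P 0" using P[of 0] by simp
  ultimately show ?thesis unfolding d P by (simp add: mult.commute)
qed

text \<open>The difference quotients of the zero extension of \<open>f\<close> have integral zero by translation invariance, and they
  converge dominatedly, since \<open>f\<close> is Lipschitz.\<close>

lemma integral_pd_zero:
  assumes f: "f \<in> CP k" and b: "bdry_zero f"
    and F: "\<And>s. s < 6 \<Longrightarrow> F s \<in> pol k" "\<And>s x. s < 6 \<Longrightarrow> x \<in> K s \<Longrightarrow> f x = F s x"
  shows "(\<Sum>s<6. integral (K s) (pd i (F s))) = 0"
proof -
  obtain L where L: "L \<ge> 0" "\<forall>x y. \<bar>f x - f y\<bar> \<le> L * norm (x - y)" using CP_lipschitz[OF f b] by blast
  have fc: "continuous_on UNIV f" by (rule continuous_of_lipschitz[OF L(2,1)])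
  have fm: "f \<in> borel_measurable borel" by (rule borel_measurable_continuous_onI[OF fc])
  let ?e = "axis i 1 :: pt"
  let ?g = "\<lambda>n x. real (Suc n) * (f (x + (1 / real (Suc n)) *\<^sub>R ?e) - f x)"
  \<comment> \<open>Where pieces overlap several summands contribute; \<open>?D\<close> is the
    derivative of \<open>f\<close> only off the null set \<open>N\<close> below.\<close>
  let ?D = "\<lambda>x. \<Sum>s<6. indicator (K s) x *\<^sub>R pd i (F s) x"
  have cD: "continuous_on A (pd i (F s))" if "s < 6" for s A by (rule pol_continuous[OF pd_pol[OF F(1)[OF that]]])
  have Dint: "set_integrable lborel (K s) (pd i (F s))" if "s < 6" for s
    by (rule set_integrable_compact[OF K_compact cD[OF that]])
  have D: "integral\<^sup>L lborel ?D = (\<Sum>s<6. integral (K s) (pd i (F s)))"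
  proof -
    have "integral\<^sup>L lborel ?D = (\<Sum>s<6. integral\<^sup>L lborel (\<lambda>x. indicator (K s) x *\<^sub>R pd i (F s) x))"
      using Dint unfolding set_integrable_def by (intro Bochner_Integration.integral_sum) auto
    also have "\<dots> = (\<Sum>s<6. integral (K s) (pd i (F s)))"
      using set_borel_integral_eq_integral(2)[OF Dint] unfolding set_lebesgue_integral_def by (intro sum.cong) auto
    finally show ?thesis .
  qed
  obtain R where R: "tri z \<subseteq> cball 0 R"
    using compact_imp_bounded[OF tri_compact] unfolding bounded_iff subset_eq by auto
  have int_f: "integrable lborel (\<lambda>x. f (x + h))" for h
  proof -
    have "integrable lborel f"
    proof -
      have "(\<lambda>x. indicator (tri z) x *\<^sub>R f x) = f" using CP_zero[OF f] by (auto simp: indicator_def fun_eq_iff)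
      then show ?thesis using borel_integrable_compact[OF tri_compact CP_continuous[OF f]] by simp
    qed
    then have "integrable (distr lborel borel ((+) h)) f" by (simp add: lborel_distr_plus)
    then have "integrable lborel (\<lambda>x. f (h + x))" using fm by (subst (asm) integrable_distr_eq) auto
    then show ?thesis by (simp add: add.commute)
  qed
  have g0: "integral\<^sup>L lborel (?g n) = 0" for n
  proof -
    have "integral\<^sup>L lborel (?g n) = real (Suc n) * (integral\<^sup>L lborel (\<lambda>x. f (x + (1 / real (Suc n)) *\<^sub>R ?e)) - integral\<^sup>L lborel f)"
      using int_f[of "(1 / real (Suc n)) *\<^sub>R ?e"] int_f[of 0]
      by (subst integral_mult_right_zero) (subst Bochner_Integration.integral_diff, simp_all)
    then show ?thesis using integral_translate[OF fm] by simp
  qed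
  \<comment> \<open>Off \<open>N\<close>, a point of the triangle is interior to one piece and
    belongs to no other.\<close>
  define N where "N = (\<Union>s<6. {x. alpha s x = 0 \<or> beta s x = 0 \<or> m s x = 0})"
  have N: "negligible N" unfolding N_def
    by (rule negligible_Union) (auto intro: tri_sides_negligible[OF K_ccw])
  have "closed N" unfolding N_def
  proof (intro closed_UN ballI)
    fix s
    have "closed {x. alpha s x = 0}" "closed {x. beta s x = 0}" "closed {x. m s x = 0}"
      by (intro closed_Collect_eq pol_continuous[OF pol_al] pol_continuous[OF pol_be] pol_continuous[OF pol_mu] continuous_on_const)+
    then show "closed {x. alpha s x = 0 \<or> beta s x = 0 \<or> m s x = 0}"
      by (intro closed_Collect_disj)
  qed simp
  with N have AE_N: "AE x in lborel. x \<notin> N" by (rule negligible_AE_lborel)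
  have lim: "(\<lambda>n. ?g n x) \<longlonglongrightarrow> ?D x" if x: "x \<notin> N" for x
  proof -
    have to: "(\<lambda>n. x + (1 / real (Suc n)) *\<^sub>R ?e) \<longlonglongrightarrow> x"
    proof -
      have "(\<lambda>n. 1 / real (Suc n)) \<longlonglongrightarrow> 0" using LIMSEQ_inverse_real_of_nat by (simp add: inverse_eq_divide)
      then have "(\<lambda>n. x + (1 / real (Suc n)) *\<^sub>R ?e) \<longlonglongrightarrow> x + 0 *\<^sub>R ?e" by (intro tendsto_intros)
      then show ?thesis by simp
    qed
    show ?thesis
    proof (cases "x \<in> tri z")
      case True
      then obtain s where s: "s < 6" "x \<in> K s" unfolding tri_Union by auto
      have "alpha s x \<noteq> 0" "beta s x \<noteq> 0" "m s x \<noteq> 0"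
        using x s(1) unfolding N_def by auto
      moreover have "alpha s x \<ge> 0" "beta s x \<ge> 0" "m s x \<ge> 0"
        using s(2) unfolding Kiff by auto
      ultimately have pos: "alpha s x > 0" "beta s x > 0" "m s x > 0" by auto
      have int: "x \<in> interior (K s)" using tri_open[OF K_ccw pos] unfolding K_def .
      have "t \<in> {..<6} - {s} \<Longrightarrow> x \<notin> K t" for t using K_overlap[of s t x] s pos by auto
      then have Dx: "?D x = pd i (F s) x"
        using s sum.remove[of "{..<6}" s "\<lambda>s. indicator (K s) x *\<^sub>R pd i (F s) x"] by simp
      have "\<forall>\<^sub>F n in sequentially. x + (1 / real (Suc n)) *\<^sub>R ?e \<in> interior (K s)"
        using to int by (simp add: topological_tendstoD)
      then have ev: "\<forall>\<^sub>F n in sequentially. real (Suc n) * (F s (x + (1 / real (Suc n)) *\<^sub>R ?e) - F s x) = ?g n x"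
      proof eventually_elim
        case (elim n)
        then have "x + (1 / real (Suc n)) *\<^sub>R ?e \<in> K s" using interior_subset by blast
        then show ?case using F(2)[OF s(1)] s(2) by simp
      qed
      show ?thesis unfolding Dx
        by (rule Lim_transform_eventually[OF pol_difference_quotient[OF F(1)[OF s(1)]] ev])
    next
      case False
      then have "x \<notin> K s" for s using K_subset by blast
      then have Dx: "?D x = 0" by simp
      have "\<forall>\<^sub>F n in sequentially. x + (1 / real (Suc n)) *\<^sub>R ?e \<in> - tri z"
        using to False tri_closed by (intro topological_tendstoD) (auto simp: open_Compl)
      then have ev: "\<forall>\<^sub>F n in sequentially. 0 = ?g n x"
        by eventually_elim (use False CP_zero[OF f] in simp)
      show ?thesis unfolding Dx by (rule Lim_transform_eventually[OF tendsto_const ev])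
    qed
  qed
  \<comment> \<open>The shifts have length at most 1, so outside the ball of radius
    \<open>R + 1\<close> both values of \<open>f\<close> in the quotient are 0.\<close>
  have bound: "norm (?g n x) \<le> L * indicator (cball 0 (R + 1)) x" for n x
  proof (cases "x \<in> cball 0 (R + 1)")
    case True
    have "\<bar>f (x + (1 / real (Suc n)) *\<^sub>R ?e) - f x\<bar> \<le> L * norm ((1 / real (Suc n)) *\<^sub>R ?e)"
      using L(2) by (metis add_diff_cancel_left')
    also have "\<dots> = L / real (Suc n)" by simp
    finally have "real (Suc n) * \<bar>f (x + (1 / real (Suc n)) *\<^sub>R ?e) - f x\<bar> \<le> L"
      by (simp add: pos_le_divide_eq mult.commute del: of_nat_Suc)
    then show ?thesis using True by (simp add: abs_mult del: of_nat_Suc)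
  next
    case False
    have "norm ((1 / real (Suc n)) *\<^sub>R ?e) \<le> 1" by simp
    moreover have "norm x \<le> norm (x + h) + norm h" for h
      by (metis add_diff_cancel_right' norm_triangle_ineq4)
    ultimately have "norm x \<le> norm (x + (1 / real (Suc n)) *\<^sub>R ?e) + 1" by (meson add_left_mono order_trans)
    then have "x + (1 / real (Suc n)) *\<^sub>R ?e \<notin> tri z" "x \<notin> tri z" using False R by auto
    then show ?thesis using CP_zero[OF f] False by simp
  qed
  have "(\<lambda>n. integral\<^sup>L lborel (?g n)) \<longlonglongrightarrow> integral\<^sup>L lborel ?D"
  proof (rule integral_dominated_convergence)
    show "integrable lborel (\<lambda>x. L * indicator (cball 0 (R + 1)) x)"
      by (intro integrable_mult_right integrable_real_indicator) (use emeasure_bounded_finite[OF bounded_cball] in simp_all)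
    show "AE x in lborel. (\<lambda>n. ?g n x) \<longlonglongrightarrow> ?D x" using AE_N lim by auto
    show "AE x in lborel. norm (?g n x) \<le> L * indicator (cball 0 (R + 1)) x" for n using bound by simp
    show "?D \<in> borel_measurable lborel"
      using Dint unfolding set_integrable_def by (intro borel_measurable_sum) (auto dest: borel_measurable_integrable)
    show "?g n \<in> borel_measurable lborel" for n
      using int_f[of "(1 / real (Suc n)) *\<^sub>R ?e"] int_f[of 0]
      by (intro borel_measurable_times borel_measurable_const borel_measurable_diff) (auto dest: borel_measurable_integrable)
  qed
  then have "integral\<^sup>L lborel ?D = 0" unfolding g0 by (simp add: LIMSEQ_const_iff)
  then show ?thesis using D by simp
qed

end

subsection \<open>Dimension of the space of splines with zero boundary values\<close>

definition Dir :: "pt \<Rightarrow> (pt \<Rightarrow> real) \<Rightarrow> pt \<Rightarrow> real"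
  where "Dir h f x = pd 1 f x * h $ 1 + pd 2 f x * h $ 2"

lemma Dir_deriv: "f \<in> pol k \<Longrightarrow> (f has_derivative (\<lambda>h. Dir h f x)) (at x)"
  unfolding Dir_def by (rule pol_deriv)

lemma Dir_pol: "f \<in> pol k \<Longrightarrow> Dir h f \<in> pol k"
proof -
  assume f: "f \<in> pol k"
  have "Dir h f = (\<lambda>x. h $ 1 * pd 1 f x + h $ 2 * pd 2 f x)" by (auto simp: Dir_def mult.commute)
  also have "\<dots> \<in> pol k"
    using bp_monoD[OF pd_pol[OF f]] by (intro bp_add bp_scale) auto
  finally show ?thesis .
qed

lemma Dir_scale: "Dir (c *\<^sub>R h) f x = c * Dir h f x"
  by (simp add: Dir_def algebra_simps)

lemma Dir_mult: "f \<in> pol k \<Longrightarrow> g \<in> pol l \<Longrightarrow> Dir h (\<lambda>x. f x * g x) x = f x * Dir h g x + Dir h f x * g x"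
  unfolding Dir_def by (simp add: pd_mult algebra_simps)

lemma Dir_power: "f \<in> pol k \<Longrightarrow> Dir h (\<lambda>x. f x ^ Suc n) x = real (Suc n) * f x ^ n * Dir h f x"
proof (induction n)
  case 0
  then show ?case by simp
next
  case (Suc n)
  have "Dir h (\<lambda>x. f x * f x ^ Suc n) x = f x * Dir h (\<lambda>x. f x ^ Suc n) x + Dir h f x * f x ^ Suc n"
    by (rule Dir_mult[OF Suc.prems bp_power[OF Suc.prems]])
  also have "\<dots> = real (Suc (Suc n)) * f x ^ Suc n * Dir h f x"
    unfolding Suc.IH[OF Suc.prems] by (simp add: algebra_simps)
  finally show ?case by simp
qed

lemma Dir_line:
  assumes "f \<in> pol k" "\<And>t. f (linepath a b t) = poly P t"
  shows "poly (pderiv P) t = Dir (b - a) f (linepath a b t)"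
  using pol_line_deriv[OF assms(1), of a "b - a" P t] assms(2) by (simp add: linepath_line Dir_def)

lemma poly_degree_1:
  fixes P :: "real poly"
  assumes "degree P \<le> 1"
  shows "poly P t = poly P 0 + t * (poly P 1 - poly P 0)" "poly (pderiv P) t = poly P 1 - poly P 0"
proof -
  obtain a R where PR: "P = pCons a R" by (cases P)
  then have "degree R = 0" using assms by (auto simp: degree_pCons_eq_if split: if_splits)
  then obtain b where "R = [:b:]" using degree_eq_zeroE by blast
  then show "poly P t = poly P 0 + t * (poly P 1 - poly P 0)" "poly (pderiv P) t = poly P 1 - poly P 0"
    using PR by (simp_all add: pderiv_pCons)
qed

text \<open>The gradient of an affine function is constant, so its derivative at \<open>x\<close>
  can be read off from an increment at any point \<open>y\<close>.\<close>

lemma Dir_affine: "f \<in> pol 1 \<Longrightarrow> Dir h f x = f (y + h) - f y"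
proof -
  assume f: "f \<in> pol 1"
  obtain P where P: "degree P \<le> 1" "\<And>t. f (y + t *\<^sub>R h) = poly P t" using pol_line[OF f] by blast
  have "pd i f \<in> pol 0" for i using pd_pol[OF f] by simp
  then have c: "pd i f x = pd i f y" for i using bp_0 by metis
  have "poly (pderiv P) 0 = Dir h f y" using pol_line_deriv[OF f P(2), of 0] by (simp add: Dir_def)
  also have "\<dots> = Dir h f x" by (simp add: Dir_def c)
  finally have "Dir h f x = poly (pderiv P) 0" by simp
  also have "\<dots> = f (y + h) - f y" using poly_degree_1(2)[OF P(1), of 0] P(2)[of 0] P(2)[of 1] by simp
  finally show ?thesis .
qed

context powell_sabin
begin

lemma m_pol: "m s \<in> pol 1"
  by (rule pol_mu)

lemma deriv_K:
  assumes s: "s < 6" and f: "f \<in> pol k" "\<And>y. y \<in> K s \<Longrightarrow> g y = f y" and x: "x \<in> K s"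
    and A: "(g has_derivative A) (at x within tri z)"
  shows "A h = Dir h f x"
proof -
  have "(g has_derivative A) (at x within K s)" using has_derivative_subset[OF A K_subset] .
  from tri_deriv_unique[OF K_ccw[of s] f(1) _ _ this[unfolded K_def]] show ?thesis
    using x f(2) unfolding K_def Dir_def by blast
qed

text \<open>At the point with parameter t of the spoke both functions \<open>m\<close> equal 1 - t.
  Equating the derivatives of the two pieces of \<open>MU ^ Suc n * q\<close> gives
  \<open>(1 - t) ^ n * (?\<Phi> + (1 - t) * ?\<Psi>) = 0\<close>, where \<open>?\<Phi>\<close>
  contains the jump of the derivative of \<open>MU\<close> and \<open>?\<Psi>\<close> is that of
  \<open>q\<close>. Cancelling the power and passing to t = 1 yields the first claim. If
  \<open>m\<close> is the same on both sides, \<open>?\<Phi>\<close> is 0, one more factor cancels,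
  and t = 1 yields the second.\<close>

lemma spoke_relation:
  assumes q: "(\<lambda>x. MU x ^ Suc n * q x) differentiable_on tri z"
    and s: "s < 6" and f: "f \<in> pol k" "\<And>x. x \<in> K s \<Longrightarrow> q x = f x"
    and g: "g \<in> pol k" "\<And>x. x \<in> K (Suc s mod 6) \<Longrightarrow> q x = g x"
  defines "b \<equiv> p (Suc s)"
  shows "f b * (Dir h (m s) b - Dir h (m (Suc s)) b) = 0"
    and "m s = m (Suc s) \<Longrightarrow> Dir h f b = Dir h g b"
proof -
  let ?s = "Suc s mod 6"
  have s': "?s < 6" by simp
  let ?W = "\<lambda>x. MU x ^ Suc n * q x"
  let ?\<Phi> = "\<lambda>x. real (Suc n) * (f x * (Dir h (m s) x - Dir h (m (Suc s)) x))" and ?\<Psi> = "\<lambda>x. Dir h f x - Dir h g x"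
  have \<Phi>: "?\<Phi> \<in> pol (k + 1)" by (intro bp_scale bp_mult bp_diff Dir_pol m_pol f(1))
  have \<Psi>: "?\<Psi> \<in> pol k" by (intro bp_diff Dir_pol f(1) g(1))
  obtain P where P: "\<And>t. ?\<Phi> (linepath (z 0) b t) = poly P t" using pol_linepath[OF \<Phi>] by blast
  obtain Q where Q: "\<And>t. ?\<Psi> (linepath (z 0) b t) = poly Q t" using pol_linepath[OF \<Psi>] by blast
  have eq: "poly (P + [:1, -1:] * Q) t = poly 0 t" if t: "t \<in> {0<..<1}" for t
  proof -
    let ?x = "linepath (z 0) b t"
    have t': "t \<in> {0..1}" using t by simp
    have x: "?x \<in> K s" "?x \<in> K ?s" unfolding b_def using seg_K(2)[OF t'] seg_K(1)[OF t', of "Suc s"] K_mod by simp_all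
    then have xT: "?x \<in> tri z" using K_subset by blast
    have mx: "m s ?x = 1 - t" "m (Suc s) ?x = 1 - t" unfolding b_def m_spoke by simp_all
    have fg: "f ?x = g ?x" using f(2)[OF x(1)] g(2)[OF x(2)] by simp
    obtain A where A: "(?W has_derivative A) (at ?x within tri z)"
      using q xT unfolding differentiable_on_def differentiable_def by blast
    have "A h = Dir h (\<lambda>x. m s x ^ Suc n * f x) ?x"
      by (rule deriv_K[OF s bp_mult[OF bp_power[OF m_pol] f(1)] _ x(1) A]) (simp only: MU_K[OF s] f(2))
    moreover have "A h = Dir h (\<lambda>x. m ?s x ^ Suc n * g x) ?x"
      by (rule deriv_K[OF s' bp_mult[OF bp_power[OF m_pol] g(1)] _ x(2) A]) (simp only: MU_K[OF s'] g(2))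
    ultimately have "Dir h (\<lambda>x. m s x ^ Suc n * f x) ?x = Dir h (\<lambda>x. m (Suc s) x ^ Suc n * g x) ?x"
      unfolding m_mod by metis
    then have "m s ?x ^ Suc n * Dir h f ?x + real (Suc n) * m s ?x ^ n * Dir h (m s) ?x * f ?x
      = m (Suc s) ?x ^ Suc n * Dir h g ?x + real (Suc n) * m (Suc s) ?x ^ n * Dir h (m (Suc s)) ?x * g ?x"
      by (simp only: Dir_mult[OF bp_power[OF m_pol] f(1)] Dir_mult[OF bp_power[OF m_pol] g(1)] Dir_power[OF m_pol])
    then have "(1 - t) ^ n * (?\<Phi> ?x + (1 - t) * ?\<Psi> ?x) = 0"
      unfolding mx fg[symmetric] by (simp add: algebra_simps)
    then have "?\<Phi> ?x + (1 - t) * ?\<Psi> ?x = 0" using t by simp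
    then show ?thesis unfolding P Q by (simp add: algebra_simps)
  qed
  then have z: "P + [:1, -1:] * Q = 0" by (rule poly_eq_half_open)
  then have "poly (P + [:1, -1:] * Q) 1 = 0" by simp
  then have "?\<Phi> b = 0" using P[of 1] by (simp add: linepath_1')
  then show "f b * (Dir h (m s) b - Dir h (m (Suc s)) b) = 0" by simp
  assume "m s = m (Suc s)"
  then have "poly P t = 0" for t using P[of t] by simp
  then have "P = 0" using poly_eq_poly_eq_iff[of P 0] by auto
  then have "[:1, -1:] * Q = 0" using z by simp
  then have "Q = 0" by (metis mult_eq_0_iff one_neq_zero pCons_eq_0_iff)
  then show "Dir h f b = Dir h g b" using Q[of 1] by (simp add: linepath_1')
qed

text \<open>Functions \<open>q\<close> such that \<open>MU ^ n q\<close> is a \<open>C\<^sup>1\<close> spline. Dividing those with zero boundary values by \<open>MU\<close> lowers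
  the degree and raises \<open>n\<close>; the boundary values themselves vanish at the corners and are \<open>C\<^sup>1\<close> along each edge
  of the triangle, so they are determined by moments of order \<open>k - 2\<close>.\<close>

definition MU_splines :: "nat \<Rightarrow> nat \<Rightarrow> (pt \<Rightarrow> real) set"
  where "MU_splines n k = {q \<in> CP k. (\<lambda>x. MU x ^ n * q x) differentiable_on tri z}"

lemma MU_splines_CP: "q \<in> MU_splines n k \<Longrightarrow> q \<in> CP k"
  by (simp add: MU_splines_def)

lemma subspace_MU_splines: "subspace (MU_splines n k)"
proof (rule subspaceI)
  show "0 \<in> MU_splines n k" using subspace_0[OF subspace_CP] by (simp add: MU_splines_def zero_fun_def)
  show "x + y \<in> MU_splines n k" if xy: "x \<in> MU_splines n k" "y \<in> MU_splines n k" for x y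
  proof -
    have "(\<lambda>w. MU w ^ n * x w + MU w ^ n * y w) differentiable_on tri z"
      using xy unfolding MU_splines_def differentiable_on_def by (auto intro!: derivative_intros)
    then show ?thesis using xy subspace_add[OF subspace_CP] by (simp add: MU_splines_def distrib_left)
  qed
  show "c *\<^sub>R x \<in> MU_splines n k" if x: "x \<in> MU_splines n k" for c x
  proof -
    have "(\<lambda>w. c * (MU w ^ n * x w)) differentiable_on tri z"
      using x unfolding MU_splines_def differentiable_on_def by (auto intro!: derivative_intros)
    then show ?thesis using x subspace_scale[OF subspace_CP] by (simp add: MU_splines_def mult.left_commute)
  qed
qed

text \<open>The derivative is taken along the outer edge that ends in the corner: \<open>m\<close>
  of the piece at this edge is constant along it, \<open>m\<close> of the next piece is not, so the
  jump in the first claim of \<open>spoke_relation\<close> is nonzero.\<close>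

lemma MU_splines_corner:
  assumes q: "q \<in> MU_splines (Suc n) k" and e: "even e"
  shows "q (p e) = 0"
proof -
  \<comment> \<open>The predecessor of \<open>e\<close> modulo 6, so that the corner is the outer
    end of the spoke between \<open>K s\<close> and its successor.\<close>
  define s where "s = (e + 5) mod 6"
  have s: "s < 6" "odd s" unfolding s_def using e by (simp, presburger)
  have "Suc s mod 6 = e mod 6" unfolding s_def by presburger
  then have pe: "p (Suc s) = p e" using p_mod6 by metis
  obtain f where f: "f \<in> pol k" "\<And>x. x \<in> K s \<Longrightarrow> q x = f x" by (rule CP_piece[OF MU_splines_CP[OF q] s(1)]) blast
  obtain g where g: "g \<in> pol k" "\<And>x. x \<in> K (Suc s mod 6) \<Longrightarrow> q x = g x"
    by (rule CP_piece[OF MU_splines_CP[OF q], of "Suc s mod 6"]) auto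
  let ?b = "p (Suc s)" let ?h = "p s - p (Suc s)"
  have r: "f ?b * (Dir ?h (m s) ?b - Dir ?h (m (Suc s)) ?b) = 0"
    by (rule spoke_relation(1)[where n = n, OF _ s(1) f g]) (use q in \<open>simp_all add: MU_splines_def\<close>)
  have "Dir ?h (m s) ?b = m s (p s) - m s ?b" using Dir_affine[OF m_pol, of ?h s ?b ?b] by simp
  also have "\<dots> = 0" using al_be_mu_vertices[OF K_ccw[of s]] by simp
  finally have 1: "Dir ?h (m s) ?b = 0" .
  have "Dir ?h (m (Suc s)) ?b = m (Suc s) (p s) - m (Suc s) ?b" using Dir_affine[OF m_pol, of ?h "Suc s" ?b ?b] by simp
  also have "\<dots> = m (Suc s) (p s)" using al_be_mu_vertices[OF K_ccw[of "Suc s"]] by simp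
  finally have "Dir ?h (m (Suc s)) ?b \<noteq> 0" using m_odd[OF s(2)] by simp
  then have "f ?b = 0" using r 1 by simp
  then show ?thesis using f(2)[OF K_p(3)] pe by simp
qed

text \<open>A boundary edge \<open>[p s, p (s + 2)]\<close> of the triangle consists of two edges of the split, meeting at
  \<open>p (s + 1)\<close>.\<close>

lemma edge_zero:
  assumes q: "q \<in> CP k" and s: "s < 6" "even s"
    and mom: "\<And>u j. u < 6 \<Longrightarrow> j + 2 \<le> k \<Longrightarrow> integral {0..1} (\<lambda>t. q (rim u t) * t ^ j) = 0"
    and ends: "q (p s) = 0" "q (p (s + 2)) = 0"
    and f: "f \<in> pol k" "\<And>x. x \<in> K s \<Longrightarrow> q x = f x" and g: "g \<in> pol k" "\<And>x. x \<in> K (Suc s) \<Longrightarrow> q x = g x"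
    and join: "q (p (Suc s)) = 0 \<or> Dir (p (s + 2) - p s) f (p (Suc s)) = Dir (p (s + 2) - p s) g (p (Suc s))"
    and t: "t \<in> {0..1}"
  shows "q (rim s t) = 0" "q (rim (Suc s) t) = 0"
proof -
  have e2: "Suc (Suc s) = s + 2" by simp
  have s1: "Suc s < 6" using s by presburger
  obtain r where r: "0 < r" "r < 1" "p (Suc s) = (1 - r) *\<^sub>R p s + r *\<^sub>R p (s + 2)" by (rule mid[OF s(2)])
  obtain P where P: "degree P \<le> k" "\<And>t. f (rim s t) = poly P t" using pol_linepath[OF f(1)] by blast
  obtain Q where Q: "degree Q \<le> k" "\<And>t. g (rim (Suc s) t) = poly Q t" using pol_linepath[OF g(1)] by blast
  have qP: "q (rim s t) = poly P t" if "t \<in> {0..1}" for t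
    using f(2)[OF seg_K(3)[OF that]] P(2) by simp
  have qQ: "q (rim (Suc s) t) = poly Q t" if "t \<in> {0..1}" for t
    using g(2)[OF seg_K(3)[OF that]] Q(2) by simp
  have dP: "poly (pderiv P) 1 = r * Dir (p (s + 2) - p s) f (p (Suc s))"
    using Dir_line[OF f(1) P(2), of 1] by (simp add: linepath_1' mid_diff(1)[OF r(3)] Dir_scale)
  have dQ: "poly (pderiv Q) 0 = (1 - r) * Dir (p (s + 2) - p s) g (p (Suc s))"
    using Dir_line[OF g(1) Q(2), of 0] unfolding e2 by (simp add: linepath_0' mid_diff(2)[OF r(3)] Dir_scale)
  have P0: "poly P 0 = 0" using qP[of 0] ends by (simp add: linepath_0')
  have Q1: "poly Q 1 = 0" using qQ[of 1] ends unfolding e2 by (simp add: linepath_1')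
  have PQ: "poly P 1 = poly Q 0" using qP[of 1] qQ[of 0] by (simp add: linepath_0' linepath_1')
  \<comment> \<open>The halves have lengths in the ratio r to 1 - r and are both parametrised over
    [0, 1]; the cross factors undo the two scalings of the derivative.\<close>
  have jn: "poly P 1 = 0 \<or> (1 - r) * poly (pderiv P) 1 = r * poly (pderiv Q) 0"
    using join qP[of 1] unfolding dP dQ by (auto simp: linepath_1')
  have mP: "integral {0..1} (\<lambda>t. poly P t * t ^ j) = 0" if "j + 2 \<le> k" for j
  proof -
    have "integral {0..1} (\<lambda>t. poly P t * t ^ j) = integral {0..1} (\<lambda>t. q (rim s t) * t ^ j)"
      by (rule integral_cong) (simp add: qP)
    then show ?thesis using mom[OF s(1) that] by simp
  qed
  have mQ: "integral {0..1} (\<lambda>t. poly Q t * t ^ j) = 0" if "j + 2 \<le> k" for j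
  proof -
    have "integral {0..1} (\<lambda>t. poly Q t * t ^ j) = integral {0..1} (\<lambda>t. q (rim (Suc s) t) * t ^ j)"
      by (rule integral_cong) (simp add: qQ)
    then show ?thesis using mom[OF s1 that] by simp
  qed
  have r1: "0 < 1 - r" using r by simp
  have "P = 0" "Q = 0"
    using two_piece_zero[OF P(1) Q(1) r(1) r1 P0 Q1 PQ jn] mP mQ by blast+
  then show "q (rim s t) = 0" "q (rim (Suc s) t) = 0"
    using qP[OF t] qQ[OF t] by simp_all
qed

lemma lin_on_moment: "lin_on (CP k) (\<lambda>q. integral {0..1} (\<lambda>t. q (rim s t) * t ^ j))"
proof -
  have int: "(\<lambda>t. q (rim s t) * t ^ j) integrable_on {0..1}" if q: "q \<in> CP k" for q
  proof (intro integrable_continuous_real continuous_intros)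
    show "continuous_on {0..1} (\<lambda>t. q (rim s t))"
    proof (rule continuous_on_compose2[OF CP_continuous[OF q] continuous_on_linepath])
      show "rim s ` {0..1} \<subseteq> tri z" using seg_K(3)[of _ s] K_subset[of s] by blast
    qed
  qed
  show ?thesis
  proof (rule lin_onI)
    show "integral {0..1} (\<lambda>t. (q + q') (rim s t) * t ^ j) =
      integral {0..1} (\<lambda>t. q (rim s t) * t ^ j) + integral {0..1} (\<lambda>t. q' (rim s t) * t ^ j)"
      if "q \<in> CP k" "q' \<in> CP k" for q q'
      using Henstock_Kurzweil_Integration.integral_add[OF int[OF that(1)] int[OF that(2)]] by (simp add: distrib_right)
    show "integral {0..1} (\<lambda>t. (c *\<^sub>R q) (rim s t) * t ^ j) =
      c *\<^sub>R integral {0..1} (\<lambda>t. q (rim s t) * t ^ j)" for c q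
      by (simp add: mult.assoc)
  qed
qed

text \<open>The bound holds for all exponents at once because each division by \<open>MU\<close>
  lowers the degree and raises the exponent. Positivity of the exponent is what makes the functions
  vanish at the corners.\<close>

lemma MU_splines_dim: "dimle (MU_splines (Suc n) k) (3 * k * (k - 1))"
proof (induction k arbitrary: n)
  case 0
  have "q = 0" if q: "q \<in> MU_splines (Suc n) 0" for q
  proof
    fix x
    show "q x = 0 x"
    proof (cases "x \<in> tri z")
      case True
      then obtain s where s: "s < 6" "x \<in> K s" unfolding tri_Union by auto
      obtain c where c: "\<And>x. x \<in> K s \<Longrightarrow> q x = c" by (rule CP0_const[OF MU_splines_CP[OF q] s(1)]) blast
      \<comment> \<open>Of two consecutive boundary vertices one is a corner, so each piece contains
        a zero of the constant.\<close>
      have "q (p s) = 0 \<or> q (p (Suc s)) = 0" using MU_splines_corner[OF q, of s] MU_splines_corner[OF q, of "Suc s"] by auto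
      then show ?thesis using c[OF s(2)] c[OF K_p(2)] c[OF K_p(3)] by auto
    qed (use CP_zero[OF MU_splines_CP[OF q]] in simp)
  qed
  then have "MU_splines (Suc n) 0 \<subseteq> {0}" by blast
  then show ?case unfolding dimle_def by (intro exI[of _ "{}"]) simp
next
  case (Suc k)
  let ?I = "{..<6::nat} \<times> {..<k}"
  let ?l = "\<lambda>i q. integral {0..1} (\<lambda>t. q (linepath (p (fst i)) (p (Suc (fst i))) t) * t ^ snd i) :: real"
  have "{q \<in> MU_splines (Suc n) (Suc k). \<forall>i\<in>?I. ?l i q = 0} \<subseteq> (\<lambda>q x. MU x * q x) ` MU_splines (Suc (Suc n)) k"
  proof clarify
    fix q assume q: "q \<in> MU_splines (Suc n) (Suc k)" and l: "\<forall>i\<in>?I. ?l i q = 0"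
    have mom: "integral {0..1} (\<lambda>t. q (rim u t) * t ^ j) = 0" if "u < 6" "j + 2 \<le> Suc k" for u j
      using bspec[OF l, of "(u, j)"] that by simp
    have ev: "q (rim s t) = 0 \<and> q (rim (Suc s) t) = 0"
      if s: "s < 6" "even s" and t: "t \<in> {0..1}" for s t
    proof -
      have s1: "Suc s < 6" using s by presburger
      then have s1': "Suc s mod 6 = Suc s" by simp
      obtain f where f: "f \<in> pol (Suc k)" "\<And>x. x \<in> K s \<Longrightarrow> q x = f x" by (rule CP_piece[OF MU_splines_CP[OF q] s(1)]) blast
      obtain g where g: "g \<in> pol (Suc k)" "\<And>x. x \<in> K (Suc s) \<Longrightarrow> q x = g x" by (rule CP_piece[OF MU_splines_CP[OF q] s1]) blast
      \<comment> \<open>The collinearity of the two outer edges enters here, through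
        \<open>m_even\<close>.\<close>
      have "Dir (p (s + 2) - p s) f (p (Suc s)) = Dir (p (s + 2) - p s) g (p (Suc s))"
        by (rule spoke_relation(2)[where n = n, OF _ s(1) f]) (use q g m_even[OF s(2)] in \<open>simp_all add: MU_splines_def s1'\<close>)
      then show ?thesis
        using edge_zero[OF MU_splines_CP[OF q] s mom _ _ f g _ t] MU_splines_corner[OF q s(2)] MU_splines_corner[OF q, of "s + 2"] s(2) by simp
    qed
    have "bdry_zero q" unfolding bdry_zero_def
    proof (intro allI impI ballI)
      fix s :: nat and t :: real assume s: "s < 6" and t: "t \<in> {0..1}"
      show "q (rim s t) = 0"
      proof (cases "even s")
        case True
        then show ?thesis using ev[OF s True t] by simp
      next
        case False
        then obtain u where u: "s = Suc u" "even u" by (cases s) auto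
        then show ?thesis using ev[OF _ u(2) t] s by simp
      qed
    qed
    then obtain g where g: "g \<in> CP k" "q = (\<lambda>x. MU x * g x)" using CP_divide[OF MU_splines_CP[OF q]] by blast
    have "(\<lambda>x. MU x ^ Suc (Suc n) * g x) = (\<lambda>x. MU x ^ Suc n * q x)" unfolding g(2) by (auto simp: mult_ac)
    then have "g \<in> MU_splines (Suc (Suc n)) k" using q g(1) unfolding MU_splines_def by simp
    then show "q \<in> (\<lambda>q x. MU x * q x) ` MU_splines (Suc (Suc n)) k" using g(2) by blast
  qed
  from dimle_mono[OF dimle_image[OF subspace_MU_splines lin_on_MU Suc.IH] this order_refl]
  have "dimle (MU_splines (Suc n) (Suc k)) (card ?I + 3 * k * (k - 1))"
    by (rule dimle_functionals[where l = ?l, rotated 3])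
      (auto intro!: subspace_MU_splines lin_on_subset[OF lin_on_moment] MU_splines_CP)
  \<comment> \<open>6 k + 3 k (k - 1) = 3 (k + 1) k; the case split serves the truncated
    subtraction.\<close>
  moreover have "card ?I + 3 * k * (k - 1) = 3 * Suc k * (Suc k - 1)"
    by (cases k) (simp_all add: card_cartesian_product algebra_simps)
  ultimately show ?case by metis
qed

lemma rot_K:
  assumes q: "q differentiable_on tri z" and s: "s < 6" and f: "f \<in> pol k" "\<And>y. y \<in> K s \<Longrightarrow> q y = f y" and x: "x \<in> K s"
  shows "rot q (tri z) x = vector [pd 2 f x, - pd 1 f x]"
proof -
  have "x \<in> tri z" using x K_subset by blast
  then have A: "(q has_derivative frechet_derivative q (at x within tri z)) (at x within tri z)"
    using q unfolding differentiable_on_def frechet_derivative_works by blast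
  have D: "frechet_derivative q (at x within tri z) h = Dir h f x" for h by (rule deriv_K[OF s f x A])
  show ?thesis by (simp add: rot_def D Dir_def) (simp add: axis_def)
qed

lemma S0_CP: "q \<in> S0_space (int k) z \<Longrightarrow> q \<in> CP k"
  by (simp add: S0_space_def)

text \<open>Zero boundary values give one factor \<open>MU\<close>. On the boundary the derivative
  of \<open>MU * q1\<close> is \<open>q1\<close> times the derivative of \<open>MU\<close>, so the
  vanishing rotation gives a second factor.\<close>

lemma S0_dim_upper: "dimle (S0_space (int (k + 2)) z) (3 * k * (k - 1))"
proof -
  have "S0_space (int (k + 2)) z \<subseteq> (\<lambda>q x. MU x ^ 2 * q x) ` MU_splines 2 k"
  proof
    fix q assume q: "q \<in> S0_space (int (k + 2)) z"
    have e2: "k + 2 = Suc (Suc k)" by simp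
    from q have qC: "q \<in> CP (Suc (Suc k))" and qd: "q differentiable_on tri z"
      and q0: "\<And>x. x \<in> frontier (tri z) \<Longrightarrow> q x = 0" and qr: "\<And>x. x \<in> frontier (tri z) \<Longrightarrow> rot q (tri z) x = 0"
      unfolding e2 S0_space_def by blast+
    have "bdry_zero q" unfolding bdry_zero_iff using q0 by blast
    then obtain q1 where q1: "q1 \<in> CP (Suc k)" "q = (\<lambda>x. MU x * q1 x)" using CP_divide[OF qC] by blast
    have "bdry_zero q1" unfolding bdry_zero_def
    proof (intro allI impI ballI)
      fix s :: nat and t :: real assume s: "s < 6" and t: "t \<in> {0..1}"
      let ?x = "rim s t"
      have x: "?x \<in> K s" by (rule seg_K(3)[OF t])
      obtain f where f: "f \<in> pol (Suc k)" "\<And>x. x \<in> K s \<Longrightarrow> q1 x = f x" by (rule CP_piece[OF q1(1) s]) blast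
      have qf: "q y = m s y * f y" if "y \<in> K s" for y using q1(2) f(2)[OF that] MU_K[OF s that] by simp
      have mf: "(\<lambda>y. m s y * f y) \<in> pol (1 + Suc k)" by (rule bp_mult[OF m_pol f(1)])
      have "?x \<in> frontier (tri z)" unfolding frontier_tri linepath_image_01[symmetric] using s t by blast
      then have "vector [pd 2 (\<lambda>y. m s y * f y) ?x, - pd 1 (\<lambda>y. m s y * f y) ?x] = (0 :: pt)"
        using rot_K[OF qd s mf qf x] qr by simp
      then have "Dir h (\<lambda>y. m s y * f y) ?x = 0" for h
        unfolding Dir_def by (simp add: vec_eq_iff forall_2)
      then have "m s ?x * Dir h f ?x + Dir h (m s) ?x * f ?x = 0" for h
        using Dir_mult[OF m_pol f(1)] by metis
      moreover have "m s ?x = 0" using al_be_mu_outer[OF K_ccw] by simp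
      \<comment> \<open>From \<open>p s\<close> to \<open>z 0\<close> the affine function
        \<open>m s\<close> grows from 0 to 1.\<close>
      moreover have "Dir (z 0 - p s) (m s) ?x = 1"
        using Dir_affine[OF m_pol, of "z 0 - p s" s ?x "p s"] al_be_mu_vertices[OF K_ccw[of s]] by simp
      ultimately have "f ?x = 0" by (metis add.left_neutral mult_1 mult_zero_left)
      then show "q1 ?x = 0" using f(2)[OF x] by simp
    qed
    then obtain q2 where q2: "q2 \<in> CP k" "q1 = (\<lambda>x. MU x * q2 x)" using CP_divide[OF q1(1)] by blast
    have e: "q = (\<lambda>x. MU x ^ 2 * q2 x)" unfolding q1(2) q2(2) by (simp add: power2_eq_square mult.assoc)
    then have "q2 \<in> MU_splines 2 k" using qd q2(1) unfolding MU_splines_def by simp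
    then show "q \<in> (\<lambda>q x. MU x ^ 2 * q x) ` MU_splines 2 k" using e by blast
  qed
  moreover have "lin_on (MU_splines 2 k) (\<lambda>q x. MU x ^ 2 * q x)"
    by (rule lin_onI) (auto simp: fun_eq_iff distrib_left)
  moreover have "dimle (MU_splines 2 k) (3 * k * (k - 1))" using MU_splines_dim[of 1 k] by (simp add: numeral_2_eq_2)
  ultimately show ?thesis using dimle_mono[OF dimle_image[OF subspace_MU_splines] _ order_refl] by blast
qed

end

subsection \<open>Unisolvence\<close>

text \<open>The rows \<open>(a1, b1)\<close> and \<open>(a2, b2)\<close> form the jump of the
  gradient of a field across a spoke \<open>S\<close>. It annihilates \<open>S\<close>, so it has
  rank at most one, and zero trace makes its range parallel to \<open>S\<close>. The image of
  \<open>E\<close> has no component normal to \<open>E\<close> either; since \<open>S\<close> and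
  \<open>E\<close> are not parallel, it is 0.\<close>

lemma Dir_linear_zero:
  fixes S E :: pt
  assumes X: "cross S E \<noteq> 0"
    and S1: "a1 * S $ 1 + b1 * S $ 2 = 0" and S2: "a2 * S $ 1 + b2 * S $ 2 = 0"
    and n: "E $ 2 * (a1 * E $ 1 + b1 * E $ 2) = E $ 1 * (a2 * E $ 1 + b2 * E $ 2)" and tr: "a1 + b2 = 0"
  shows "a1 * E $ 1 + b1 * E $ 2 = 0" "a2 * E $ 1 + b2 * E $ 2 = 0"
proof -
  define u1 u2 where "u1 = a1 * E $ 1 + b1 * E $ 2" and "u2 = a2 * E $ 1 + b2 * E $ 2"
  have a1X: "a1 * cross S E = - S $ 2 * u1"
  proof -
    have "a1 * cross S E + S $ 2 * u1 = E $ 2 * (a1 * S $ 1 + b1 * S $ 2)"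
      unfolding u1_def cross_def by (simp add: algebra_simps)
    then show ?thesis using S1 by simp
  qed
  have b2X: "b2 * cross S E = S $ 1 * u2"
  proof -
    have "S $ 1 * u2 - b2 * cross S E = E $ 1 * (a2 * S $ 1 + b2 * S $ 2)"
      unfolding u2_def cross_def by (simp add: algebra_simps)
    then show ?thesis using S2 by simp
  qed
  have "S $ 1 * u2 - S $ 2 * u1 = (a1 + b2) * cross S E" using a1X b2X by (simp add: distrib_right)
  then have t: "S $ 1 * u2 = S $ 2 * u1" using tr by simp
  have n': "E $ 2 * u1 = E $ 1 * u2" using n unfolding u1_def u2_def .
  have "cross S E * u1 = S $ 1 * (E $ 2 * u1) - E $ 1 * (S $ 2 * u1)" by (simp add: cross_def algebra_simps)
  also have "\<dots> = 0" unfolding n' t[symmetric] by simp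
  finally have "u1 = 0" using X by simp
  have "cross S E * u2 = E $ 2 * (S $ 1 * u2) - S $ 2 * (E $ 1 * u2)" by (simp add: cross_def algebra_simps)
  also have "\<dots> = 0" unfolding n'[symmetric] t by simp
  finally have "u2 = 0" using X by simp
  show "a1 * E $ 1 + b1 * E $ 2 = 0" "a2 * E $ 1 + b2 * E $ 2 = 0"
    using \<open>u1 = 0\<close> \<open>u2 = 0\<close> unfolding u1_def u2_def .
qed

lemma two_forms_zero:
  fixes S E :: pt
  assumes X: "cross S E \<noteq> 0" and "a * S $ 1 + b * S $ 2 = 0" "a * E $ 1 + b * E $ 2 = 0"
  shows "a = 0" "b = 0"
proof -
  have e: "a * cross S E = E $ 2 * (a * S $ 1 + b * S $ 2) - S $ 2 * (a * E $ 1 + b * E $ 2)"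
    "b * cross S E = S $ 1 * (a * E $ 1 + b * E $ 2) - E $ 1 * (a * S $ 1 + b * S $ 2)"
    by (simp_all add: cross_def algebra_simps)
  have "a * cross S E = 0" "b * cross S E = 0"
    by (simp_all only: e assms(2,3) mult_zero_right diff_0_right)
  then show "a = 0" "b = 0" using X by simp_all
qed

section \<open>Divergence, potentials and the lower bound for the spline dimension\<close>

context powell_sabin
begin

text \<open>A choice of a representing polynomial. For \<open>q\<close> in \<open>CP k\<close> it is
  the only one, because each piece has interior points.\<close>

definition piece_poly :: "(pt \<Rightarrow> real) \<Rightarrow> nat \<Rightarrow> nat \<Rightarrow> pt \<Rightarrow> real"
  where "piece_poly q k s = (SOME f. f \<in> pol k \<and> (\<forall>x\<in>K s. q x = f x))"

lemma piece:
  assumes "q \<in> CP k" "s < 6"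
  shows "piece_poly q k s \<in> pol k" "x \<in> K s \<Longrightarrow> q x = piece_poly q k s x"
proof -
  have "\<exists>f. f \<in> pol k \<and> (\<forall>x\<in>K s. q x = f x)" using assms unfolding CP_iff by blast
  from someI_ex[OF this] have "piece_poly q k s \<in> pol k \<and> (\<forall>x\<in>K s. q x = piece_poly q k s x)" unfolding piece_poly_def .
  then show "piece_poly q k s \<in> pol k" "x \<in> K s \<Longrightarrow> q x = piece_poly q k s x" by blast+
qed

lemma L1_comp: "v \<in> L1_space (int k) z \<Longrightarrow> (\<lambda>x. v x $ i) \<in> CP k"
  by (simp add: L1_space_def)

lemma L1_continuous: "v \<in> L1_space (int k) z \<Longrightarrow> continuous_on (tri z) v"
  unfolding continuous_on_componentwise[of _ v]
  using CP_continuous[OF L1_comp] by (auto simp: Basis_vec_def inner_axis)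

lemma L1_inner: "v \<in> L1_space (int k) z \<Longrightarrow> (\<lambda>x. v x \<bullet> d) \<in> CP k"
proof -
  assume v: "v \<in> L1_space (int k) z"
  have "(\<lambda>x. v x \<bullet> d) = (d $ 1) *\<^sub>R (\<lambda>x. v x $ 1) + (d $ 2) *\<^sub>R (\<lambda>x. v x $ 2)"
    by (auto simp: inner_vec_def sum_2 mult.commute)
  then show ?thesis
    using subspace_add[OF subspace_CP] subspace_scale[OF subspace_CP] L1_comp[OF v] by simp
qed

abbreviation "V v k i s \<equiv> piece_poly (\<lambda>x. v x $ i) k s"

definition div_piece :: "(pt \<Rightarrow> pt) \<Rightarrow> nat \<Rightarrow> nat \<Rightarrow> pt \<Rightarrow> real"
  where "div_piece v k s x = pd 1 (V v k 1 s) x + pd 2 (V v k 2 s) x"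

lemma div_piece_pol: "v \<in> L1_space (int k) z \<Longrightarrow> s < 6 \<Longrightarrow> div_piece v k s \<in> pol (k - 1)"
  unfolding div_piece_def[abs_def] by (intro bp_add pd_pol piece L1_comp)

lemma div_K:
  assumes v: "v \<in> L1_space (int k) z" and s: "s < 6" and x: "x \<in> K s"
  shows "divergence v (K s) x = div_piece v k s x"
proof -
  have d: "((\<lambda>x. v x $ i) has_derivative (\<lambda>h. Dir h (V v k i s) x)) (at x within K s)" for i
    by (rule has_derivative_transform[OF x _ has_derivative_at_withinI[OF Dir_deriv[OF piece(1)[OF L1_comp[OF v] s]]]])
      (rule piece(2)[OF L1_comp[OF v] s])
  have "(v has_derivative (\<lambda>h. \<chi> i. Dir h (V v k i s) x)) (at x within K s)"
    unfolding has_derivative_componentwise_within[of v]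
    by (auto simp: Basis_vec_def inner_axis d)
  then have "v differentiable at x within K s" by (auto simp: differentiable_def)
  then have A: "(v has_derivative frechet_derivative v (at x within K s)) (at x within K s)"
    unfolding frechet_derivative_works .
  have "frechet_derivative v (at x within K s) h $ i = Dir h (V v k i s) x" for h i
  proof -
    have "((\<lambda>x. v x $ i) has_derivative (\<lambda>h. frechet_derivative v (at x within K s) h $ i)) (at x within K s)"
      using bounded_linear.has_derivative[OF bounded_linear_vec_nth A] .
    from tri_deriv_unique[OF K_ccw[of s] piece(1)[OF L1_comp[OF v] s] _ _ this[unfolded K_def]] show ?thesis
      using x piece(2)[OF L1_comp[OF v] s] unfolding K_def Dir_def by blast
  qed
  then show ?thesis unfolding divergence_def sum_2 div_piece_def by (simp add: Dir_def) (simp add: axis_def)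
qed

text \<open>Both pieces restrict to the same polynomial on the spoke, so only derivatives across the
  spoke can jump.\<close>

lemma spoke_Dir:
  assumes q: "q \<in> CP k" and s: "s < 6" "Suc s < 6"
  shows "Dir (p (Suc s) - z 0) (piece_poly q k s) (p (Suc s)) = Dir (p (Suc s) - z 0) (piece_poly q k (Suc s)) (p (Suc s))"
proof -
  note f = piece[OF q s(1)] and g = piece[OF q s(2)]
  obtain P where P: "\<And>t. piece_poly q k s (spoke (Suc s) t) = poly P t" using pol_linepath[OF f(1)] by blast
  obtain Q where Q: "\<And>t. piece_poly q k (Suc s) (spoke (Suc s) t) = poly Q t" using pol_linepath[OF g(1)] by blast
  have "P = Q"
  proof (rule poly_eq_half_open)
    fix t :: real assume "t \<in> {0<..<1}"
    then have t: "t \<in> {0..1}" by simp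
    show "poly P t = poly Q t"
      using f(2)[OF seg_K(2)[OF t]] g(2)[OF seg_K(1)[OF t]] P[of t] Q[of t] by simp
  qed
  then show ?thesis using Dir_line[OF f(1) P, of 1] Dir_line[OF g(1) Q, of 1] by (simp add: linepath_1')
qed

lemma edge_Dir:
  assumes f: "f \<in> pol k" and z: "\<And>t. t \<in> {0..1} \<Longrightarrow> f (linepath a b t) = 0"
  shows "Dir (b - a) f (linepath a b t) = 0"
proof -
  obtain P where P: "\<And>t. f (linepath a b t) = poly P t" using pol_linepath[OF f] by blast
  then have "P = 0" using z by (intro poly_zero_on_unit) simp
  then show ?thesis using Dir_line[OF f P, of t] by simp
qed

text \<open>Transversality of spoke and outer edge: derivatives in these two directions determine
  the gradient.\<close>

lemma spoke_edge_cross: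
  assumes "even s" shows "cross (p (Suc s) - z 0) (p (s + 2) - p s) \<noteq> 0"
proof -
  obtain t where t: "0 < t" "t < 1" "p (Suc s) = (1 - t) *\<^sub>R p s + t *\<^sub>R p (s + 2)" by (rule mid[OF assms])
  have "cross (p s - z 0) (p (Suc s) - z 0) = - t * cross (p (s + 2) - p s) (p s - z 0)"
    unfolding mid_diff(3)[OF t(3)] by (simp add: cross_def algebra_simps)
  moreover have "cross (p (Suc s) - z 0) (p (s + 2) - p s) = - cross (p (s + 2) - p s) (p s - z 0)"
    unfolding mid_diff(3)[OF t(3)] by (simp add: cross_def algebra_simps)
  ultimately show ?thesis using K_ccw[of s] by (auto simp: ccw_cross)
qed

lemma edge_Dir_K:
  assumes q: "q \<in> CP k" and s: "even s" "s < 6"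
    and z: "\<And>t. t \<in> {0..1} \<Longrightarrow> q (rim s t) = 0"
      "\<And>t. t \<in> {0..1} \<Longrightarrow> q (rim (Suc s) t) = 0"
  shows "Dir (p (s + 2) - p s) (piece_poly q k s) (p (Suc s)) = 0" "Dir (p (s + 2) - p s) (piece_poly q k (Suc s)) (p (Suc s)) = 0"
proof -
  have e2: "Suc (Suc s) = s + 2" by simp
  have s1: "Suc s < 6" using s by presburger
  obtain t where t: "0 < t" "t < 1" "p (Suc s) = (1 - t) *\<^sub>R p s + t *\<^sub>R p (s + 2)" by (rule mid[OF s(1)])
  have "Dir (p (Suc s) - p s) (piece_poly q k s) (rim s 1) = 0"
    using piece(2)[OF q s(2) seg_K(3)] z(1) by (intro edge_Dir[OF piece(1)[OF q s(2)]]) simp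
  then show "Dir (p (s + 2) - p s) (piece_poly q k s) (p (Suc s)) = 0"
    using t(1) by (simp add: linepath_1' mid_diff(1)[OF t(3)] Dir_scale)
  have "Dir (p (Suc (Suc s)) - p (Suc s)) (piece_poly q k (Suc s)) (rim (Suc s) 0) = 0"
    using piece(2)[OF q s1 seg_K(3)] z(2) by (intro edge_Dir[OF piece(1)[OF q s1]]) simp
  then show "Dir (p (s + 2) - p s) (piece_poly q k (Suc s)) (p (Suc s)) = 0"
    using t(2) unfolding e2 by (simp add: linepath_0' mid_diff(2)[OF t(3)] Dir_scale)
qed

definition bdry_zero_field :: "(pt \<Rightarrow> pt) \<Rightarrow> bool"
  where "bdry_zero_field v \<longleftrightarrow> (\<forall>i. bdry_zero (\<lambda>x. v x $ i))"

text \<open>The divergence of a field that vanishes on the boundary is continuous at \<open>p (s + 1)\<close>, \<open>s\<close> even: there both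
  pieces have zero derivative along the boundary edge, and equal derivatives along the spoke.\<close>

lemma div_V2:
  assumes v: "v \<in> L1_space (int (Suc k)) z" and b: "bdry_zero_field v"
  defines "w \<equiv> \<lambda>L x. if L \<in> ps_split z \<and> x \<in> L then divergence v L x else 0"
  shows "w \<in> V2_space (int k) z"
proof -
  have wK: "w (K s) x = (if x \<in> K s then div_piece v (Suc k) s x else 0)" if "s < 6" for s x
    unfolding w_def ps_split_K using div_K[OF v that] that by auto
  have PW: "w \<in> PW k" unfolding PW_iff
  proof (intro conjI allI impI)
    fix s :: nat assume s: "s < 6"
    show "\<exists>f\<in>pol k. \<forall>x\<in>K s. w (K s) x = f x" using div_piece_pol[OF v s] wK[OF s] by (intro bexI[of _ "div_piece v (Suc k) s"]) auto
    show "w (K s) x = 0" if "x \<notin> K s" for x using wK[OF s] that by simp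
  qed (auto simp: w_def ps_split_K fun_eq_iff)
  have jump: "w (K s) (p (Suc s)) = w (K (Suc s)) (p (Suc s))" if s: "even s" "s < 6" for s
  proof -
    have s1: "Suc s < 6" using s by presburger
    let ?b = "p (Suc s)" let ?S = "?b - z 0" let ?E = "p (s + 2) - p s"
    have g: "pd j (V v (Suc k) i s) ?b = pd j (V v (Suc k) i (Suc s)) ?b" for i j
    proof -
      let ?q = "\<lambda>x. v x $ i"
      have q: "?q \<in> CP (Suc k)" by (rule L1_comp[OF v])
      have z: "?q (rim u t) = 0" if "u < 6" "t \<in> {0..1}" for u t
        using b that unfolding bdry_zero_field_def bdry_zero_def by blast
      let ?a = "\<lambda>j. pd j (piece_poly ?q (Suc k) s) ?b - pd j (piece_poly ?q (Suc k) (Suc s)) ?b"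
      have "?a 1 * ?S $ 1 + ?a 2 * ?S $ 2 = 0"
        using spoke_Dir[OF q s(2) s1] by (simp add: Dir_def algebra_simps)
      moreover have "?a 1 * ?E $ 1 + ?a 2 * ?E $ 2 = 0"
        using edge_Dir_K[OF q s z[OF s(2)] z[OF s1]] by (simp add: Dir_def algebra_simps)
      ultimately have "?a 1 = 0" "?a 2 = 0" using two_forms_zero[OF spoke_edge_cross[OF s(1)]] by blast+
      then show ?thesis using exhaust_2[of j] by auto
    qed
    show ?thesis using wK[OF s(2), of ?b] wK[OF s1, of ?b] K_p(3)[of s] K_p(2)[of "Suc s"] g by (simp add: div_piece_def)
  qed
  have "(\<Sum>s<6. integral (K s) (w (K s))) = 0"
  proof -
    have "integral (K s) (w (K s)) = integral (K s) (pd 1 (V v (Suc k) 1 s)) + integral (K s) (pd 2 (V v (Suc k) 2 s))" if s: "s < 6" for s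
    proof -
      have i: "pd i (V v (Suc k) i s) integrable_on K s" for i
        by (rule integrable_on_compact[OF K_compact pol_continuous[OF pd_pol[OF piece(1)[OF L1_comp[OF v] s]]]])
      have "integral (K s) (w (K s)) = integral (K s) (\<lambda>x. pd 1 (V v (Suc k) 1 s) x + pd 2 (V v (Suc k) 2 s) x)"
        by (rule integral_cong) (simp add: wK[OF s] div_piece_def)
      also have "\<dots> = integral (K s) (pd 1 (V v (Suc k) 1 s)) + integral (K s) (pd 2 (V v (Suc k) 2 s))"
        by (rule Henstock_Kurzweil_Integration.integral_add[OF i i])
      finally show ?thesis .
    qed
    then have "(\<Sum>s<6. integral (K s) (w (K s))) = (\<Sum>s<6. integral (K s) (pd 1 (V v (Suc k) 1 s))) + (\<Sum>s<6. integral (K s) (pd 2 (V v (Suc k) 2 s)))"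
      by (simp add: sum.distrib)
    also have "\<dots> = 0"
      using integral_pd_zero[OF L1_comp[OF v] _ piece[OF L1_comp[OF v]]] b unfolding bdry_zero_field_def by simp
    finally show ?thesis .
  qed
  then show ?thesis unfolding V2_space_def sum_split using PW jump[of 0] jump[of 2] jump[of 4]
    by (subst jumps_K) simp
qed

text \<open>The square of the divergence integrates to 0 on each piece. Its polynomial then vanishes
  on a set with interior points and hence on the whole plane, as required for the construction of a
  polynomial potential.\<close>

lemma div_zero_of_moments:
  assumes v: "v \<in> L1_space (int (Suc k)) z" and b: "bdry_zero_field v"
    and g: "\<And>w. w \<in> V2_space (int k) z \<Longrightarrow> (\<Sum>s<6. integral (K s) (\<lambda>x. divergence v (K s) x * w (K s) x)) = 0"
    and s: "s < 6"
  shows "div_piece v (Suc k) s x = 0"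
proof -
  define w where "w = (\<lambda>L x. if L \<in> ps_split z \<and> x \<in> L then divergence v L x else 0)"
  have wK: "w (K s) x = div_piece v (Suc k) s x" if "s < 6" "x \<in> K s" for s x
    unfolding w_def ps_split_K using div_K[OF v that] that by auto
  have int: "(\<lambda>x. (div_piece v (Suc k) s x)\<^sup>2) integrable_on K s" if "s < 6" for s
    by (rule integrable_on_compact[OF K_compact]) (intro continuous_intros pol_continuous[OF div_piece_pol[OF v that]])
  have eq: "integral (K s) (\<lambda>x. divergence v (K s) x * w (K s) x) = integral (K s) (\<lambda>x. (div_piece v (Suc k) s x)\<^sup>2)" if "s < 6" for s
    by (rule integral_cong) (simp add: wK[OF that] div_K[OF v that] power2_eq_square)
  have "(\<Sum>s<6. integral (K s) (\<lambda>x. (div_piece v (Suc k) s x)\<^sup>2)) = 0"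
    using g[OF div_V2[OF v b, folded w_def]] eq by simp
  moreover have "integral (K s) (\<lambda>x. (div_piece v (Suc k) s x)\<^sup>2) \<ge> 0" if "s < 6" for s
    using int[OF that] by (intro integral_nonneg) auto
  ultimately have "integral (K s) (\<lambda>x. (div_piece v (Suc k) s x)\<^sup>2) = 0"
    using s sum_nonneg_eq_0_iff[of "{..<6}" "\<lambda>s. integral (K s) (\<lambda>x. (div_piece v (Suc k) s x)\<^sup>2)"] by auto
  then have i: "((\<lambda>x. (div_piece v (Suc k) s x)\<^sup>2) has_integral 0) (K s)" using int[OF s] by (simp add: has_integral_iff)
  have "(div_piece v (Suc k) s x)\<^sup>2 = 0" if "x \<in> K s" for x
    by (rule integral_zero_imp_zero[OF K_convex K_compact K_int _ _ i that])
      (auto intro!: continuous_intros pol_continuous[OF div_piece_pol[OF v s]])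
  then show ?thesis using pol_identity[OF div_piece_pol[OF v s] K_int[of s]] by simp
qed

text \<open>For a finite union the limit can be checked piece by piece. A piece that does not
  contain \<open>x\<close> is closed and stays away from \<open>x\<close>, so its limit condition is
  vacuous.\<close>

lemma has_derivative_Union_K:
  assumes "\<And>s. s < 6 \<Longrightarrow> x \<in> K s \<Longrightarrow> (q has_derivative A) (at x within K s)" "x \<in> tri z"
  shows "(q has_derivative A) (at x within tri z)"
proof -
  have "bounded_linear A"
    using assms unfolding tri_Union by (auto dest: has_derivative_bounded_linear)
  moreover have *: "((\<lambda>y. (1 / norm (y - x)) *\<^sub>R (q y - (q x + A (y - x)))) \<longlongrightarrow> 0) (at x within K s)" if "s < 6" for s
  proof (cases "x \<in> K s")
    case True
    then show ?thesis using assms(1)[OF that] unfolding has_derivative_within by blast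
  next
    case False
    then have "at x within K s = bot"
      using K_closed[of s] by (simp add: at_within_eq_bot_iff)
    then show ?thesis by simp
  qed
  have "((\<lambda>y. (1 / norm (y - x)) *\<^sub>R (q y - (q x + A (y - x)))) \<longlongrightarrow> 0) (at x within (\<Union>s\<in>I. K s))"
    if "finite I" "I \<subseteq> {..<6}" for I
    using that by (induction I rule: finite_induct) (auto simp: Lim_within_Un *)
  from this[of "{..<6}"] have "((\<lambda>y. (1 / norm (y - x)) *\<^sub>R (q y - (q x + A (y - x)))) \<longlongrightarrow> 0) (at x within (\<Union>s\<in>{..<6}. K s))"
    by simp
  ultimately show ?thesis unfolding has_derivative_within tri_Union by simp
qed

text \<open>The potentials of the six pieces are normalised to a common value at \<open>z 0\<close>.
  Their derivatives along a spoke are given by the single-valued \<open>v\<close>, so neighbours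
  agree on the whole spoke. On the boundary \<open>v\<close> is 0, which makes the glued function
  constant there.\<close>

lemma potential:
  assumes v: "v \<in> L1_space (int k) z" and b: "bdry_zero_field v" and d: "\<And>s x. s < 6 \<Longrightarrow> div_piece v k s x = 0"
  shows "\<exists>q\<in>S0_space (int (Suc k)) z. \<forall>x\<in>tri z. rot q (tri z) x = v x"
proof -
  have "\<exists>q\<in>pol (Suc k). pd 2 q = V v k 1 s \<and> pd 1 q = (\<lambda>x. - V v k 2 s x)" if "s < 6" for s
    by (rule pol_potential[OF piece(1)[OF L1_comp[OF v] that] piece(1)[OF L1_comp[OF v] that]])
      (use d[OF that] in \<open>simp add: div_piece_def\<close>)
  then have "\<forall>s. \<exists>q. s < 6 \<longrightarrow> q \<in> pol (Suc k) \<and> pd 2 q = V v k 1 s \<and> pd 1 q = (\<lambda>x. - V v k 2 s x)" by blast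
  from choice[OF this] obtain Q0 where Q0: "\<And>s. s < 6 \<Longrightarrow> Q0 s \<in> pol (Suc k)" "\<And>s. s < 6 \<Longrightarrow> pd 2 (Q0 s) = V v k 1 s"
    "\<And>s. s < 6 \<Longrightarrow> pd 1 (Q0 s) = (\<lambda>x. - V v k 2 s x)" by blast
  \<comment> \<open>All potentials \<open>Q s\<close> get the value \<open>- c\<close> at
    \<open>z 0\<close>; this \<open>c\<close> makes \<open>Q 0\<close> vanish at \<open>p 0\<close>,
    from where the zero spreads around the boundary.\<close>
  define c where "c = Q0 0 (p 0) - Q0 0 (z 0)"
  define Q where "Q = (\<lambda>s x. Q0 s x - (Q0 s (z 0) + c))"
  have Q: "Q s \<in> pol (Suc k)" "pd 2 (Q s) = V v k 1 s" "pd 1 (Q s) = (\<lambda>x. - V v k 2 s x)" if "s < 6" for s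
  proof -
    have cst: "(\<lambda>x. C) \<in> pol 0" for C by (rule bp_const)
    have "pd i (\<lambda>x. C) = (\<lambda>x. 0)" for i C
    proof
      fix x show "pd i (\<lambda>x. C) x = 0"
        using pd_pol[OF cst] pdI[of "\<lambda>x. C" 0 0 x] exhaust_2[of i] by auto
    qed
    then show "Q s \<in> pol (Suc k)" "pd 2 (Q s) = V v k 1 s" "pd 1 (Q s) = (\<lambda>x. - V v k 2 s x)"
      unfolding Q_def using Q0[OF that] pd_diff[OF Q0(1)[OF that] cst] by (auto intro: bp_diff bp_const)
  qed
  have QDir: "Dir h (Q s) x = v x $ 1 * h $ 2 - v x $ 2 * h $ 1" if "s < 6" "x \<in> K s" for s x h
    using piece(2)[OF L1_comp[OF v] that, of 1] piece(2)[OF L1_comp[OF v] that, of 2] Q(2,3)[OF that(1)]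
    by (simp add: Dir_def)
  have A: "Q s (spoke (Suc s) t) = Q (Suc s mod 6) (spoke (Suc s) t)" if s: "s < 6" for s t
  proof -
    have s': "Suc s mod 6 < 6" by simp
    obtain P where P: "\<And>t. Q s (spoke (Suc s) t) = poly P t" using pol_linepath[OF Q(1)[OF s]] by blast
    obtain R where R: "\<And>t. Q (Suc s mod 6) (spoke (Suc s) t) = poly R t" using pol_linepath[OF Q(1)[OF s']] by blast
    have "pderiv P = pderiv R"
    proof (rule poly_eq_half_open)
      fix t :: real assume "t \<in> {0<..<1}"
      then have t: "t \<in> {0..1}" by simp
      have "spoke (Suc s) t \<in> K (Suc s mod 6)" using seg_K(1)[OF t, of "Suc s"] K_mod by simp
      then show "poly (pderiv P) t = poly (pderiv R) t"
        using Dir_line[OF Q(1)[OF s] P] Dir_line[OF Q(1)[OF s'] R] QDir[OF s seg_K(2)[OF t]] QDir[OF s'] by simp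
    qed
    then have "pderiv (P - R) = 0" by (simp add: pderiv_diff)
    then obtain c where "P - R = [:c:]" using pderiv_iszero by blast
    moreover have "poly (P - R) 0 = 0" using P[of 0] R[of 0] by (simp add: linepath_0' Q_def)
    ultimately have "P - R = 0" by simp
    then show ?thesis unfolding P R by simp
  qed
  define q where "q = glued Q"
  have qK: "q x = Q s x" if "s < 6" "x \<in> K s" for s x unfolding q_def by (rule glued_eq[OF A that])
  have qC: "q \<in> CP (Suc k)" unfolding q_def by (rule glued_CP[OF A Q(1)])
  have qd: "(q has_derivative (\<lambda>h. v x $ 1 * h $ 2 - v x $ 2 * h $ 1)) (at x within tri z)" if x: "x \<in> tri z" for x
  proof (rule has_derivative_Union_K[OF _ x])
    fix s assume s: "s < 6" "x \<in> K s"
    have "(q has_derivative (\<lambda>h. Dir h (Q s) x)) (at x within K s)"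
      by (rule has_derivative_transform[OF s(2) qK[OF s(1)] has_derivative_at_withinI[OF Dir_deriv[OF Q(1)[OF s(1)]]]])
    then show "(q has_derivative (\<lambda>h. v x $ 1 * h $ 2 - v x $ 2 * h $ 1)) (at x within K s)"
      unfolding QDir[OF s] .
  qed
  have qD: "q differentiable_on tri z" unfolding differentiable_on_def differentiable_def using qd by blast
  have qr: "rot q (tri z) x = v x" if x: "x \<in> tri z" for x
  proof -
    obtain s where s: "s < 6" "x \<in> K s" using x unfolding tri_Union by auto
    have "rot q (tri z) x = vector [pd 2 (Q s) x, - pd 1 (Q s) x]"
      by (rule rot_K[OF qD s(1) Q(1)[OF s(1)] qK[OF s(1)] s(2)])
    then show ?thesis unfolding Q(2,3)[OF s(1)]
      using piece(2)[OF L1_comp[OF v] s, of 1] piece(2)[OF L1_comp[OF v] s, of 2] by (simp add: vec_eq_iff forall_2)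
  qed
  have vz: "v x = 0" if "x \<in> frontier (tri z)" for x
    using b that unfolding bdry_zero_field_def bdry_zero_iff by (auto simp: vec_eq_iff)
  have edge: "q (rim s t) = q (p s)" if s: "s < 6" and t: "t \<in> {0..1}" for s t
  proof -
    obtain P where P: "\<And>t. Q s (rim s t) = poly P t" using pol_linepath[OF Q(1)[OF s]] by blast
    have "pderiv P = 0"
    proof (rule poly_zero_on_unit)
      fix t :: real assume t: "t \<in> {0..1}"
      have "v (rim s t) = 0" 
        by (rule vz) (unfold frontier_tri linepath_image_01[symmetric], use s t in blast)
      then show "poly (pderiv P) t = 0" using Dir_line[OF Q(1)[OF s] P, of t] QDir[OF s seg_K(3)[OF t]] by simp
    qed
    then obtain C where "P = [:C:]" using pderiv_iszero by blast
    then show ?thesis using P[of t] P[of 0] qK[OF s seg_K(3)[OF t]] qK[OF s K_p(2)] by (simp add: linepath_0')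
  qed
  have q0: "q (p s) = 0" if "s \<le> 5" for s
    using that
  proof (induction s)
    case 0
    then show ?case using qK[of 0 "p 0"] K_p(2) by (simp add: Q_def c_def)
  next
    case (Suc s)
    then show ?case using edge[of s 1] by (simp add: linepath_1')
  qed
  have "bdry_zero q" unfolding bdry_zero_def using edge q0 by simp
  then have "\<forall>x\<in>frontier (tri z). q x = 0" unfolding bdry_zero_iff .
  moreover have "\<forall>x\<in>frontier (tri z). rot q (tri z) x = 0"
    using qr vz tri_closed frontier_subset_closed by (metis subsetD)
  moreover have "continuous_on (tri z) (rot q (tri z))"
  proof -
    have "continuous_on (tri z) v" by (rule L1_continuous[OF v])
    then show ?thesis using qr by (simp cong: continuous_on_cong)
  qed
  ultimately have "q \<in> S0_space (int (Suc k)) z" unfolding S0_space_def using qC qD by blast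
  then show ?thesis using qr by blast
qed

text \<open>\<open>frechet_derivative\<close> is an actual derivative only of differentiable
  functions, so linearity of \<open>rot\<close> is confined to the space; it is verified on the
  polynomial of each piece.\<close>

lemma subspace_S0_lin:
  "subspace (S0_space (int k) z)"
  "lin_on (S0_space (int k) z) (\<lambda>q x. if x \<in> tri z then rot q (tri z) x else 0)"
proof -
  have D: "q differentiable_on tri z" if "q \<in> S0_space (int k) z" for q using that by (simp add: S0_space_def)
  have ra: "rot (q + q') (tri z) x = rot q (tri z) x + rot q' (tri z) x"
    if q: "q \<in> CP k" "q' \<in> CP k" "q differentiable_on tri z" "q' differentiable_on tri z" and x: "x \<in> tri z" for q q' x
  proof -
    obtain s where s: "s < 6" "x \<in> K s" using x unfolding tri_Union by auto
    note f = piece[OF q(1) s(1)] and g = piece[OF q(2) s(1)]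
    have "(\<lambda>x. q x + q' x) differentiable_on tri z"
      using q(3,4) unfolding differentiable_on_def by (auto intro: derivative_intros)
    then have "(q + q') differentiable_on tri z" by (simp add: plus_fun_def)
    then have "rot (q + q') (tri z) x = vector [pd 2 (\<lambda>x. piece_poly q k s x + piece_poly q' k s x) x, - pd 1 (\<lambda>x. piece_poly q k s x + piece_poly q' k s x) x]"
      by (rule rot_K[OF _ s(1) bp_add[OF f(1) g(1)] _ s(2)]) (simp add: f(2) g(2))
    then show ?thesis using rot_K[OF q(3) s(1) f s(2)] rot_K[OF q(4) s(1) g s(2)]
      by (simp add: pd_add[OF f(1) g(1)] vec_eq_iff forall_2)
  qed
  have rs: "rot (c *\<^sub>R q) (tri z) x = c *\<^sub>R rot q (tri z) x"
    if q: "q \<in> CP k" "q differentiable_on tri z" and x: "x \<in> tri z" for q c x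
  proof -
    obtain s where s: "s < 6" "x \<in> K s" using x unfolding tri_Union by auto
    note f = piece[OF q(1) s(1)]
    have "(\<lambda>x. c * q x) differentiable_on tri z"
      using q(2) unfolding differentiable_on_def by (auto intro: derivative_intros)
    then have "(c *\<^sub>R q) differentiable_on tri z" by (simp add: scaleR_fun_def)
    then have "rot (c *\<^sub>R q) (tri z) x = vector [pd 2 (\<lambda>x. c * piece_poly q k s x) x, - pd 1 (\<lambda>x. c * piece_poly q k s x) x]"
      by (rule rot_K[OF _ s(1) bp_scale[OF f(1)] _ s(2)]) (simp add: f(2))
    then show ?thesis using rot_K[OF q(2) s(1) f s(2)]
      by (simp add: pd_scale[OF f(1)] vec_eq_iff forall_2)
  qed
  have fT: "x \<in> tri z" if "x \<in> frontier (tri z)" for x using that tri_closed frontier_subset_closed by blast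
  show "lin_on (S0_space (int k) z) (\<lambda>q x. if x \<in> tri z then rot q (tri z) x else 0)"
    by (rule lin_onI) (auto simp: fun_eq_iff ra rs S0_CP D)
  show "subspace (S0_space (int k) z)"
  proof (rule subspaceI)
    have 0: "rot 0 (tri z) x = 0" if "x \<in> tri z" for x
      using rs[of 0 x 0] that subspace_0[OF subspace_CP] by (simp add: differentiable_on_def zero_fun_def)
    show "0 \<in> S0_space (int k) z" unfolding S0_space_def
      using subspace_0[OF subspace_CP] 0 fT
      by (auto simp: differentiable_on_def zero_fun_def cong: continuous_on_cong)
    show "x + y \<in> S0_space (int k) z" if xy: "x \<in> S0_space (int k) z" "y \<in> S0_space (int k) z" for x y
    proof -
      have "(\<lambda>w. x w + y w) differentiable_on tri z"
        using D[OF xy(1)] D[OF xy(2)] unfolding differentiable_on_def by (auto intro: derivative_intros)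
      moreover have "continuous_on (tri z) (rot (x + y) (tri z))"
      proof -
        have "continuous_on (tri z) (\<lambda>w. rot x (tri z) w + rot y (tri z) w)"
          using xy by (intro continuous_intros) (auto simp: S0_space_def)
        then show ?thesis using ra[OF S0_CP[OF xy(1)] S0_CP[OF xy(2)] D[OF xy(1)] D[OF xy(2)]]
          by (subst continuous_on_cong[OF refl]) auto
      qed
      ultimately show ?thesis
        using xy subspace_add[OF subspace_CP S0_CP[OF xy(1)] S0_CP[OF xy(2)]] fT
          ra[OF S0_CP[OF xy(1)] S0_CP[OF xy(2)] D[OF xy(1)] D[OF xy(2)]]
        unfolding S0_space_def by (simp add: plus_fun_def)
    qed
    show "c *\<^sub>R x \<in> S0_space (int k) z" if xx: "x \<in> S0_space (int k) z" for c x
    proof -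
      have "(\<lambda>w. c * x w) differentiable_on tri z"
        using D[OF xx] unfolding differentiable_on_def by (auto intro: derivative_intros)
      moreover have "continuous_on (tri z) (rot (c *\<^sub>R x) (tri z))"
      proof -
        have "continuous_on (tri z) (\<lambda>w. c *\<^sub>R rot x (tri z) w)"
          using xx by (intro continuous_intros) (auto simp: S0_space_def)
        then show ?thesis using rs[OF S0_CP[OF xx] D[OF xx]]
          by (subst continuous_on_cong[OF refl]) auto
      qed
      ultimately show ?thesis
        using xx subspace_scale[OF subspace_CP S0_CP[OF xx]] fT rs[OF S0_CP[OF xx] D[OF xx]]
        unfolding S0_space_def by (simp add: scaleR_fun_def)
    qed
  qed
qed

text \<open>The chosen representing polynomials add up because a polynomial is determined by its
  values on a piece, not because of the choice.\<close>

lemma divergence_add: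
  assumes "v \<in> L1_space (int k) z" "v' \<in> L1_space (int k) z" "v + v' \<in> L1_space (int k) z" "s < 6" "x \<in> K s"
  shows "divergence (v + v') (K s) x = divergence v (K s) x + divergence v' (K s) x"
proof -
  have "V (v + v') k i s y = V v k i s y + V v' k i s y" for i y
  proof -
    note a = piece[OF L1_comp[OF assms(1), of i] assms(4)] and b = piece[OF L1_comp[OF assms(2), of i] assms(4)]
      and c = piece[OF L1_comp[OF assms(3), of i] assms(4)]
    have "V (v + v') k i s y - (V v k i s y + V v' k i s y) = 0"
    proof (rule pol_identity[OF bp_diff[OF c(1) bp_add[OF a(1) b(1)]] K_int[of s]])
      fix y assume y: "y \<in> K s"
      show "V (v + v') k i s y - (V v k i s y + V v' k i s y) = 0"
        using a(2)[OF y] b(2)[OF y] c(2)[OF y] by simp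
    qed
    then show ?thesis by simp
  qed
  then have "V (v + v') k i s = (\<lambda>y. V v k i s y + V v' k i s y)" for i by blast
  then show ?thesis unfolding div_K[OF assms(1,4,5)] div_K[OF assms(2,4,5)] div_K[OF assms(3,4,5)] div_piece_def
    by (simp add: pd_add[OF piece(1)[OF L1_comp[OF assms(1)] assms(4)] piece(1)[OF L1_comp[OF assms(2)] assms(4)]])
qed

lemma divergence_scaleR:
  assumes "v \<in> L1_space (int k) z" "c *\<^sub>R v \<in> L1_space (int k) z" "s < 6" "x \<in> K s"
  shows "divergence (c *\<^sub>R v) (K s) x = c * divergence v (K s) x"
proof -
  have "V (c *\<^sub>R v) k i s y = c * V v k i s y" for i y
  proof -
    note a = piece[OF L1_comp[OF assms(1), of i] assms(3)] and b = piece[OF L1_comp[OF assms(2), of i] assms(3)]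
    have "V (c *\<^sub>R v) k i s y - c * V v k i s y = 0"
    proof (rule pol_identity[OF bp_diff[OF b(1) bp_scale[OF a(1)]] K_int[of s]])
      fix y assume y: "y \<in> K s"
      show "V (c *\<^sub>R v) k i s y - c * V v k i s y = 0"
        using a(2)[OF y] b(2)[OF y] by simp
    qed
    then show ?thesis by simp
  qed
  then have "V (c *\<^sub>R v) k i s = (\<lambda>y. c * V v k i s y)" for i by blast
  then show ?thesis unfolding div_K[OF assms(1,3,4)] div_K[OF assms(2,3,4)] div_piece_def
    by (simp add: pd_scale[OF piece(1)[OF L1_comp[OF assms(1)] assms(3)]] distrib_left)
qed

text \<open>On the fields vanishing on the boundary, the divergence maps into \<open>V2_space\<close> and its kernel consists of the
  rotations of \<open>S0_space\<close>.\<close>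

lemma S0_dim_lower: "3 * k * (k - 1) \<le> dim (S0_space (int (k + 2)) z)"
proof -
  let ?r = "Suc k"
  let ?M = "{q \<in> CP ?r. bdry_zero q}"
  let ?L = "{v :: pt \<Rightarrow> pt. \<forall>i. (\<lambda>x. v x $ i) \<in> ?M}"
  let ?W = "V2_space (int k) z"
  note M = bdry_zero_CP_dim[of k]
  note L = dim_componentwise[OF M(3) M(2), where 'n = 2]
  have LL: "v \<in> L1_space (int ?r) z" "bdry_zero_field v" if "v \<in> ?L" for v
    using that by (auto simp: L1_space_def bdry_zero_field_def)
  \<comment> \<open>A finite basis turns orthogonality of the divergence to all of \<open>?W\<close>
    into \<open>dim ?W\<close> conditions.\<close>
  obtain B where B: "B \<subseteq> ?W" "independent B" "finite B" "?W \<subseteq> span B" "card B = dim ?W"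
    by (rule dimle_basis[OF V2_dim(2)])
  let ?l = "\<lambda>w v. \<Sum>s<6. integral (K s) (\<lambda>x. divergence v (K s) x * w (K s) x) :: real"
  have int: "(\<lambda>x. divergence v (K s) x * w (K s) x) integrable_on K s"
    if v: "v \<in> L1_space (int ?r) z" and w: "w \<in> PW k" and s: "s < 6" for v w s
  proof (rule integrable_on_compact[OF K_compact])
    obtain f where f: "f \<in> pol k" "\<forall>x\<in>K s. w (K s) x = f x" using w s unfolding PW_iff by blast
    have "continuous_on (K s) (\<lambda>x. div_piece v ?r s x * f x)"
      by (intro continuous_intros pol_continuous[OF div_piece_pol[OF v s]] pol_continuous[OF f(1)])
    then show "continuous_on (K s) (\<lambda>x. divergence v (K s) x * w (K s) x)"
      using div_K[OF v s] f(2) by (subst continuous_on_cong[OF refl]) auto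
  qed
  have WP: "?W \<subseteq> PW k" by (auto simp: V2_space_def)
  have lin_v: "lin_on ?L (?l w)" if w: "w \<in> PW k" for w
  proof (rule lin_onI)
    fix v v' assume v: "v \<in> ?L" "v' \<in> ?L"
    have vv: "v + v' \<in> ?L" using subspace_add[OF L(3) v] .
    have "integral (K s) (\<lambda>x. divergence (v + v') (K s) x * w (K s) x) =
      integral (K s) (\<lambda>x. divergence v (K s) x * w (K s) x) + integral (K s) (\<lambda>x. divergence v' (K s) x * w (K s) x)" if s: "s < 6" for s
    proof -
      have "integral (K s) (\<lambda>x. divergence (v + v') (K s) x * w (K s) x) =
        integral (K s) (\<lambda>x. divergence v (K s) x * w (K s) x + divergence v' (K s) x * w (K s) x)"
        by (rule integral_cong) (simp add: divergence_add[OF LL(1)[OF v(1)] LL(1)[OF v(2)] LL(1)[OF vv] s] distrib_right)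
      then show ?thesis
        using Henstock_Kurzweil_Integration.integral_add[OF int[OF LL(1)[OF v(1)] w s] int[OF LL(1)[OF v(2)] w s]] by simp
    qed
    then show "?l w (v + v') = ?l w v + ?l w v'" by (simp add: sum.distrib)
  next
    fix c v assume v: "v \<in> ?L"
    have cv: "c *\<^sub>R v \<in> ?L" using subspace_scale[OF L(3) v] .
    have "integral (K s) (\<lambda>x. divergence (c *\<^sub>R v) (K s) x * w (K s) x) = c * integral (K s) (\<lambda>x. divergence v (K s) x * w (K s) x)"
      if s: "s < 6" for s
    proof -
      have "integral (K s) (\<lambda>x. divergence (c *\<^sub>R v) (K s) x * w (K s) x) = integral (K s) (\<lambda>x. c * (divergence v (K s) x * w (K s) x))"
        by (rule integral_cong) (simp add: divergence_scaleR[OF LL(1)[OF v] LL(1)[OF cv] s])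
      then show ?thesis by simp
    qed
    then show "?l w (c *\<^sub>R v) = c *\<^sub>R ?l w v" by (simp add: sum_distrib_left)
  qed
  have lin_w: "lin_on ?W (\<lambda>w. ?l w v)" if v: "v \<in> L1_space (int ?r) z" for v
  proof (rule lin_onI)
    fix w w' assume w: "w \<in> ?W" "w' \<in> ?W"
    have "integral (K s) (\<lambda>x. divergence v (K s) x * (w + w') (K s) x) =
      integral (K s) (\<lambda>x. divergence v (K s) x * w (K s) x) + integral (K s) (\<lambda>x. divergence v (K s) x * w' (K s) x)" if s: "s < 6" for s
      using Henstock_Kurzweil_Integration.integral_add[OF int[OF v _ s] int[OF v _ s], of w w'] w WP by (auto simp: distrib_left)
    then show "?l (w + w') v = ?l w v + ?l w' v" by (simp add: sum.distrib)
  next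
    fix c w
    show "?l (c *\<^sub>R w) v = c *\<^sub>R ?l w v" by (simp add: sum_distrib_left mult.left_commute)
  qed
  have ker: "{v \<in> ?L. \<forall>w\<in>B. ?l w v = 0} \<subseteq> (\<lambda>q x. if x \<in> tri z then rot q (tri z) x else 0) ` S0_space (int (k + 2)) z"
  proof
    fix v assume "v \<in> {v \<in> ?L. \<forall>w\<in>B. ?l w v = 0}"
    then have v: "v \<in> ?L" and l: "\<And>w. w \<in> B \<Longrightarrow> ?l w v = 0" by auto
    have "?l w v = 0" if w: "w \<in> ?W" for w
    proof -
      have "w \<in> span B" using B(4) w by blast
      then obtain c where "w = (\<Sum>b\<in>B. c b *\<^sub>R b)" using span_finite[OF B(3)] by auto
      then have "?l w v = (\<Sum>b\<in>B. c b *\<^sub>R ?l b v)"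
        using lin_on_sum[OF V2_dim(3) lin_w[OF LL(1)[OF v]] B(3), of "\<lambda>b. b" c] B(1) by auto
      then show ?thesis using l by simp
    qed
    then have "div_piece v ?r s x = 0" if "s < 6" for s x
      using div_zero_of_moments[OF LL[OF v] _ that] by blast
    from potential[OF LL[OF v] this] obtain q where q: "q \<in> S0_space (int (Suc ?r)) z" "\<forall>x\<in>tri z. rot q (tri z) x = v x" by blast
    have "v x = 0" if "x \<notin> tri z" for x
      using CP_zero[OF L1_comp[OF LL(1)[OF v]] that] by (simp add: vec_eq_iff)
    then have ve: "v = (\<lambda>x. if x \<in> tri z then rot q (tri z) x else 0)" using q(2) by auto
    have e2: "k + 2 = Suc ?r" by simp
    show "v \<in> (\<lambda>q x. if x \<in> tri z then rot q (tri z) x else 0) ` S0_space (int (k + 2)) z"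
      unfolding e2 by (rule image_eqI[where x = q]) (rule ve, rule q(1))
  qed
  have "dim {v \<in> ?L. \<forall>w\<in>B. ?l w v = 0} \<le> dim (S0_space (int (k + 2)) z)"
    by (rule dim_image_le[OF subspace_S0_lin S0_dim_upper ker])
  moreover have "dimle ?L (card B + dim {v \<in> ?L. \<forall>w\<in>B. ?l w v = 0})"
  proof (rule dimle_functionals[where l = ?l, OF B(3) L(3)])
    show "lin_on ?L (?l w)" if "w \<in> B" for w using lin_v that B(1) WP by blast
    show "dimle {v \<in> ?L. \<forall>w\<in>B. ?l w v = 0} (dim {v \<in> ?L. \<forall>w\<in>B. ?l w v = 0})"
      by (rule dimle_dim[OF dimle_mono[OF L(2) _ order_refl]]) blast
  qed
  from dimle_imp[OF this] have "2 * dim ?M \<le> dim ?W + dim {v \<in> ?L. \<forall>w\<in>B. ?l w v = 0}"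
    unfolding L(1) B(5) by simp
  ultimately have "2 * dim ?M \<le> dim ?W + dim (S0_space (int (k + 2)) z)" by linarith
  moreover have "3 * ?r^2 + 3 * ?r + 1 \<le> 6 * ?r + dim ?M" using M(1) unfolding CP_dim .
  moreover have "dim ?W + 4 = 3 * (k + 1) * (k + 2)" by (rule V2_dim(1))
  \<comment> \<open>With r = k + 1: 2 (3 r^2 - 3 r + 1) - (3 r (r + 1) - 4) = 3 k (k - 1).\<close>
  ultimately show ?thesis by (cases k) (simp_all add: power2_eq_square algebra_simps)
qed

lemma S0_dim: "dim (S0_space (int (k + 2)) z) = 3 * k * (k - 1)"
  using S0_dim_lower dimle_imp[OF S0_dim_upper] by (rule antisym[rotated])

section \<open>Normal components on the edges and injectivity of the degrees of freedom\<close>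

lemma tri_outer_normal:
  assumes "even s" "edge z i = closed_segment (p s) (p (s + 2))"
  shows "outer_normal (tri z) (edge z i) = (1 / norm (p (s + 2) - p s)) *\<^sub>R rot_right (p (s + 2) - p s)"
proof -
  have "ccw (p s) (p (s + 2)) (p (s + 4))"
    using tri_ccw[OF assms(1)] by (simp add: ccw_cross cross_def algebra_simps)
  moreover have "tri z = convex hull {p s, p (s + 2), p (s + 4)}"
  proof -
    have "s mod 6 = 0 \<or> s mod 6 = 2 \<or> s mod 6 = 4" using assms(1) by presburger
    then have "{p s, p (s + 2), p (s + 4)} = {p 4, p 0, p 2}"
      using p_mod[of s 0] p_mod[of s 2] p_mod[of s 4] p_period[of 0] p_period[of 2] by (elim disjE) auto
    then show ?thesis unfolding tri_p by simp
  qed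
  ultimately show ?thesis unfolding assms(2) using outer_normal_ccw by simp
qed

text \<open>For \<open>r = 1\<close> a function that vanishes at both corners is, along the edge,
  its value at the split point times a hat function. Multiplication by this value makes the
  integrand nonnegative whatever its sign, so a zero integral forces it to be 0.\<close>

lemma flux_mid:
  assumes q: "q \<in> CP 1" and s: "even s" "s < 6" and ends: "q (p s) = 0" "q (p (s + 2)) = 0"
    and int: "integral {0..1} (\<lambda>t. q (linepath (p s) (p (s + 2)) t)) = 0"
  shows "q (p (Suc s)) = 0"
proof -
  let ?c = "q (p (Suc s))" let ?l = "linepath (p s) (p (s + 2))"
  have e2: "Suc (Suc s) = s + 2" by simp
  have s1: "Suc s < 6" using s by presburger
  have lin: "q (rim u t) = q (p u) + t * (q (p (Suc u)) - q (p u))" if u: "u < 6" and t: "t \<in> {0..1}" for u t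
  proof -
    note f = piece[OF q u]
    obtain P where P: "degree P \<le> 1" "\<And>t. piece_poly q 1 u (rim u t) = poly P t" using pol_linepath[OF f(1)] by blast
    have "q (rim u t) = poly P t" if "t \<in> {0..1}" for t using f(2)[OF seg_K(3)[OF that]] P(2) by simp
    from this[OF t] this[of 0] this[of 1] show ?thesis using poly_degree_1(1)[OF P(1), of t] by (simp add: linepath_0' linepath_1')
  qed
  have nn: "?c * q x \<ge> 0" if "x \<in> closed_segment (p s) (p (s + 2))" for x
  proof -
    have "x \<in> closed_segment (p s) (p (Suc s)) \<union> closed_segment (p (Suc s)) (p (Suc (Suc s)))"
      using that rim_Un[OF s(1)] unfolding e2 by simp
    then obtain t where t: "t \<in> {0..1}" and "x = rim s t \<or> x = rim (Suc s) t"
      unfolding linepath_image_01[symmetric] by blast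
    then have "q x = t * ?c \<or> q x = (1 - t) * ?c"
      using lin[OF s(2) t] lin[OF s1 t] ends unfolding e2 by (auto simp: algebra_simps)
    then have "?c * q x = t * ?c\<^sup>2 \<or> ?c * q x = (1 - t) * ?c\<^sup>2" by (auto simp: power2_eq_square)
    then show ?thesis using t by auto
  qed
  have seg: "?l t \<in> closed_segment (p s) (p (s + 2))" if "t \<in> {0..1}" for t using that by (rule linepath_in_path)
  have sT: "closed_segment (p s) (p (s + 2)) \<subseteq> tri z"
    using K_p(2)[of s] K_p(2)[of "s + 2"] K_subset tri_convex by (intro closed_segment_subset) auto
  have cont: "continuous_on {0..1} (\<lambda>t. ?c * q (?l t))"
    by (intro continuous_intros continuous_on_compose2[OF CP_continuous[OF q] continuous_on_linepath])
      (use seg sT in blast)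
  have "integral {0..1} (\<lambda>t. ?c * q (?l t)) = 0" using int by simp
  then have z: "?c * q (?l t) = 0" if "t \<in> {0..1}" for t
    using integral_eq_0_iff[OF cont] nn[OF seg] that by auto
  obtain t where t: "0 < t" "t < 1" "p (Suc s) = (1 - t) *\<^sub>R p s + t *\<^sub>R p (s + 2)" by (rule mid[OF s(1)])
  then have "?l t = p (Suc s)" by (simp add: linepath_def)
  then show ?thesis using z[of t] t(1,2) by simp
qed

lemma unisolvence:
  assumes v: "v \<in> L1_space (int r) z" and r: "r \<ge> 1"
    and a: "\<And>i. i \<in> {1..3} \<Longrightarrow> v (z i) = 0"
    and b: "\<And>i. r = 1 \<Longrightarrow> i \<in> {1..3} \<Longrightarrow> segment_integral (z (nx i)) (z (nx (nx i)))
        (\<lambda>x. v x \<bullet> outer_normal (tri z) (edge z i)) = 0"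
    and c: "\<And>i. i \<in> {1..3} \<Longrightarrow> jump z (divergence v) i = 0"
    and d: "\<And>i. r \<ge> 2 \<Longrightarrow> i \<in> {1..3} \<Longrightarrow> v (z (3 + i)) \<bullet> outer_normal (tri z) (edge z i) = 0"
    and e: "\<And>a b w. (a, b) \<in> bdry_edges z \<Longrightarrow> w \<in> vpoly_on (int r - 2) (closed_segment a b) \<Longrightarrow>
        segment_integral a b (\<lambda>x. v x \<bullet> w x) = 0"
    and f: "\<And>w. w \<in> S0_space (int r + 1) z \<Longrightarrow> integral (tri z) (\<lambda>x. v x \<bullet> rot w (tri z) x) = 0"
    and g: "\<And>w. w \<in> V2_space (int r - 1) z \<Longrightarrow> (\<Sum>K\<in>ps_split z. integral K (\<lambda>x. divergence v K x * w K x)) = 0"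
  shows "v = 0"
proof -
  define k where "k = r - 1"
  have rk: "r = Suc k" using r by (simp add: k_def)
  have corner: "v (p s) = 0" if ev: "even s" for s
  proof -
    obtain i where i: "i \<in> {1..3}" "p s = z (nx i)" by (rule even_cases[OF ev])
    have "nx i \<in> {1..3}" unfolding nx_def using i(1) by auto
    then show ?thesis using a i(2) by simp
  qed
  have mom: "integral {0..1} (\<lambda>t. (v (rim u t) \<bullet> h) * t ^ j) = 0"
    if u: "u < 6" and j: "j + 2 \<le> r" for u j h
  proof -
    let ?a = "p u" let ?b = "p (Suc u)" let ?S = "closed_segment ?a ?b"
    \<comment> \<open>On the edge this test function is \<open>t ^ j\<close> times the fixed vector
      \<open>h\<close>; \<open>h\<close> is later the normal direction and then a unit coordinate
      vector.\<close>
    let ?w = "\<lambda>x. if x \<in> ?S then (seg_coord ?a ?b x ^ j) *\<^sub>R h else 0"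
    have rr: "int r - 2 = int (r - 2)" using j by simp
    have "(\<lambda>x. h $ i * seg_coord ?a ?b x ^ j) \<in> pol (r - 2)" for i
      using bp_monoD[OF bp_scale[OF bp_power[OF seg_coord_pol, of ?a ?b j]], of "r - 2"] j by simp
    then have "?w \<in> vpoly_on (int r - 2) ?S"
      unfolding vpoly_on_def rr poly_on_iff by (auto intro!: bexI[of _ "\<lambda>x. h $ _ * seg_coord ?a ?b x ^ j"] simp: mult.commute)
    then have "segment_integral ?a ?b (\<lambda>x. v x \<bullet> ?w x) = 0"
      by (rule e[rotated]) (use u in \<open>auto simp: bdry_edges_p\<close>)
    then have "integral {0..1} (\<lambda>t. v (linepath ?a ?b t) \<bullet> ?w (linepath ?a ?b t)) = 0"
      using p_ne(1)[of u] by (simp add: segment_integral_def)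
    moreover have "integral {0..1} (\<lambda>t. v (linepath ?a ?b t) \<bullet> ?w (linepath ?a ?b t)) = integral {0..1} (\<lambda>t. (v (linepath ?a ?b t) \<bullet> h) * t ^ j)"
      by (rule integral_cong) (simp add: linepath_in_path seg_coord_linepath[OF p_ne(1)])
    ultimately show ?thesis by simp
  qed
  have edge_v: "v (rim s t) = 0 \<and> v (rim (Suc s) t) = 0"
    if s: "even s" "s < 6" and t: "t \<in> {0..1}" for s t
  proof -
    have e2: "Suc (Suc s) = s + 2" by simp
    have s1: "Suc s < 6" using s by presburger
    obtain i where i: "i \<in> {1..3}" "p s = z (nx i)" "p (Suc s) = z (3 + i)" "p (s + 2) = z (nx (nx i))"
      by (rule even_cases[OF s(1)])
    define E where "E = p (s + 2) - p s"
    let ?b = "p (Suc s)" let ?S = "?b - z 0"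
    have E0: "E \<noteq> 0" unfolding E_def using tri_ccw[OF s(1)] by (auto simp: cross_def)
    have edge: "edge z i = closed_segment (p s) (p (s + 2))" by (simp add: edge_def i)
    note N = tri_outer_normal[OF s(1) edge, folded E_def]
    \<comment> \<open>The normal component of \<open>v\<close>, scaled by the length of the edge,
      which keeps it free of division.\<close>
    let ?q = "\<lambda>x. v x \<bullet> rot_right E"
    have q: "?q \<in> CP r" by (rule L1_inner[OF v])
    have ends: "?q (p s) = 0" "?q (p (s + 2)) = 0" using corner[of s] corner[of "s + 2"] s by simp_all
    have mid0: "?q ?b = 0"
    proof (cases "r = 1")
      case True
      have "norm E * integral {0..1} (\<lambda>t. (v (linepath (p s) (p (s + 2)) t) \<bullet> rot_right E) / norm E) = 0"
        using b[OF True i(1)] unfolding N i(2,4)[symmetric] segment_integral_def by (simp add: dist_norm norm_minus_commute E_def)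
      then have "integral {0..1} (\<lambda>t. ?q (linepath (p s) (p (s + 2)) t)) = 0" using E0 by simp
      then show ?thesis using flux_mid[OF _ s ends] q True by simp
    next
      case False
      then have "v ?b \<bullet> outer_normal (tri z) (edge z i) = 0" using d[OF _ i(1)] r i(3) by simp
      then show ?thesis unfolding N using E0 by simp
    qed
    \<comment> \<open>The normal component is treated first: its value at the split point is 0,
      which is the first alternative in the joining hypothesis of \<open>edge_zero\<close>.\<close>
    have Zq: "?q (rim s t) = 0" "?q (rim (Suc s) t) = 0" if "t \<in> {0..1}" for t
      using edge_zero[OF q s(2,1) mom ends piece[OF q s(2)] piece[OF q s1] _ that] mid0 by blast+
    have Fq: "Dir h (piece_poly ?q r u) x = E $ 2 * Dir h (V v r 1 u) x - E $ 1 * Dir h (V v r 2 u) x" if u: "u < 6" for h u x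
    proof -
      note f1 = piece[OF L1_comp[OF v, of 1] u] and f2 = piece[OF L1_comp[OF v, of 2] u]
      have "piece_poly ?q r u y - (E $ 2 * V v r 1 u y - E $ 1 * V v r 2 u y) = 0" for y
      proof (rule pol_identity[OF bp_diff[OF piece(1)[OF q u] bp_diff[OF bp_scale[OF f1(1)] bp_scale[OF f2(1)]]] K_int[of u]])
        fix y assume y: "y \<in> K u"
        show "piece_poly ?q r u y - (E $ 2 * V v r 1 u y - E $ 1 * V v r 2 u y) = 0"
          using piece(2)[OF q u y] f1(2)[OF y] f2(2)[OF y] by (simp add: inner_vec_def sum_2 rot_right_def mult.commute)
      qed
      then have "piece_poly ?q r u = (\<lambda>y. E $ 2 * V v r 1 u y - E $ 1 * V v r 2 u y)" by (simp add: fun_eq_iff)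
      then show ?thesis
        unfolding Dir_def by (simp add: pd_diff[OF bp_scale[OF f1(1)] bp_scale[OF f2(1)]] pd_scale[OF f1(1)] pd_scale[OF f2(1)] algebra_simps)
    qed
    have KK: "K1 z i = K s" "K2 z i = K (Suc s)" unfolding K1_def K2_def K_def e2 i by simp_all
    let ?n = "outer_normal (K s) (closed_segment (z 0) ?b)"
    have "K s = convex hull {?b, z 0, p s}" unfolding K_def by (simp add: insert_commute)
    then have n1: "?n = (1 / norm (z 0 - ?b)) *\<^sub>R rot_right (z 0 - ?b)"
      using outer_normal_ccw[OF ccw_rotate[OF ccw_rotate[OF K_ccw[of s]]]] by (simp add: closed_segment_commute)
    have n2: "outer_normal (K (Suc s)) (closed_segment (z 0) ?b) = - ?n"
    proof -
      have "rot_right (?b - z 0) = - rot_right (z 0 - ?b)" by (simp add: rot_right_def vec_eq_iff forall_2)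
      then show ?thesis
        using outer_normal_ccw[OF K_ccw[of "Suc s"]] unfolding n1 by (simp add: K_def norm_minus_commute)
    qed
    have "(divergence v (K s) ?b - divergence v (K (Suc s)) ?b) *\<^sub>R ?n = 0"
      using c[OF i(1)] unfolding jump_def KK i(3)[symmetric] n2 by (simp add: scaleR_diff_left)
    moreover have "?n \<noteq> 0"
    proof -
      have "norm (rot_right (z 0 - ?b)) \<noteq> 0" unfolding norm_rot_right using p_ne(3)[of s] by simp
      then show ?thesis unfolding n1 using p_ne(3)[of s] by auto
    qed
    ultimately have "divergence v (K s) ?b = divergence v (K (Suc s)) ?b" by simp
    then have tr: "div_piece v r s ?b = div_piece v r (Suc s) ?b"
      using div_K[OF v s(2) K_p(3)] div_K[OF v s1 K_p(2)] by simp
    \<comment> \<open>The jump of the gradient of \<open>v\<close> across the spoke at the split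
      point. It kills the spoke direction by continuity, has trace 0 by (c), and its normal
      component along the edge is 0 by the previous step.\<close>
    let ?A = "\<lambda>i j. pd j (V v r i s) ?b - pd j (V v r i (Suc s)) ?b"
    have sp: "?A i 1 * ?S $ 1 + ?A i 2 * ?S $ 2 = 0" for i
      using spoke_Dir[OF L1_comp[OF v, of i] s(2) s1] by (simp add: Dir_def algebra_simps)
    have "Dir E (piece_poly ?q r s) ?b = 0" "Dir E (piece_poly ?q r (Suc s)) ?b = 0"
      using edge_Dir_K[OF q s Zq, folded E_def] by blast+
    then have n: "E $ 2 * (?A 1 1 * E $ 1 + ?A 1 2 * E $ 2) = E $ 1 * (?A 2 1 * E $ 1 + ?A 2 2 * E $ 2)"
      unfolding Fq[OF s(2)] Fq[OF s1] by (simp add: Dir_def algebra_simps)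
    have t0: "?A 1 1 + ?A 2 2 = 0" using tr by (simp add: div_piece_def)
    note DZ = Dir_linear_zero[OF spoke_edge_cross[OF s(1), folded E_def] sp sp n t0]
    \<comment> \<open>With the derivatives along the edge matching, the second alternative of the
      joining hypothesis becomes available for each Cartesian component.\<close>
    have join: "Dir E (V v r j s) ?b = Dir E (V v r j (Suc s)) ?b" for j
      using DZ exhaust_2[of j] by (auto simp: Dir_def algebra_simps)
    have "v (rim s t) $ j = 0 \<and> v (rim (Suc s) t) $ j = 0" for j
    proof -
      note qj = L1_comp[OF v, of j]
      have m: "integral {0..1} (\<lambda>t. v (rim u t) $ j * t ^ l) = 0" if "u < 6" "l + 2 \<le> r" for u l
        using mom[OF that, of "axis j 1"] by (simp add: inner_axis)
      have "v (p s) $ j = 0" "v (p (s + 2)) $ j = 0" using corner[of s] corner[of "s + 2"] s by simp_all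
      then show ?thesis
        using edge_zero[OF qj s(2,1) m _ _ piece[OF qj s(2)] piece[OF qj s1] disjI2[OF join[unfolded E_def]] t] by blast
    qed
    then show ?thesis by (simp add: vec_eq_iff)
  qed
  have bdry_zero_field: "bdry_zero_field v" unfolding bdry_zero_field_def bdry_zero_def
  proof (intro allI impI ballI)
    fix j and s :: nat and t :: real assume s: "s < 6" and t: "t \<in> {0..1}"
    show "v (rim s t) $ j = 0"
    proof (cases "even s")
      case True
      then show ?thesis using edge_v[OF True s t] by simp
    next
      case False
      then obtain u where u: "s = Suc u" "even u" by (cases s) auto
      then show ?thesis using edge_v[OF u(2) _ t] s by simp
    qed
  qed
  have v': "v \<in> L1_space (int (Suc k)) z" using v rk by simp
  have "div_piece v (Suc k) s x = 0" if "s < 6" for s x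
  proof (rule div_zero_of_moments[OF v' bdry_zero_field _ that])
    fix w assume "w \<in> V2_space (int k) z"
    then show "(\<Sum>s<6. integral (K s) (\<lambda>x. divergence v (K s) x * w (K s) x)) = 0"
      using g[of w] rk unfolding sum_split by simp
  qed
  from potential[OF v' bdry_zero_field this] obtain q where q: "q \<in> S0_space (int (Suc (Suc k))) z" "\<forall>x\<in>tri z. rot q (tri z) x = v x" by blast
  have "integral (tri z) (\<lambda>x. v x \<bullet> rot q (tri z) x) = 0"
  proof (rule f)
    have "int r + 1 = int (Suc (Suc k))" using rk by simp
    then show "q \<in> S0_space (int r + 1) z" using q(1) by metis
  qed
  moreover have "integral (tri z) (\<lambda>x. v x \<bullet> rot q (tri z) x) = integral (tri z) (\<lambda>x. v x \<bullet> v x)"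
    by (rule integral_cong) (simp add: q(2))
  moreover have cont: "continuous_on (tri z) (\<lambda>x. v x \<bullet> v x)"
    by (intro continuous_on_inner L1_continuous[OF v])
  ultimately have int: "((\<lambda>x. v x \<bullet> v x) has_integral 0) (tri z)"
    using integrable_on_compact[OF tri_compact cont] by (simp add: has_integral_iff)
  show ?thesis
  proof
    fix x
    show "v x = 0 x"
    proof (cases "x \<in> tri z")
      case True
      have "v x \<bullet> v x = 0"
        by (rule integral_zero_imp_zero[OF tri_convex tri_compact tri_interior cont _ int True]) simp
      then show ?thesis by simp
    next
      case False
      then show ?thesis using CP_zero[OF L1_comp[OF v]] by (simp add: vec_eq_iff)
    qed
  qed
qed

end

theorem lemma4p5:
  fixes z :: "nat \<Rightarrow> real^2" and r :: nat
  assumes "powell_sabin_points z" and "r \<ge> 1"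
  shows "num_edge_dofs r z = 12 * (r - 1) \<and>
    dim (S0_space (int r + 1) z) = 3 * (r - 1) * (r - 2) \<and>
    dim (V2_space (int r - 1) z) = 3 * r * (r + 1) - 4 \<and>
    dim (L1_space (int r) z) = 6 * r^2 + 6 * r + 2 \<and>
    num_dofs r z = dim (L1_space (int r) z) \<and>
    (\<forall>v \<in> L1_space (int r) z.
      (\<forall>i\<in>{1..3}. v (z i) = 0) \<and>
      (r = 1 \<longrightarrow> (\<forall>i\<in>{1..3}. segment_integral (z (nx i)) (z (nx (nx i)))
                     (\<lambda>x. v x \<bullet> outer_normal (tri z) (edge z i)) = 0)) \<and>
      (\<forall>i\<in>{1..3}. jump z (divergence v) i = 0) \<and>
      (r \<ge> 2 \<longrightarrow> (\<forall>i\<in>{1..3}. v (z (3 + i)) \<bullet> outer_normal (tri z) (edge z i) = 0)) \<and>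
      (\<forall>(a, b)\<in>bdry_edges z. \<forall>w\<in>vpoly_on (int r - 2) (closed_segment a b).
          segment_integral a b (\<lambda>x. v x \<bullet> w x) = 0) \<and>
      (\<forall>w\<in>S0_space (int r + 1) z. integral (tri z) (\<lambda>x. v x \<bullet> rot w (tri z) x) = 0) \<and>
      (\<forall>w\<in>V2_space (int r - 1) z.
          (\<Sum>K\<in>ps_split z. integral K (\<lambda>x. divergence v K x * w K x)) = 0)
      \<longrightarrow> v = 0)"
proof -
  interpret powell_sabin z by unfold_locales (rule assms(1))
  obtain k where k: "r = Suc k" using assms(2) by (cases r) auto
  have i1: "int r + 1 = int (k + 2)" "int r - 1 = int k" using k by simp_all
  have e: "num_edge_dofs r z = 12 * (r - 1)" by (rule num_edge_dofs_eq[OF assms(2)])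
  have s: "dim (S0_space (int r + 1) z) = 3 * (r - 1) * (r - 2)" 
  proof -
    have "dim (S0_space (int r + 1) z) = 3 * k * (k - 1)" unfolding i1 by (rule S0_dim)
    then show ?thesis using k by simp
  qed
  have v: "dim (V2_space (int r - 1) z) = 3 * r * (r + 1) - 4"
  proof -
    have "dim (V2_space (int r - 1) z) + 4 = 3 * r * (r + 1)" unfolding i1 V2_dim(1) using k by (simp add: algebra_simps)
    then show ?thesis by (metis add_diff_cancel_right')
  qed
  have l: "dim (L1_space (int r) z) = 6 * r^2 + 6 * r + 2" by (rule L1_dim)
  \<comment> \<open>Exactly one of the families (b) and (d) is present: 6 + 3 + 3 + 12 (r - 1) + 3
    (r - 1) (r - 2) + 3 r (r + 1) - 4 = 6 r^2 + 6 r + 2.\<close>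
  have n: "num_dofs r z = dim (L1_space (int r) z)"
    unfolding num_dofs_def e s v l
    by (cases k) (simp_all add: k power2_eq_square algebra_simps)
  show ?thesis
    by (intro conjI e s v l n ballI impI, elim conjE, rule unisolvence[OF _ assms(2)]) (assumption | blast)+
qed

end
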